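(* Let $M$ be a $d$-dimensional smooth Riemannian manifold, $f:M\to M$ a $C^1$ map, and $J\subset M$ an average conformal repeller of $f$. Let $\mu\in\mathcal{M}(f|_J)$ be an $f$-invariant Borel probability measure supported on $J$. For any ergodic decomposition $\tau$ of $\mu$, $$\dim_H\mu=\operatorname{ess\,sup}\{\dim_H\nu:\nu\in\mathcal{E}(f|_J)\},$$ where the essential supremum is taken with respect to $\tau$.
   Context: $\mathcal{M}(f|_J)$ and $\mathcal{E}(f|_J)$ denote the sets of $f$-invariant, respectively ergodic $f$-invariant, Borel probability measures supported on $J$. A compact $f$-invariant set $J\subset M$ is a repeller of $f$ if (1) there is an open neighbourhood $U$ of $J$ with $J=\{x\in U:f^n(x)\in U\ \forall n\ge0\}$, and (2) there exist $\kappa>1$ and $C>0$ such that $\|D_xf^n(v)\|\ge C\kappa^n\|v\|$ for all $x\in J$, $v\in T_xM$, $n\ge1$. It is an average conformal repeller if moreover for every $\nu\in\mathcal{E}(f|_J)$ the Lyapunov exponents $\lambda_1(\nu)\le\dots\le\lambda_d(\nu)$ of $\nu$ (the values of $\lim_{n\to\infty}\frac1n\log\|D_xf^n(v)\|$ given by Oseledec's theorem) satisfy $\lambda_1(\nu)=\dots=\lambda_d(\nu)>0$. A Borel probability measure $\tau$ on $\mathcal{M}(f|_J)$ (weak-star topology) is an ergodic decomposition of $\mu$ if $\tau(\mathcal{E}(f|_J))=1$ and $\int\psi\,d\mu=\int_{\mathcal{E}(f|_J)}\big(\int\psi\,d\nu\big)d\tau(\nu)$ for every $\psi\in L^1(\mu)$.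 The Hausdorff dimension of a Borel probability measure $\nu$ on $M$ is $\dim_H\nu=\inf\{\dim_HZ:Z\subset M,\ \nu(Z)=1\}$, where $\dim_HZ$ is the usual Hausdorff dimension. *)

theory Defs
  imports "HOL-Probability.Probability"
begin

section \<open>Smooth manifolds\<close>

text \<open>
  The manifold \<open>M\<close> is the whole of a Hausdorff, second countable type \<open>'a\<close>; the model space is
  a Euclidean space \<open>'b\<close>, so the dimension \<open>d\<close> is \<open>DIM('b)\<close>. A chart \<open>(U, \<phi>)\<close> is only
  meaningful on \<open>U\<close>; its inverse is \<open>inv_into U \<phi>\<close>.
\<close>

type_synonym ('a, 'b) chart = "'a set \<times> ('a \<Rightarrow> 'b)"

definition is_chart :: "('a::topological_space, 'b::euclidean_space) chart \<Rightarrow> bool" where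
  "is_chart c \<longleftrightarrow> open (fst c) \<and> open (snd c ` fst c) \<and>
     homeomorphism (fst c) (snd c ` fst c) (snd c) (inv_into (fst c) (snd c))"

text \<open>\<open>Ck_on k S F\<close>: \<open>F\<close> is of class \<open>C\<close>-\<open>k\<close> on \<open>S\<close>. Only meant for open \<open>S\<close>.\<close>

fun Ck_on :: "nat \<Rightarrow> 'b::euclidean_space set \<Rightarrow> ('b \<Rightarrow> 'c::real_normed_vector) \<Rightarrow> bool" where
  "Ck_on 0 S F \<longleftrightarrow> continuous_on S F"
| "Ck_on (Suc k) S F \<longleftrightarrow> (\<forall>x\<in>S. F differentiable (at x)) \<and>
     (\<forall>v. Ck_on k S (\<lambda>x. frechet_derivative F (at x) v))"

definition smooth_on :: "'b::euclidean_space set \<Rightarrow> ('b \<Rightarrow> 'c::real_normed_vector) \<Rightarrow> bool" where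
  "smooth_on S F \<longleftrightarrow> (\<forall>k. Ck_on k S F)"

text \<open>
  The representative of \<open>f\<close> in the charts \<open>c\<close> (source) and \<open>c'\<close> (target). It is meaningful on
  \<open>snd c ` (fst c \<inter> f -` fst c')\<close>; for \<open>f = id\<close> it is the transition map.
\<close>

definition local_rep ::
  "('a, 'b) chart \<Rightarrow> ('a, 'b) chart \<Rightarrow> ('a \<Rightarrow> 'a) \<Rightarrow> 'b::euclidean_space \<Rightarrow> 'b" where
  "local_rep c c' f = snd c' \<circ> f \<circ> inv_into (fst c) (snd c)"

definition smooth_atlas :: "('a::topological_space, 'b::euclidean_space) chart set \<Rightarrow> bool" where
  "smooth_atlas A \<longleftrightarrow> (\<forall>c\<in>A. is_chart c) \<and> (\<Union>c\<in>A. fst c) = UNIV \<and>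
     (\<forall>c\<in>A. \<forall>c'\<in>A. smooth_on (snd c ` (fst c \<inter> fst c')) (local_rep c c' id))"

definition C1_map ::
  "('a::topological_space, 'b::euclidean_space) chart set \<Rightarrow> ('a \<Rightarrow> 'a) \<Rightarrow> bool" where
  "C1_map A f \<longleftrightarrow> continuous_on UNIV f \<and>
     (\<forall>c\<in>A. \<forall>c'\<in>A. Ck_on 1 (snd c ` (fst c \<inter> f -` fst c')) (local_rep c c' f))"

text \<open>
  The tangent space at \<open>x\<close> is the model space \<open>'b\<close>, a vector being identified with its
  coordinates in one preferred chart around \<open>x\<close>, chosen once and for all. The coordinates of the
  same vector in another chart are obtained by differentiating the transition map.
\<close>

definition chart_at :: "('a, 'b) chart set \<Rightarrow> 'a \<Rightarrow> ('a, 'b) chart" where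
  "chart_at A x = (SOME c. c \<in> A \<and> x \<in> fst c)"

definition differential ::
  "('a, 'b::euclidean_space) chart set \<Rightarrow> ('a \<Rightarrow> 'a) \<Rightarrow> 'a \<Rightarrow> 'b \<Rightarrow> 'b" where
  "differential A f x =
     frechet_derivative (local_rep (chart_at A x) (chart_at A (f x)) f) (at (snd (chart_at A x) x))"

text \<open>The tangent vector at \<open>p\<close> whose coordinates in the chart \<open>c\<close> are \<open>v\<close>.\<close>

definition from_chart ::
  "('a, 'b::euclidean_space) chart set \<Rightarrow> ('a, 'b) chart \<Rightarrow> 'a \<Rightarrow> 'b \<Rightarrow> 'b" where
  "from_chart A c p = frechet_derivative (local_rep c (chart_at A p) id) (at (snd c p))"


section \<open>Riemannian metrics\<close>

text \<open>
  The preferred chart jumps from point to point, so \<open>x \<mapsto> g x v w\<close> need not be continuous for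
  fixed \<open>v\<close>, \<open>w\<close>. Smoothness is required of the metric coefficients in every chart.
\<close>

definition riemannian_metric ::
  "('a, 'b::euclidean_space) chart set \<Rightarrow> ('a \<Rightarrow> 'b \<Rightarrow> 'b \<Rightarrow> real) \<Rightarrow> bool" where
  "riemannian_metric A g \<longleftrightarrow>
     (\<forall>x. bilinear (g x) \<and> (\<forall>v w. g x v w = g x w v) \<and> (\<forall>v. v \<noteq> 0 \<longrightarrow> g x v v > 0)) \<and>
     (\<forall>c\<in>A. \<forall>i\<in>Basis. \<forall>j\<in>Basis. smooth_on (snd c ` fst c)
        (\<lambda>y. let p = inv_into (fst c) (snd c) y
             in g p (from_chart A c p i) (from_chart A c p j)))"

definition tangent_norm :: "('a \<Rightarrow> 'b \<Rightarrow> 'b \<Rightarrow> real) \<Rightarrow> 'a \<Rightarrow> 'b \<Rightarrow> real" where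
  "tangent_norm g x v = sqrt (g x v v)"

definition piecewise_C1_curve ::
  "('a::topological_space, 'b::euclidean_space) chart set \<Rightarrow> (real \<Rightarrow> 'a) \<Rightarrow> bool" where
  "piecewise_C1_curve A \<gamma> \<longleftrightarrow> path \<gamma> \<and>
     (\<forall>c\<in>A. \<forall>a b. 0 \<le> a \<and> a \<le> b \<and> b \<le> 1 \<and> \<gamma> ` {a..b} \<subseteq> fst c \<longrightarrow>
        (snd c \<circ> \<gamma>) piecewise_C1_differentiable_on {a..b})"

text \<open>
  For a piecewise \<open>C\<close>-1 curve the velocity is junk at finitely many times only, which does not
  affect the length.
\<close>

definition velocity ::
  "('a, 'b::euclidean_space) chart set \<Rightarrow> (real \<Rightarrow> 'a) \<Rightarrow> real \<Rightarrow> 'b" where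
  "velocity A \<gamma> t = vector_derivative (snd (chart_at A (\<gamma> t)) \<circ> \<gamma>) (at t)"

definition curve_length ::
  "('a, 'b::euclidean_space) chart set \<Rightarrow> ('a \<Rightarrow> 'b \<Rightarrow> 'b \<Rightarrow> real) \<Rightarrow> (real \<Rightarrow> 'a) \<Rightarrow> ennreal" where
  "curve_length A g \<gamma> =
     (\<integral>\<^sup>+t\<in>{0..1}. ennreal (tangent_norm g (\<gamma> t) (velocity A \<gamma> t)) \<partial>lborel)"

text \<open>\<open>M\<close> need not be connected: the distance between different components is \<open>\<top>\<close>.\<close>

definition riemannian_dist ::
  "('a::topological_space, 'b::euclidean_space) chart set \<Rightarrow> ('a \<Rightarrow> 'b \<Rightarrow> 'b \<Rightarrow> real) \<Rightarrow>
     'a \<Rightarrow> 'a \<Rightarrow> ennreal" where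
  "riemannian_dist A g x y =
     Inf {curve_length A g \<gamma> | \<gamma>. piecewise_C1_curve A \<gamma> \<and> pathstart \<gamma> = x \<and> pathfinish \<gamma> = y}"


section \<open>Hausdorff dimension\<close>

definition ediameter :: "('a \<Rightarrow> 'a \<Rightarrow> ennreal) \<Rightarrow> 'a set \<Rightarrow> ennreal" where
  "ediameter \<rho> S = (SUP x\<in>S. SUP y\<in>S. \<rho> x y)"

text \<open>
  The covering sets have finite diameter, so \<open>enn2real\<close> is faithful here. Only exponents
  \<open>s > 0\<close> are used below, so the value of \<open>0 powr 0\<close> plays no role.
\<close>

definition hausdorff_premeasure ::
  "('a \<Rightarrow> 'a \<Rightarrow> ennreal) \<Rightarrow> real \<Rightarrow> real \<Rightarrow> 'a set \<Rightarrow> ennreal" where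
  "hausdorff_premeasure \<rho> s \<delta> Z =
     Inf {(\<Sum>i. ennreal (enn2real (ediameter \<rho> (U i)) powr s)) | U :: nat \<Rightarrow> 'a set.
            Z \<subseteq> (\<Union>i. U i) \<and> (\<forall>i. ediameter \<rho> (U i) \<le> ennreal \<delta>)}"

definition hausdorff_outer_measure ::
  "('a \<Rightarrow> 'a \<Rightarrow> ennreal) \<Rightarrow> real \<Rightarrow> 'a set \<Rightarrow> ennreal" where
  "hausdorff_outer_measure \<rho> s Z = (SUP \<delta>\<in>{0<..}. hausdorff_premeasure \<rho> s \<delta> Z)"

definition hausdorff_dim :: "('a \<Rightarrow> 'a \<Rightarrow> ennreal) \<Rightarrow> 'a set \<Rightarrow> ennreal" where
  "hausdorff_dim \<rho> Z = Inf {ennreal s | s. s > 0 \<and> hausdorff_outer_measure \<rho> s Z = 0}"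

definition hausdorff_dim_measure ::
  "('a::topological_space \<Rightarrow> 'a \<Rightarrow> ennreal) \<Rightarrow> 'a measure \<Rightarrow> ennreal" where
  "hausdorff_dim_measure \<rho> \<nu> = Inf {hausdorff_dim \<rho> Z | Z. Z \<in> sets borel \<and> emeasure \<nu> Z = 1}"


section \<open>Invariant measures and ergodic decompositions\<close>

definition invariant_measures ::
  "('a::topological_space \<Rightarrow> 'a) \<Rightarrow> 'a set \<Rightarrow> 'a measure set" where
  "invariant_measures f J = {\<nu>. prob_space \<nu> \<and> sets \<nu> = sets borel \<and> emeasure \<nu> J = 1 \<and>
     (\<forall>B\<in>sets borel. emeasure \<nu> (f -` B) = emeasure \<nu> B)}"

definition ergodic_measures ::
  "('a::topological_space \<Rightarrow> 'a) \<Rightarrow> 'a set \<Rightarrow> 'a measure set" where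
  "ergodic_measures f J = {\<nu> \<in> invariant_measures f J.
     \<forall>B\<in>sets borel. f -` B = B \<longrightarrow> emeasure \<nu> B = 0 \<or> emeasure \<nu> B = 1}"

text \<open>
  The weak-star topology is the coarsest one making \<open>\<nu> \<mapsto> \<integral>\<psi> d\<nu>\<close> continuous for all
  \<open>\<psi> \<in> C(J)\<close>. Its underlying set is \<open>invariant_measures f J\<close>.
\<close>

definition weak_star_topology ::
  "('a::topological_space \<Rightarrow> 'a) \<Rightarrow> 'a set \<Rightarrow> 'a measure topology" where
  "weak_star_topology f J = topology_generated_by
     {{\<nu> \<in> invariant_measures f J. (LINT x:J|\<nu>. \<psi> x) \<in> V} | (\<psi> :: 'a \<Rightarrow> real) V.
        continuous_on J \<psi> \<and> open V}"

definition borel_invariant_measures ::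
  "('a::topological_space \<Rightarrow> 'a) \<Rightarrow> 'a set \<Rightarrow> 'a measure measure" where
  "borel_invariant_measures f J =
     sigma (invariant_measures f J) {W. openin (weak_star_topology f J) W}"

text \<open>
  The Bochner integral is 0 on non-integrable functions, so the existence of the two integrals on
  the right of the decomposition formula is spelled out.
\<close>

definition ergodic_decomposition ::
  "('a::topological_space \<Rightarrow> 'a) \<Rightarrow> 'a set \<Rightarrow> 'a measure \<Rightarrow> 'a measure measure \<Rightarrow> bool" where
  "ergodic_decomposition f J \<mu> \<tau> \<longleftrightarrow>
     prob_space \<tau> \<and> sets \<tau> = sets (borel_invariant_measures f J) \<and>
     emeasure \<tau> (ergodic_measures f J) = 1 \<and>
     (\<forall>\<psi> :: 'a \<Rightarrow> real. integrable \<mu> \<psi> \<longrightarrow>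
        (AE \<nu> in \<tau>. integrable \<nu> \<psi>) \<and>
        set_integrable \<tau> (ergodic_measures f J) (\<lambda>\<nu>. LINT x|\<nu>. \<psi> x) \<and>
        (LINT x|\<mu>. \<psi> x) = (LINT \<nu>:ergodic_measures f J|\<tau>. (LINT x|\<nu>. \<psi> x)))"

text \<open>
  Unlike \<open>esssup\<close>, which is \<open>\<top>\<close> on non-measurable functions, this does not depend on
  the measurability of \<open>F\<close>; the two agree for measurable \<open>F\<close> if \<open>E\<close> has full measure.
\<close>

definition essential_sup_on :: "'c measure \<Rightarrow> 'c set \<Rightarrow> ('c \<Rightarrow> ennreal) \<Rightarrow> ennreal" where
  "essential_sup_on \<tau> E F = Inf {z. AE \<nu> in \<tau>. \<nu> \<in> E \<longrightarrow> F \<nu> \<le> z}"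


section \<open>Average conformal repellers\<close>

definition repeller ::
  "('a::topological_space, 'b::euclidean_space) chart set \<Rightarrow> ('a \<Rightarrow> 'b \<Rightarrow> 'b \<Rightarrow> real) \<Rightarrow>
     ('a \<Rightarrow> 'a) \<Rightarrow> 'a set \<Rightarrow> bool" where
  "repeller A g f J \<longleftrightarrow> compact J \<and> f ` J \<subseteq> J \<and>
     (\<exists>U. open U \<and> J \<subseteq> U \<and> J = {x \<in> U. \<forall>n. (f ^^ n) x \<in> U}) \<and>
     (\<exists>\<kappa> C. \<kappa> > 1 \<and> C > 0 \<and> (\<forall>x\<in>J. \<forall>v. \<forall>n\<ge>1.
        tangent_norm g ((f ^^ n) x) (differential A (f ^^ n) x v) \<ge> C * \<kappa> ^ n * tangent_norm g x v))"

text \<open>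
  \<open>L 1 \<le> \<dots> \<le> L d\<close> are the Lyapunov exponents of \<open>\<nu>\<close>, listed with multiplicity: at almost
  every point the limit \<open>ell v\<close> exists for each tangent vector \<open>v \<noteq> 0\<close>, and the members
  \<open>{v. v = 0 \<or> ell v \<le> t}\<close> of the Oseledets filtration have the dimension prescribed by \<open>L\<close>.
  Real-valued limits suffice, since \<open>D f^n\<close> is uniformly expanding on a repeller.
\<close>

definition lyapunov_exponents ::
  "('a::topological_space, 'b::euclidean_space) chart set \<Rightarrow> ('a \<Rightarrow> 'b \<Rightarrow> 'b \<Rightarrow> real) \<Rightarrow>
     ('a \<Rightarrow> 'a) \<Rightarrow> 'a measure \<Rightarrow> (nat \<Rightarrow> real) \<Rightarrow> bool" where
  "lyapunov_exponents A g f \<nu> L \<longleftrightarrow>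
     mono_on {1..DIM('b)} L \<and>
     (AE x in \<nu>. \<exists>ell :: 'b \<Rightarrow> real.
        (\<forall>v. v \<noteq> 0 \<longrightarrow>
          (\<lambda>n. ln (tangent_norm g ((f ^^ n) x) (differential A (f ^^ n) x v)) / real n)
            \<longlonglongrightarrow> ell v) \<and>
        (\<forall>t. dim {v. v = 0 \<or> ell v \<le> t} = card {i \<in> {1..DIM('b)}. L i \<le> t}))"

definition average_conformal_repeller ::
  "('a::topological_space, 'b::euclidean_space) chart set \<Rightarrow> ('a \<Rightarrow> 'b \<Rightarrow> 'b \<Rightarrow> real) \<Rightarrow>
     ('a \<Rightarrow> 'a) \<Rightarrow> 'a set \<Rightarrow> bool" where
  "average_conformal_repeller A g f J \<longleftrightarrow> repeller A g f J \<and>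
     (\<forall>\<nu>\<in>ergodic_measures f J. \<exists>L. lyapunov_exponents A g f \<nu> L \<and>
        (\<forall>i\<in>{1..DIM('b)}. L i = L 1 \<and> L i > 0))"

end

theory Submission
  imports Defs
begin

text \<open>
  If \<open>\<mu> Z = 1\<close> then \<open>\<nu> Z = 1\<close> for almost every ergodic component \<open>\<nu>\<close>, which gives one inequality.
  For the other one, let \<open>t < t'\<close> and let \<open>\<nu>\<close> be an ergodic measure with exponent \<open>\<lambda>\<close> that is carried
  by a \<open>t\<close>-null set. Cover most of this set by finitely many open sets \<open>V i\<close> with
  \<open>\<Sum>i. exp (- t \<lambda> l i) < 1/2\<close>, where \<open>exp (- \<lambda> l i)\<close> is about the diameter of \<open>V i\<close>, so that
  \<open>V i\<close> stays small for \<open>l i\<close> steps. An orbit that visits the union of the \<open>V i\<close> and a set of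
  good expansion with frequency close to 1 is coded by a sequence of blocks, one of length \<open>l i\<close>
  for each visit to \<open>V i\<close>. Multiplicativity of the expansion turns the bound above into covers of
  the set of all such points, which is therefore \<open>t'\<close>-null. This set is determined by
  finitely many rational parameters and a finite family of basic open sets. Hence the union over
  all parameters for which it is \<open>t'\<close>-null is a single \<open>t'\<close>-null set that has full measure for
  every ergodic measure of dimension less than \<open>t\<close>, and therefore for \<open>\<mu>\<close>. No entropy is needed.
\<close>

section \<open>Visits and the maximal ergodic theorem\<close>

text \<open>The obstacle is that \<open>\<tau>\<close> may charge uncountably many ergodic measures,
  whose null carriers cannot be united; a carrier is therefore used only to find block lengths and
  open sets. Blocks are weighted as in Kraft's inequality: the long ones receive total weight at
  most 1/2, the other half is shared, as weight \<open>\<theta>\<close> each, by the pieces of a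
  finite cover that code single bad steps. Bad steps may be expensive because they are rare. But the
  cover depends on the scale at which growth is seen, so \<open>\<theta>\<close> is known only after
  the growth set, and the admissible frequency of bad steps only after \<open>\<theta>\<close>.
  Ergodicity breaks this circle: for a fixed growth set, an additive constant \<open>q\<close> in
  the frequency bound yields almost full measure, and \<open>q\<close> affects only the first cover,
  not the rates. Two choices serve this scheme. Growth is demanded of pairs of points, at times
  depending on the pair, since the lower rate is obtained direction by direction. Distances are
  measured by a real-valued \<open>d\<close> that is bi-Lipschitz to the charts near
  \<open>J\<close>, as the Riemannian distance is infinite between components.\<close>

definition visits :: "('a \<Rightarrow> 'a) \<Rightarrow> 'a set \<Rightarrow> nat \<Rightarrow> 'a \<Rightarrow> nat" where
  "visits f B n x = card {j. j < n \<and> (f ^^ j) x \<in> B}"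

lemma visits_0 [simp]: "visits f B 0 x = 0"
  by (simp add: visits_def)

lemma visits_Suc: "visits f B (Suc n) x = (if x \<in> B then 1 else 0) + visits f B n (f x)"
proof -
  have eq: "{j. j < Suc n \<and> (f ^^ j) x \<in> B} =
      (if x \<in> B then {0} else {}) \<union> Suc ` {j. j < n \<and> (f ^^ j) (f x) \<in> B}" (is "_ = ?A \<union> Suc ` ?R")
  proof (rule set_eqI)
    fix j show "j \<in> {j. j < Suc n \<and> (f ^^ j) x \<in> B} \<longleftrightarrow> j \<in> ?A \<union> Suc ` ?R"
      by (cases j) (auto simp: funpow_swap1)
  qed
  have "card (?A \<union> Suc ` ?R) = card ?A + card (Suc ` ?R)"
    by (rule card_Un_disjoint) auto
  then show ?thesis
    unfolding visits_def eq by (auto simp: card_image)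
qed

lemma visits_add: "visits f B (m + n) x = visits f B m x + visits f B n ((f ^^ m) x)"
  by (induction m arbitrary: x) (auto simp: visits_Suc funpow_swap1)

text \<open>The maximum over 0 \<le> m \<le> n of the Birkhoff sums of \<open>h\<close> over m
  steps, computed by splitting off the first step.\<close>

primrec excess_max :: "('a \<Rightarrow> 'a) \<Rightarrow> ('a \<Rightarrow> real) \<Rightarrow> nat \<Rightarrow> 'a \<Rightarrow> real" where
  "excess_max f h 0 x = 0"
| "excess_max f h (Suc n) x = max 0 (h x + excess_max f h n (f x))"

lemma excess_max_nonneg: "0 \<le> excess_max f h n x"
  by (cases n) auto

lemma excess_max_mono: "excess_max f h n x \<le> excess_max f h (Suc n) x"
proof (induction n arbitrary: x)
  case 0 then show ?case by simp
next
  case (Suc n)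
  have "excess_max f h n (f x) \<le> excess_max f h (Suc n) (f x)" by (rule Suc.IH)
  then show ?case by simp
qed

lemma excess_max_le: "(\<And>x. h x \<le> 1) \<Longrightarrow> excess_max f h n x \<le> real n"
proof (induction n arbitrary: x)
  case (Suc n)
  have "excess_max f h n (f x) \<le> real n" by (rule Suc.IH[OF Suc.prems])
  with Suc.prems[of x] show ?case by simp
qed simp

text \<open>The left side is the Birkhoff sum over n steps of the function on the right, hence one
  of the sums in the maximum.\<close>

lemma visits_le_excess_max:
  "real (visits f B n x) - e * real n \<le> excess_max f (\<lambda>x. indicator B x - e) n x"
proof (induction n arbitrary: x)
  case (Suc n)
  show ?case using Suc.IH[of "f x"]
    by (auto simp: visits_Suc algebra_simps indicator_def)
qed simp

text \<open>Garsia's proof of the maximal ergodic theorem, applied to \<open>indicator B - e\<close>.\<close>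

lemma maximal_visits:
  assumes "prob_space M" and f[measurable]: "f \<in> M \<rightarrow>\<^sub>M M" and inv: "distr M M f = M"
    and B[measurable]: "B \<in> sets M" and e: "0 < e"
    and C[measurable]: "C \<in> sets M"
    and C_sub: "\<And>x. x \<in> C \<Longrightarrow> \<exists>n. real (visits f B n x) > e * real n"
  shows "measure M C \<le> measure M B / e"
proof -
  interpret prob_space M by fact
  define h where "h = (\<lambda>x. indicator B x - e)"
  define m where "m = excess_max f h"
  have h_le: "h x \<le> 1" for x using e by (simp add: h_def indicator_def)
  have h_meas[measurable]: "h \<in> borel_measurable M" unfolding h_def by measurable
  have m_Suc: "m (Suc n) = (\<lambda>x. max 0 (h x + m n (f x)))" for n
    by (rule ext) (simp add: m_def)
  have m_meas[measurable]: "m n \<in> borel_measurable M" for n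
  proof (induction n)
    case 0 have "m 0 = (\<lambda>x. 0)" by (rule ext) (simp add: m_def) then show ?case by simp
  next
    case (Suc n) then have [measurable]: "m n \<in> borel_measurable M" .
    show ?case unfolding m_Suc by measurable
  qed
  have bnd: "norm (m n x) \<le> real n" for n x
    using excess_max_nonneg[of f h n x] excess_max_le[of h f n x, OF h_le] by (simp add: m_def)
  have m_int: "integrable M (m n)" for n
    by (rule integrable_const_bound[where B="real n"]) (use bnd in \<open>auto intro!: AE_I2\<close>)
  have mf_int: "integrable M (\<lambda>x. m n (f x))" for n
    by (rule integrable_const_bound[where B="real n"]) (use bnd in \<open>auto intro!: AE_I2\<close>)
  have inv_int: "(\<integral>x. m n (f x) \<partial>M) = (\<integral>x. m n x \<partial>M)" for n
    using integral_distr[of f M M "m n"] inv by simp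
  define P where "P n = {x \<in> space M. 0 < m n x}" for n
  have P_meas[measurable]: "P n \<in> sets M" for n unfolding P_def by measurable
  have key: "e * measure M (P n) \<le> measure M B" for n
  proof (cases n)
    case 0 then show ?thesis by (simp add: P_def m_def)
  next
    case (Suc k)
    \<comment> \<open>Garsia's inequality. Where \<open>m n\<close> is positive, the maximum with 0
      is inactive, so \<open>m n x - h x\<close> is \<open>m k (f x)\<close>, which is at most
      \<open>m n (f x)\<close>. Elsewhere \<open>m n x\<close> is 0 and \<open>m n (f x)\<close> is
      nonnegative.\<close>
    have pw: "m n x - m n (f x) \<le> indicator (B \<inter> P n) x - e * indicator (P n) x" if "x \<in> space M" for x
    proof (cases "0 < m n x")
      case True
      then have "m n x = h x + m k (f x)" unfolding Suc m_Suc by auto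
      moreover have "m k (f x) \<le> m n (f x)" unfolding Suc m_def by (rule excess_max_mono)
      ultimately show ?thesis using True that by (auto simp: h_def P_def indicator_def)
    next
      case False
      then have "m n x = 0" "0 \<le> m n (f x)"
        using excess_max_nonneg[of f h] by (auto simp: m_def order.antisym not_less)
      then show ?thesis using False by (auto simp: P_def)
    qed
    have ind_int: "integrable M (indicator S :: _ \<Rightarrow> real)" if "S \<in> sets M" for S
      using that by (simp add: less_top[symmetric])
    have BP: "B \<inter> P n \<in> sets M" by simp
    note ind_int = ind_int[OF BP] ind_int[OF P_meas]
    \<comment> \<open>By invariance both terms have the same integral, which is finite since
      \<open>m n\<close> lies between 0 and n.\<close>
    have "0 = (\<integral>x. m n x - m n (f x) \<partial>M)"
      using m_int mf_int inv_int by simp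
    also have "\<dots> \<le> (\<integral>x. indicator (B \<inter> P n) x - e * indicator (P n) x \<partial>M)"
      by (rule integral_mono) (use m_int mf_int pw ind_int in \<open>auto intro!: Bochner_Integration.integrable_diff\<close>)
    also have "\<dots> = measure M (B \<inter> P n) - e * measure M (P n)"
      using ind_int by (simp add: Int_absorb2 sets.sets_into_space)
    also have "measure M (B \<inter> P n) \<le> measure M B"
      by (rule finite_measure_mono) auto
    finally show ?thesis by simp
  qed
  have inc: "incseq P"
    unfolding incseq_Suc_iff P_def m_def using excess_max_mono[of f h] by (auto intro: less_le_trans)
  have "(\<lambda>n. measure M (P n)) \<longlonglongrightarrow> measure M (\<Union>n. P n)"
    by (rule finite_Lim_measure_incseq) (use inc in auto)
  then have "e * measure M (\<Union>n. P n) \<le> measure M B"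
    by (intro LIMSEQ_le_const2[OF tendsto_mult_left]) (use key in auto)
  moreover have "C \<subseteq> (\<Union>n. P n)"
  proof
    fix x assume x: "x \<in> C"
    then obtain n where n: "real (visits f B n x) > e * real n" using C_sub by blast
    have "x \<in> space M" using x C sets.sets_into_space by blast
    with visits_le_excess_max[of f B n x e] n show "x \<in> (\<Union>n. P n)"
      unfolding P_def m_def h_def by (force intro!: exI[of _ n])
  qed
  then have "measure M C \<le> measure M (\<Union>n. P n)"
    by (intro finite_measure_mono) auto
  ultimately have "e * measure M C \<le> measure M B"
    using e by (meson mult_left_mono less_imp_le order_trans)
  then show ?thesis using e by (simp add: field_simps)
qed

section \<open>Null sets of Hausdorff measures\<close>

lemma ediameter_leI: "(\<And>x y. x \<in> S \<Longrightarrow> y \<in> S \<Longrightarrow> \<rho> x y \<le> c) \<Longrightarrow> ediameter \<rho> S \<le> c"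
  unfolding ediameter_def by (intro SUP_least) auto

lemma ediameter_upper: "x \<in> S \<Longrightarrow> y \<in> S \<Longrightarrow> \<rho> x y \<le> ediameter \<rho> S"
  unfolding ediameter_def by (rule order_trans[OF SUP_upper SUP_upper[of x S "\<lambda>x. SUP y\<in>S. \<rho> x y"]])

text \<open>Only the vanishing of Hausdorff measures matters for dimensions, so the supremum over
  scales and the infimum over covers are unfolded once and for all into the existence of cheap
  covers.\<close>

lemma hausdorff_null_iff:
  "hausdorff_outer_measure \<rho> s Z = 0 \<longleftrightarrow> (\<forall>\<delta>>0. \<forall>\<epsilon>>0. \<exists>U :: nat \<Rightarrow> _. Z \<subseteq> (\<Union>i. U i) \<and>
     (\<forall>i. ediameter \<rho> (U i) \<le> ennreal \<delta>) \<and>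
     (\<Sum>i. ennreal (enn2real (ediameter \<rho> (U i)) powr s)) \<le> ennreal \<epsilon>)" (is "_ \<longleftrightarrow> (\<forall>\<delta>>0. ?P \<delta>)")
proof -
  have pre: "hausdorff_premeasure \<rho> s \<delta> Z = 0 \<longleftrightarrow> ?P \<delta>" for \<delta>
  proof -
    define S where "S = {(\<Sum>i. ennreal (enn2real (ediameter \<rho> (U i)) powr s)) | U :: nat \<Rightarrow> _.
      Z \<subseteq> (\<Union>i. U i) \<and> (\<forall>i. ediameter \<rho> (U i) \<le> ennreal \<delta>)}"
    have "Inf S = 0 \<longleftrightarrow> (\<forall>\<epsilon>>0. \<exists>c\<in>S. c \<le> ennreal \<epsilon>)"
    proof
      assume 0: "Inf S = 0"
      show "\<forall>\<epsilon>>0. \<exists>c\<in>S. c \<le> ennreal \<epsilon>"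
      proof (intro allI impI)
        fix \<epsilon> :: real assume "0 < \<epsilon>"
        then have "Inf S < ennreal \<epsilon>" using 0 by simp
        then obtain c where "c \<in> S" "c < ennreal \<epsilon>" unfolding Inf_less_iff by (elim bexE)
        then show "\<exists>c\<in>S. c \<le> ennreal \<epsilon>" using less_imp_le by (intro bexI[of _ c])
      qed
    next
      assume P: "\<forall>\<epsilon>>0. \<exists>c\<in>S. c \<le> ennreal \<epsilon>"
      have "Inf S \<le> 0 + ennreal \<epsilon>" if "0 < \<epsilon>" for \<epsilon>
      proof -
        obtain c where c: "c \<in> S" "c \<le> ennreal \<epsilon>" using P \<open>0 < \<epsilon>\<close> by (elim allE impE bexE)
        then show ?thesis using Inf_lower2 by simp
      qed
      then have "Inf S \<le> 0" by (rule ennreal_le_epsilon)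
      then show "Inf S = 0" by simp
    qed
    moreover have "(\<exists>c\<in>S. c \<le> e) \<longleftrightarrow> (\<exists>U :: nat \<Rightarrow> _. Z \<subseteq> (\<Union>i. U i) \<and>
        (\<forall>i. ediameter \<rho> (U i) \<le> ennreal \<delta>) \<and>
        (\<Sum>i. ennreal (enn2real (ediameter \<rho> (U i)) powr s)) \<le> e)" for e
      unfolding S_def mem_Collect_eq bex_simps by auto
    ultimately show ?thesis unfolding hausdorff_premeasure_def S_def[symmetric] by simp
  qed
  have "(SUP \<delta>\<in>{0<..}. h \<delta>) = 0 \<longleftrightarrow> (\<forall>\<delta>>0. h \<delta> = 0)" for h :: "real \<Rightarrow> ennreal"
    using SUP_bot_conv(1)[of h "{0<..}"] by (auto simp: bot_ennreal)
  then show ?thesis unfolding hausdorff_outer_measure_def pre[symmetric] .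
qed

lemma hausdorff_null_mono:
  assumes "hausdorff_outer_measure \<rho> s Z = 0" "Y \<subseteq> Z"
  shows "hausdorff_outer_measure \<rho> s Y = 0"
  using assms(1) unfolding hausdorff_null_iff by (meson order_trans[OF assms(2)])

lemma hausdorff_null_exponent_mono:
  assumes null: "hausdorff_outer_measure \<rho> s Z = 0" and st: "0 < s" "s \<le> t"
  shows "hausdorff_outer_measure \<rho> t Z = 0"
  unfolding hausdorff_null_iff
proof (intro allI impI)
  fix \<delta> \<epsilon> :: real assume pos: "0 < \<delta>" "0 < \<epsilon>"
  \<comment> \<open>The scale is capped at 1, since for diameters up to 1 the power decreases in the
    exponent.\<close>
  then have "0 < min \<delta> 1" by simp
  from null[unfolded hausdorff_null_iff, rule_format, OF this pos(2)]
  obtain U :: "nat \<Rightarrow> _" where U: "Z \<subseteq> (\<Union>i. U i)"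
      "\<And>i. ediameter \<rho> (U i) \<le> ennreal (min \<delta> 1)"
      "(\<Sum>i. ennreal (enn2real (ediameter \<rho> (U i)) powr s)) \<le> ennreal \<epsilon>"
    by blast
  have "enn2real (ediameter \<rho> (U i)) powr t \<le> enn2real (ediameter \<rho> (U i)) powr s" for i
  proof (rule powr_mono')
    have "enn2real (ediameter \<rho> (U i)) \<le> enn2real (ennreal (min \<delta> 1))"
      by (rule enn2real_mono) (use U in auto)
    then show "enn2real (ediameter \<rho> (U i)) \<le> 1" using pos by simp
  qed (use st in auto)
  then have "(\<Sum>i. ennreal (enn2real (ediameter \<rho> (U i)) powr t)) \<le>
      (\<Sum>i. ennreal (enn2real (ediameter \<rho> (U i)) powr s))"
    by (intro suminf_le) (auto intro: ennreal_leI)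
  then have "(\<Sum>i. ennreal (enn2real (ediameter \<rho> (U i)) powr t)) \<le> ennreal \<epsilon>"
    using U(3) by (rule order_trans)
  moreover have "ediameter \<rho> (U i) \<le> ennreal \<delta>" for i
    by (rule order_trans[OF U(2)]) (simp add: ennreal_leI)
  ultimately show "\<exists>U :: nat \<Rightarrow> _. Z \<subseteq> (\<Union>i. U i) \<and> (\<forall>i. ediameter \<rho> (U i) \<le> ennreal \<delta>) \<and>
      (\<Sum>i. ennreal (enn2real (ediameter \<rho> (U i)) powr t)) \<le> ennreal \<epsilon>"
    using U(1) by blast
qed

lemma hausdorff_null_UN:
  assumes "\<And>n :: nat. hausdorff_outer_measure \<rho> s (Z n) = 0"
  shows "hausdorff_outer_measure \<rho> s (\<Union>n. Z n) = 0"
  unfolding hausdorff_null_iff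
proof (intro allI impI)
  fix \<delta> \<epsilon> :: real assume pos: "0 < \<delta>" "0 < \<epsilon>"
  have "\<forall>n. \<exists>U :: nat \<Rightarrow> _. Z n \<subseteq> (\<Union>i. U i) \<and> (\<forall>i. ediameter \<rho> (U i) \<le> ennreal \<delta>) \<and>
      (\<Sum>i. ennreal (enn2real (ediameter \<rho> (U i)) powr s)) \<le> ennreal (\<epsilon> * (1/2) ^ Suc n)"
  proof
    fix n
    have "0 < \<epsilon> * (1/2) ^ Suc n" using pos by simp
    with assms[of n, unfolded hausdorff_null_iff] pos(1)
    show "\<exists>U :: nat \<Rightarrow> _. Z n \<subseteq> (\<Union>i. U i) \<and> (\<forall>i. ediameter \<rho> (U i) \<le> ennreal \<delta>) \<and>
      (\<Sum>i. ennreal (enn2real (ediameter \<rho> (U i)) powr s)) \<le> ennreal (\<epsilon> * (1/2) ^ Suc n)"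
      by blast
  qed
  then obtain U :: "nat \<Rightarrow> nat \<Rightarrow> _" where U: "\<And>n. Z n \<subseteq> (\<Union>i. U n i)"
      "\<And>n i. ediameter \<rho> (U n i) \<le> ennreal \<delta>"
      "\<And>n. (\<Sum>i. ennreal (enn2real (ediameter \<rho> (U n i)) powr s)) \<le> ennreal (\<epsilon> * (1/2) ^ Suc n)"
    by metis
  define V where "V = (\<lambda>i. case_prod U (prod_decode i))"
  have "(\<Sum>i. ennreal (enn2real (ediameter \<rho> (V i)) powr s)) =
      (\<Sum>n. \<Sum>i. ennreal (enn2real (ediameter \<rho> (U n i)) powr s))"
    unfolding V_def
    by (rule suminf_ennreal_2dimen[where f="\<lambda>p. ennreal (enn2real (ediameter \<rho> (case_prod U p)) powr s)"])
      simp
  also have "\<dots> \<le> (\<Sum>n. ennreal (\<epsilon> * (1/2) ^ Suc n))"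
    by (intro suminf_le U(3)) auto
  also have "\<dots> = ennreal \<epsilon>"
    by (rule suminf_ennreal_eq) (use pos sums_mult[OF power_half_series, of \<epsilon>] in auto)
  finally have "(\<Sum>i. ennreal (enn2real (ediameter \<rho> (V i)) powr s)) \<le> ennreal \<epsilon>" .
  moreover have "(\<Union>n. Z n) \<subseteq> (\<Union>i. V i)"
  proof
    fix x assume "x \<in> (\<Union>n. Z n)"
    then obtain n i where "x \<in> U n i" using U(1) by blast
    then have "x \<in> V (prod_encode (n, i))" by (simp add: V_def)
    then show "x \<in> (\<Union>i. V i)" by blast
  qed
  moreover have "ediameter \<rho> (V i) \<le> ennreal \<delta>" for i
    unfolding V_def by (cases "prod_decode i") (simp add: U(2))
  ultimately show "\<exists>U :: nat \<Rightarrow> _. (\<Union>n. Z n) \<subseteq> (\<Union>i. U i) \<and> (\<forall>i. ediameter \<rho> (U i) \<le> ennreal \<delta>) \<and>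
      (\<Sum>i. ennreal (enn2real (ediameter \<rho> (U i)) powr s)) \<le> ennreal \<epsilon>" by blast
qed

lemma hausdorff_null_empty [simp]: "hausdorff_outer_measure \<rho> s {} = 0"
  unfolding hausdorff_null_iff
  by (intro allI impI exI[of _ "\<lambda>_. {}"]) (simp add: ediameter_def bot_ennreal)

lemma hausdorff_null_UN_countable:
  assumes "countable I" "\<And>i. i \<in> I \<Longrightarrow> hausdorff_outer_measure \<rho> s (Z i) = 0"
  shows "hausdorff_outer_measure \<rho> s (\<Union>i\<in>I. Z i) = 0"
proof (cases "I = {}")
  case False
  then have "(\<Union>i\<in>I. Z i) = (\<Union>n. Z (from_nat_into I n))"
    using assms(1) by (metis UN_extend_simps(10) range_from_nat_into)
  then show ?thesis
    using hausdorff_null_UN[of \<rho> s "\<lambda>n. Z (from_nat_into I n)"] assms(2) False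
    by (simp add: from_nat_into)
qed simp

lemma hausdorff_null_lipschitz:
  assumes null: "hausdorff_outer_measure \<rho> s Z = 0" and s: "0 < s" and K: "0 < K"
    and le: "\<And>x y. x \<in> Z \<Longrightarrow> y \<in> Z \<Longrightarrow> \<rho>' x y \<le> ennreal K * \<rho> x y"
  shows "hausdorff_outer_measure \<rho>' s Z = 0"
  unfolding hausdorff_null_iff
proof (intro allI impI)
  fix \<delta> \<epsilon> :: real assume pos: "0 < \<delta>" "0 < \<epsilon>"
  then have "0 < \<delta> / K" "0 < \<epsilon> / K powr s" using K by auto
  from null[unfolded hausdorff_null_iff, rule_format, OF this]
  obtain U :: "nat \<Rightarrow> _" where U: "Z \<subseteq> (\<Union>i. U i)"
      "\<And>i. ediameter \<rho> (U i) \<le> ennreal (\<delta> / K)"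
      "(\<Sum>i. ennreal (enn2real (ediameter \<rho> (U i)) powr s)) \<le> ennreal (\<epsilon> / K powr s)"
    by blast
  \<comment> \<open>The Lipschitz bound holds only between points of \<open>Z\<close>, so the
    covering sets are cut down to it.\<close>
  define V where "V i = U i \<inter> Z" for i
  have diam: "ediameter \<rho>' (V i) \<le> ennreal K * ediameter \<rho> (U i)" for i
  proof (rule ediameter_leI)
    fix x y assume "x \<in> V i" "y \<in> V i"
    then have "\<rho>' x y \<le> ennreal K * \<rho> x y" "\<rho> x y \<le> ediameter \<rho> (U i)"
      using le by (auto simp: V_def intro: ediameter_upper)
    then show "\<rho>' x y \<le> ennreal K * ediameter \<rho> (U i)"
      by (meson mult_left_mono order_trans zero_le)
  qed
  have fin: "ediameter \<rho> (U i) < \<top>" for i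
    using U(2)[of i] by (meson ennreal_less_top order_le_less_trans)
  have "enn2real (ediameter \<rho>' (V i)) \<le> enn2real (ennreal K * ediameter \<rho> (U i))" for i
    by (intro enn2real_mono diam) (use fin in \<open>simp add: ennreal_mult_less_top\<close>)
  then have r: "enn2real (ediameter \<rho>' (V i)) \<le> K * enn2real (ediameter \<rho> (U i))" for i
    using K by (simp add: enn2real_mult)
  have "enn2real (ediameter \<rho>' (V i)) powr s \<le> K powr s * enn2real (ediameter \<rho> (U i)) powr s" for i
  proof -
    have "enn2real (ediameter \<rho>' (V i)) powr s \<le> (K * enn2real (ediameter \<rho> (U i))) powr s"
      using r s by (intro powr_mono2) auto
    then show ?thesis using K by (simp add: powr_mult)
  qed
  then have "(\<Sum>i. ennreal (enn2real (ediameter \<rho>' (V i)) powr s)) \<le>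
      (\<Sum>i. ennreal (K powr s) * ennreal (enn2real (ediameter \<rho> (U i)) powr s))"
    by (intro suminf_le) (auto simp: ennreal_mult[symmetric] intro!: ennreal_leI)
  also have "\<dots> = ennreal (K powr s) * (\<Sum>i. ennreal (enn2real (ediameter \<rho> (U i)) powr s))"
    by (rule ennreal_suminf_cmult)
  also have "\<dots> \<le> ennreal (K powr s) * ennreal (\<epsilon> / K powr s)"
    by (intro mult_left_mono U(3)) simp
  also have "\<dots> = ennreal \<epsilon>" using K pos by (simp add: ennreal_mult[symmetric])
  finally have "(\<Sum>i. ennreal (enn2real (ediameter \<rho>' (V i)) powr s)) \<le> ennreal \<epsilon>" .
  moreover have "Z \<subseteq> (\<Union>i. V i)" using U(1) by (auto simp: V_def)
  moreover have "ediameter \<rho>' (V i) \<le> ennreal \<delta>" for i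
  proof -
    have "ediameter \<rho>' (V i) \<le> ennreal K * ennreal (\<delta> / K)"
      using diam U(2) by (meson mult_left_mono order_trans zero_le)
    then show ?thesis using K pos by (simp add: ennreal_mult[symmetric])
  qed
  ultimately show "\<exists>U :: nat \<Rightarrow> _. Z \<subseteq> (\<Union>i. U i) \<and> (\<forall>i. ediameter \<rho>' (U i) \<le> ennreal \<delta>) \<and>
      (\<Sum>i. ennreal (enn2real (ediameter \<rho>' (U i)) powr s)) \<le> ennreal \<epsilon>" by blast
qed

lemma hausdorff_dim_le: "0 < s \<Longrightarrow> hausdorff_outer_measure \<rho> s Z = 0 \<Longrightarrow> hausdorff_dim \<rho> Z \<le> ennreal s"
  unfolding hausdorff_dim_def by (intro Inf_lower) auto

lemma hausdorff_null_of_dim_less: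
  assumes "hausdorff_dim \<rho> Z < ennreal t"
  shows "hausdorff_outer_measure \<rho> t Z = 0"
proof -
  obtain s where s: "0 < s" "hausdorff_outer_measure \<rho> s Z = 0" "ennreal s < ennreal t"
    using assms unfolding hausdorff_dim_def Inf_less_iff by auto
  then have "s \<le> t" by (meson ennreal_less_iff less_imp_le)
  with s show ?thesis using hausdorff_null_exponent_mono by blast
qed

text \<open>The bounds \<open>D i\<close> are made positive, since logarithms of them are taken later.\<close>

lemma hausdorff_null_real_cover:
  fixes d :: "'a \<Rightarrow> 'a \<Rightarrow> real"
  assumes null: "hausdorff_outer_measure (\<lambda>x y. ennreal (d x y)) s Z = 0"
    and s: "0 < s" and pos: "0 < \<delta>" "0 < \<epsilon>"
  obtains U :: "nat \<Rightarrow> 'a set" and D :: "nat \<Rightarrow> real" where "Z \<subseteq> (\<Union>i. U i)"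
    "\<And>i. 0 < D i" "\<And>i. D i \<le> \<delta>" "\<And>i x y. x \<in> U i \<Longrightarrow> y \<in> U i \<Longrightarrow> d x y \<le> D i"
    "summable (\<lambda>i. D i powr s)" "(\<Sum>i. D i powr s) \<le> \<epsilon>"
proof -
  let ?\<rho> = "\<lambda>x y. ennreal (d x y)"
  from null[unfolded hausdorff_null_iff, rule_format, OF pos(1) half_gt_zero[OF pos(2)]]
  obtain U :: "nat \<Rightarrow> _" where U: "Z \<subseteq> (\<Union>i. U i)"
      "\<And>i. ediameter ?\<rho> (U i) \<le> ennreal \<delta>"
      "(\<Sum>i. ennreal (enn2real (ediameter ?\<rho> (U i)) powr s)) \<le> ennreal (\<epsilon>/2)"
    by blast
  define E where "E i = enn2real (ediameter ?\<rho> (U i))" for i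
  \<comment> \<open>A positive floor for the diameters; its s-th powers add up to at most the other
    half of \<open>\<epsilon>\<close>.\<close>
  define e where "e i = min \<delta> ((\<epsilon>/2 * (1/2) ^ Suc i) powr (1/s))" for i
  define D where "D i = max (E i) (e i)" for i
  have e0: "0 < e i" for i using pos by (simp add: e_def)
  have E: "E i \<le> \<delta>" for i
    using enn2real_mono[OF U(2)[of i]] pos by (simp add: E_def)
  have sumE: "summable (\<lambda>i. E i powr s)"
    by (rule summable_suminf_not_top) (use neq_top_trans[OF ennreal_neq_top U(3)] in \<open>simp_all add: E_def\<close>)
  have "ennreal (\<Sum>i. E i powr s) \<le> ennreal (\<epsilon>/2)"
    using U(3) sumE by (simp add: E_def suminf_ennreal2)
  then have sumE_le: "(\<Sum>i. E i powr s) \<le> \<epsilon>/2" using pos by simp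
  have e_le: "e i powr s \<le> \<epsilon>/2 * (1/2) ^ Suc i" for i
  proof -
    have "e i powr s \<le> ((\<epsilon>/2 * (1/2) ^ Suc i) powr (1/s)) powr s"
      using e0[of i] s by (intro powr_mono2) (auto simp: e_def)
    then show ?thesis using s pos by (simp add: powr_powr)
  qed
  have le: "D i powr s \<le> E i powr s + \<epsilon>/2 * (1/2) ^ Suc i" for i
  proof -
    define q where "q = \<epsilon>/2 * (1/2) ^ Suc i"
    have "0 \<le> E i powr s" "0 \<le> q" "e i powr s \<le> q" using pos e_le[of i] by (auto simp: q_def)
    moreover have "D i = E i \<or> D i = e i" by (auto simp: D_def)
    ultimately show ?thesis unfolding q_def[symmetric] by (elim disjE; simp only:; linarith)
  qed
  have sum_e: "(\<lambda>i. \<epsilon>/2 * (1/2) ^ Suc i) sums (\<epsilon>/2)"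
    using sums_mult[OF power_half_series, of "\<epsilon>/2"] by simp
  have sumR: "summable (\<lambda>i. E i powr s + \<epsilon>/2 * (1/2) ^ Suc i)"
    using sumE sum_e by (intro summable_add) (auto simp: sums_iff)
  have sumD: "summable (\<lambda>i. D i powr s)"
    by (rule summable_comparison_test'[OF sumR]) (use le in auto)
  have "(\<Sum>i. D i powr s) \<le> (\<Sum>i. E i powr s + \<epsilon>/2 * (1/2) ^ Suc i)"
    by (intro suminf_le le sumD sumR)
  also have "\<dots> = (\<Sum>i. E i powr s) + \<epsilon>/2"
    using sumE sum_e by (subst suminf_add[symmetric]) (auto simp: sums_iff)
  finally have "(\<Sum>i. D i powr s) \<le> \<epsilon>" using sumE_le by simp
  moreover have "d x y \<le> D i" if "x \<in> U i" "y \<in> U i" for x y i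
  proof -
    have "ennreal (d x y) \<le> ediameter ?\<rho> (U i)" using ediameter_upper[OF that, of ?\<rho>] .
    also have "\<dots> = ennreal (E i)"
      unfolding E_def using order_le_less_trans[OF U(2)[of i] ennreal_less_top]
      by (rule ennreal_enn2real[symmetric])
    finally have "d x y \<le> E i" using ennreal_le_iff[of "E i" "d x y"] by (simp add: E_def)
    then show ?thesis by (simp add: D_def)
  qed
  moreover have "0 < D i" "D i \<le> \<delta>" for i
    using E[of i] e0[of i] by (auto simp: D_def e_def less_max_iff_disj)
  ultimately show ?thesis
    using U(1) sumD by (intro that[of U D])
qed

text \<open>Finite lists are what the recursive coding produces; repeated sets count repeatedly, and
  upper bounds replace the exact diameters. Padding with empty sets, whose diameter is 0, gives a
  sequence.\<close>

lemma hausdorff_null_realI: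
  fixes d :: "'a \<Rightarrow> 'a \<Rightarrow> real"
  assumes s: "0 < s"
    and "\<And>\<delta> \<epsilon>. 0 < \<delta> \<Longrightarrow> 0 < \<epsilon> \<Longrightarrow> \<exists>xs :: ('a set \<times> real) list. Z \<subseteq> \<Union>(fst ` set xs) \<and>
      (\<forall>(U, D)\<in>set xs. 0 \<le> D \<and> D \<le> \<delta> \<and> (\<forall>x\<in>U. \<forall>y\<in>U. d x y \<le> D)) \<and>
      (\<Sum>(U, D)\<leftarrow>xs. D powr s) \<le> \<epsilon>"
  shows "hausdorff_outer_measure (\<lambda>x y. ennreal (d x y)) s Z = 0"
  unfolding hausdorff_null_iff
proof (intro allI impI)
  fix \<delta> \<epsilon> :: real assume "0 < \<delta>" "0 < \<epsilon>"
  from assms(2)[OF this] obtain xs :: "('a set \<times> real) list" where xs: "Z \<subseteq> \<Union>(fst ` set xs)"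
    "\<forall>(U, D)\<in>set xs. 0 \<le> D \<and> D \<le> \<delta> \<and> (\<forall>x\<in>U. \<forall>y\<in>U. d x y \<le> D)"
    "(\<Sum>(U, D)\<leftarrow>xs. D powr s) \<le> \<epsilon>" by (elim exE conjE)
  let ?\<rho> = "\<lambda>x y. ennreal (d x y)"
  define V where "V i = (if i < length xs then fst (xs ! i) else {})" for i
  have xs_i: "0 \<le> snd (xs ! i) \<and> snd (xs ! i) \<le> \<delta> \<and> (\<forall>x\<in>fst (xs ! i). \<forall>y\<in>fst (xs ! i). d x y \<le> snd (xs ! i))"
    if "i < length xs" for i
    using bspec[OF xs(2), of "xs ! i"] that by (simp add: case_prod_beta)
  have diam: "ediameter ?\<rho> (V i) \<le> ennreal (snd (xs ! i))" if "i < length xs" for i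
    using xs_i[OF that] that by (intro ediameter_leI) (auto simp: V_def intro!: ennreal_leI)
  have "(\<Sum>i. ennreal (enn2real (ediameter ?\<rho> (V i)) powr s)) =
      (\<Sum>i<length xs. ennreal (enn2real (ediameter ?\<rho> (V i)) powr s))"
    by (rule suminf_finite) (auto simp: V_def ediameter_def bot_ennreal)
  also have "\<dots> \<le> (\<Sum>i<length xs. ennreal (snd (xs ! i) powr s))"
  proof (intro sum_mono ennreal_leI powr_mono2)
    fix i assume "i \<in> {..<length xs}"
    then show "enn2real (ediameter ?\<rho> (V i)) \<le> snd (xs ! i)"
      using enn2real_mono[OF diam[of i]] xs_i[of i] by (simp add: less_top[symmetric])
  qed (use s in auto)
  also have "\<dots> = ennreal (\<Sum>(U, D)\<leftarrow>xs. D powr s)"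
    by (simp add: sum_list_sum_nth atLeast0LessThan case_prod_beta)
  also have "\<dots> \<le> ennreal \<epsilon>" using xs(3) by (rule ennreal_leI)
  finally have "(\<Sum>i. ennreal (enn2real (ediameter ?\<rho> (V i)) powr s)) \<le> ennreal \<epsilon>" .
  moreover have "Z \<subseteq> (\<Union>i. V i)"
  proof
    fix x assume "x \<in> Z"
    then obtain p where "p \<in> set xs" "x \<in> fst p" using xs(1) by blast
    then obtain i where "i < length xs" "x \<in> fst (xs ! i)" by (metis in_set_conv_nth)
    then show "x \<in> (\<Union>i. V i)" by (auto simp: V_def intro!: exI[of _ i])
  qed
  moreover have "ediameter ?\<rho> (V i) \<le> ennreal \<delta>" for i
  proof (cases "i < length xs")
    case True
    then show ?thesis using diam[OF True] xs_i[OF True] by (meson ennreal_leI order_trans)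
  qed (simp add: V_def ediameter_def bot_ennreal)
  ultimately show "\<exists>U :: nat \<Rightarrow> _. Z \<subseteq> (\<Union>i. U i) \<and> (\<forall>i. ediameter ?\<rho> (U i) \<le> ennreal \<delta>) \<and>
      (\<Sum>i. ennreal (enn2real (ediameter ?\<rho> (U i)) powr s)) \<le> ennreal \<epsilon>" by (intro exI[of _ V] conjI allI)
qed

section \<open>Shadowing orbits\<close>

lemma visits_funpow_le: "m \<le> n \<Longrightarrow> visits f B (n - m) ((f ^^ m) x) \<le> visits f B n x"
  using visits_add[of f B m "n - m" x] by simp

text \<open>\<open>d\<close> is a real-valued pseudometric whose balls are open in the given
  topology; it stands in for the Riemannian distance, which may be infinite.\<close>

locale metric_dynamics =
  fixes f :: "'a::topological_space \<Rightarrow> 'a" and J :: "'a set" and d :: "'a \<Rightarrow> 'a \<Rightarrow> real"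
  assumes d_refl [simp]: "d x x = 0"
    and d_sym: "d x y = d y x"
    and d_triangle: "d x z \<le> d x y + d y z"
    and d_open: "open {y. d x y < e}"
    and f_cont: "continuous_on UNIV f"
    and f_J: "x \<in> J \<Longrightarrow> f x \<in> J"
begin

lemma d_nonneg: "0 \<le> d x y"
  using d_triangle[of x x y] d_sym[of x y] by simp

lemma funpow_J: "x \<in> J \<Longrightarrow> (f ^^ n) x \<in> J"
  by (induction n) (auto simp: f_J)

text \<open>The two times are existential and may depend on the pair: the lower rate becomes
  available direction by direction, at times bounded only afterwards by compactness.\<close>

definition growth_pair :: "real \<Rightarrow> real \<Rightarrow> nat \<Rightarrow> 'a \<Rightarrow> 'a \<Rightarrow> bool" where
  "growth_pair \<alpha> \<beta> k x y \<longleftrightarrow>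
     (\<exists>N\<in>{1..k}. exp (\<alpha> * real N) * d x y \<le> d ((f ^^ N) x) ((f ^^ N) y)) \<and>
     (\<exists>N\<in>{1..k}. d ((f ^^ N) x) ((f ^^ N) y) \<le> exp (\<beta> * real N) * d x y)"

text \<open>\<open>k\<close> bounds the times and fixes the radius at once, so the sets increase
  with \<open>k\<close>. Both points of the pair vary near \<open>z\<close>; strict derivatives of
  the iterates at \<open>z\<close> control such pairs.\<close>

definition growth_set :: "real \<Rightarrow> real \<Rightarrow> nat \<Rightarrow> 'a set" where
  "growth_set \<alpha> \<beta> k =
     {z \<in> J. \<forall>x\<in>J. \<forall>y\<in>J. d z x < 1 / Suc k \<and> d z y < 1 / Suc k \<longrightarrow> growth_pair \<alpha> \<beta> k x y}"

lemma growth_pair_mono: "growth_pair \<alpha> \<beta> k x y \<Longrightarrow> k \<le> l \<Longrightarrow> growth_pair \<alpha> \<beta> l x y"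
  unfolding growth_pair_def by (meson atLeastAtMost_iff order_trans)

lemma growth_set_mono:
  assumes "k \<le> l" shows "growth_set \<alpha> \<beta> k \<subseteq> growth_set \<alpha> \<beta> l"
proof -
  have "1 / real (Suc l) \<le> 1 / real (Suc k)" using assms by (intro divide_left_mono) auto
  then show ?thesis
    unfolding growth_set_def using growth_pair_mono[OF _ assms]
    by (auto intro: order_less_le_trans)
qed

lemma growth_setD:
  "x \<in> growth_set \<alpha> \<beta> k \<Longrightarrow> y \<in> J \<Longrightarrow> d x y < 1 / Suc k \<Longrightarrow> growth_pair \<alpha> \<beta> k x y"
  unfolding growth_set_def by simp

text \<open>\<open>exp C\<close> limits the distortion of a single step in either direction and pays
  for steps taken outside the growth set. The bound on \<open>r\<close> lets
  \<open>growth_setD\<close> apply to points closer than \<open>r\<close>.\<close>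

definition scale_ok :: "real \<Rightarrow> nat \<Rightarrow> real \<Rightarrow> bool" where
  "scale_ok C k r \<longleftrightarrow> 0 < r \<and> r \<le> 1 / Suc k \<and>
     (\<forall>x\<in>J. \<forall>y\<in>J. d x y < r \<longrightarrow>
        d x y \<le> exp C * d (f x) (f y) \<and> d (f x) (f y) \<le> exp C * d x y)"

text \<open>Walk along the orbit of \<open>x\<close> while the other orbit stays within
  \<open>r\<close>. In the growth set, jump ahead by some time N \<le> k with a gain of
  \<open>\<alpha>\<close> per unit of time; elsewhere take one step, which loses at most
  \<open>C\<close> and forgoes \<open>\<alpha>\<close>. Hence a bad visit costs
  \<open>\<alpha> + C\<close>, and the last stretch of at most \<open>k\<close> steps is covered by
  the constant term.\<close>

lemma shadowing_contraction:
  assumes ok: "scale_ok C k r" and \<alpha>: "0 \<le> \<alpha>" and C: "0 \<le> C"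
  shows "1 \<le> n \<Longrightarrow> x \<in> J \<Longrightarrow> y \<in> J \<Longrightarrow> (\<And>j. j < n \<Longrightarrow> d ((f ^^ j) x) ((f ^^ j) y) < r) \<Longrightarrow>
    d x y \<le> r * exp ((\<alpha> + C) * real k - \<alpha> * real n + (\<alpha> + C) * real (visits f (- growth_set \<alpha> \<beta> k) n x))"
proof (induction n arbitrary: x y rule: less_induct)
  case (less n)
  let ?v = "visits f (- growth_set \<alpha> \<beta> k)"
  have r: "0 < r" using ok by (simp add: scale_ok_def)
  have dxy: "d x y < r" using less.prems(4)[of 0] less.prems(1) by simp
  show ?case
  proof (cases "n \<le> k")
    case True
    have "\<alpha> * real n \<le> \<alpha> * real k" using True \<alpha> by (intro mult_left_mono) auto
    then have "0 \<le> (\<alpha> + C) * real k - \<alpha> * real n + (\<alpha> + C) * real (?v n x)"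
    proof -
      have "0 \<le> C * real k" "0 \<le> (\<alpha> + C) * real (?v n x)" using \<alpha> C by auto
      with \<open>\<alpha> * real n \<le> \<alpha> * real k\<close> show ?thesis by (simp add: distrib_right)
    qed
    then have "r * 1 \<le> r * exp ((\<alpha> + C) * real k - \<alpha> * real n + (\<alpha> + C) * real (?v n x))"
      using r by (intro mult_left_mono) auto
    with dxy show ?thesis by simp
  next
    case nk: False
    show ?thesis
    proof (cases "x \<in> growth_set \<alpha> \<beta> k")
      case True
      have "growth_pair \<alpha> \<beta> k x y"
        using growth_setD[OF True less.prems(3)] dxy ok by (simp add: scale_ok_def)
      then obtain N where N: "1 \<le> N" "N \<le> k"
        and le: "exp (\<alpha> * real N) * d x y \<le> d ((f ^^ N) x) ((f ^^ N) y)"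
        unfolding growth_pair_def by auto
      have "d ((f ^^ N) x) ((f ^^ N) y) \<le> r * exp ((\<alpha> + C) * real k - \<alpha> * real (n - N)
          + (\<alpha> + C) * real (?v (n - N) ((f ^^ N) x)))"
      proof (rule less.IH)
        fix j assume "j < n - N"
        then show "d ((f ^^ j) ((f ^^ N) x)) ((f ^^ j) ((f ^^ N) y)) < r"
          using less.prems(4)[of "j + N"] by (simp add: funpow_add)
      qed (use N nk less.prems funpow_J in auto)
      also have "\<dots> \<le> r * exp ((\<alpha> + C) * real k - \<alpha> * real (n - N) + (\<alpha> + C) * real (?v n x))"
        using r \<alpha> C visits_funpow_le[of N n f] N nk
        by (intro mult_left_mono) (auto intro!: mult_left_mono)
      finally have "exp (\<alpha> * real N) * d x y \<le>
          r * exp ((\<alpha> + C) * real k - \<alpha> * real (n - N) + (\<alpha> + C) * real (?v n x))"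
        using le by simp
      then have "exp (- \<alpha> * real N) * (exp (\<alpha> * real N) * d x y) \<le> exp (- \<alpha> * real N) *
          (r * exp ((\<alpha> + C) * real k - \<alpha> * real (n - N) + (\<alpha> + C) * real (?v n x)))"
        by (intro mult_left_mono) auto
      also have "exp (- \<alpha> * real N) * (exp (\<alpha> * real N) * d x y) = d x y"
        by (simp add: mult.assoc[symmetric] exp_add[symmetric])
      also have "exp (- \<alpha> * real N) *
          (r * exp ((\<alpha> + C) * real k - \<alpha> * real (n - N) + (\<alpha> + C) * real (?v n x))) =
          r * exp ((\<alpha> + C) * real k - \<alpha> * real n + (\<alpha> + C) * real (?v n x))"
      proof -
        have "(\<alpha> + C) * real k - \<alpha> * real n + (\<alpha> + C) * real (?v n x) = - \<alpha> * real N +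
          ((\<alpha> + C) * real k - \<alpha> * real (n - N) + (\<alpha> + C) * real (?v n x))"
          using N nk by (simp add: of_nat_diff algebra_simps)
        then show ?thesis by (simp only: exp_add) (simp add: algebra_simps)
      qed
      finally show ?thesis .
    next
      case False
      show ?thesis
      proof (cases "n = 1")
        case True
        \<comment> \<open>No orbit segment remains after this step, so the induction hypothesis does
          not apply. With \<open>k\<close> = 0 the exponent equals \<open>C\<close>, which is
          nonnegative.\<close>
        with nk have "k = 0" by simp
        have "?v n x = 1" using False True by (simp add: visits_Suc)
        with \<open>k = 0\<close> True C have "0 \<le> (\<alpha> + C) * real k - \<alpha> * real n + (\<alpha> + C) * real (?v n x)"
          by simp
        then have "r * 1 \<le> r * exp ((\<alpha> + C) * real k - \<alpha> * real n + (\<alpha> + C) * real (?v n x))"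
          using r by (intro mult_left_mono) auto
        with dxy show ?thesis by simp
      next
        case n1: False
        obtain m where m: "n = Suc m" "1 \<le> m" using n1 less.prems(1) by (cases n) auto
        have "d (f x) (f y) \<le> r * exp ((\<alpha> + C) * real k - \<alpha> * real m
            + (\<alpha> + C) * real (?v m (f x)))"
        proof (rule less.IH)
          fix j assume "j < m"
          then show "d ((f ^^ j) (f x)) ((f ^^ j) (f y)) < r"
            using less.prems(4)[of "Suc j"] m by (simp add: funpow_swap1)
        qed (use m less.prems f_J in auto)
        then have "exp C * d (f x) (f y) \<le> exp C * (r * exp ((\<alpha> + C) * real k - \<alpha> * real m
            + (\<alpha> + C) * real (?v m (f x))))"
          by (intro mult_left_mono) auto
        also have "\<dots> = r * exp ((\<alpha> + C) * real k - \<alpha> * real n + (\<alpha> + C) * real (?v n x))"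
        proof -
          have "real (?v n x) = 1 + real (?v m (f x))" using False m by (simp add: visits_Suc)
          then have "(\<alpha> + C) * real k - \<alpha> * real n + (\<alpha> + C) * real (?v n x) = C +
            ((\<alpha> + C) * real k - \<alpha> * real m + (\<alpha> + C) * real (?v m (f x)))"
            using m by (simp add: algebra_simps)
          then show ?thesis by (simp only: exp_add) (simp add: algebra_simps)
        qed
        finally show ?thesis
          using ok dxy less.prems unfolding scale_ok_def by (meson order_trans)
      qed
    qed
  qed
qed

text \<open>The one-step bound can be iterated while the distance stays below the scale; as
  \<open>C\<close> is nonnegative, it suffices that the final bound does. It serves for stretches
  shorter than \<open>k\<close>.\<close>

lemma step_expansion:
  assumes ok: "scale_ok C k r" and C: "0 \<le> C"
  shows "x \<in> J \<Longrightarrow> y \<in> J \<Longrightarrow> d x y * exp (C * real n) < r \<Longrightarrow>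
    d ((f ^^ n) x) ((f ^^ n) y) \<le> d x y * exp (C * real n)"
proof (induction n arbitrary: x y)
  case (Suc n)
  have "exp 0 \<le> exp (C * real (Suc n))" using C by (intro exp_le_cancel_iff[THEN iffD2]) simp
  then have "d x y * 1 \<le> d x y * exp (C * real (Suc n))"
    by (intro mult_left_mono d_nonneg) simp
  with Suc.prems have "d x y < r" by simp
  then have 1: "d (f x) (f y) \<le> exp C * d x y"
    using ok Suc.prems by (simp add: scale_ok_def)
  then have "d (f x) (f y) * exp (C * real n) \<le> exp C * d x y * exp (C * real n)"
    by (intro mult_right_mono) auto
  also have "\<dots> = d x y * exp (C * real (Suc n))"
    by (simp add: algebra_simps exp_add)
  finally have 2: "d (f x) (f y) * exp (C * real n) \<le> d x y * exp (C * real (Suc n))" .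
  have "d ((f ^^ n) (f x)) ((f ^^ n) (f y)) \<le> d (f x) (f y) * exp (C * real n)"
    by (rule Suc.IH) (use 2 Suc.prems f_J in auto)
  with 2 show ?case by (simp add: funpow_swap1)
qed simp

text \<open>The walk of \<open>shadowing_contraction\<close>, now with the upper rates. Closeness of
  the two orbits is a conclusion: the bound for the remaining walk never exceeds the bound for the
  whole, so if the latter is below \<open>r\<close>, every pair met on the way is within the
  scale.\<close>

lemma shadowing_expansion:
  assumes ok: "scale_ok C k r" and \<beta>: "0 \<le> \<beta>" and C: "0 \<le> C"
  shows "x \<in> J \<Longrightarrow> y \<in> J \<Longrightarrow>
    d x y * exp (\<beta> * real n + C * real (visits f (- growth_set \<alpha> \<beta> k) n x) + C * real k) < r \<Longrightarrow>
    d ((f ^^ n) x) ((f ^^ n) y) \<le>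
      d x y * exp (\<beta> * real n + C * real (visits f (- growth_set \<alpha> \<beta> k) n x) + C * real k)"
proof (induction n arbitrary: x y rule: less_induct)
  case (less n)
  let ?v = "visits f (- growth_set \<alpha> \<beta> k)"
  define E where "E = \<beta> * real n + C * real (?v n x) + C * real k"
  have E0: "0 \<le> E" unfolding E_def using \<beta> C by simp
  have "d x y * 1 \<le> d x y * exp E" using E0 by (intro mult_left_mono d_nonneg) simp
  with less.prems(3) have dxy: "d x y < r" by (simp add: E_def)
  have dE: "d x y * exp E < r" using less.prems(3) by (simp add: E_def)
  have "d ((f ^^ n) x) ((f ^^ n) y) \<le> d x y * exp E"
  proof (cases "n = 0")
    case True
    then show ?thesis using \<open>d x y * 1 \<le> d x y * exp E\<close> by simp
  next
    case n0: False
    show ?thesis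
    proof (cases "x \<in> growth_set \<alpha> \<beta> k")
      case True
      have "growth_pair \<alpha> \<beta> k x y"
        using growth_setD[OF True less.prems(2)] dxy ok by (simp add: scale_ok_def)
      then obtain N where N: "1 \<le> N" "N \<le> k"
        and le: "d ((f ^^ N) x) ((f ^^ N) y) \<le> exp (\<beta> * real N) * d x y"
        unfolding growth_pair_def by auto
      show ?thesis
      proof (cases "N \<le> n")
        case True
        define E' where "E' = \<beta> * real (n - N) + C * real (?v (n - N) ((f ^^ N) x)) + C * real k"
        have "\<beta> * real N + E' \<le> E"
          unfolding E_def E'_def using True visits_funpow_le[OF True, of f] C
          by (simp add: of_nat_diff algebra_simps mult_left_mono)
        then have "d x y * exp (\<beta> * real N + E') \<le> d x y * exp E"
          by (intro mult_left_mono d_nonneg) simp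
        moreover have "d ((f ^^ N) x) ((f ^^ N) y) * exp E' \<le> exp (\<beta> * real N) * d x y * exp E'"
          using le by (intro mult_right_mono) auto
        moreover have "exp (\<beta> * real N) * d x y * exp E' = d x y * exp (\<beta> * real N + E')"
          by (simp only: exp_add mult_ac)
        ultimately have le': "d ((f ^^ N) x) ((f ^^ N) y) * exp E' \<le> d x y * exp E"
          by linarith
        have "d ((f ^^ (n - N)) ((f ^^ N) x)) ((f ^^ (n - N)) ((f ^^ N) y))
            \<le> d ((f ^^ N) x) ((f ^^ N) y) * exp E'"
          unfolding E'_def
          by (rule less.IH) (use N True less.prems funpow_J le' dE in \<open>auto simp: E'_def\<close>)
        moreover have "(f ^^ (n - N)) ((f ^^ N) z) = (f ^^ n) z" for z
          using True funpow_add[of "n - N" N f] by (simp add: fun_eq_iff)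
        ultimately show ?thesis using le' by simp
      next
        case False
        \<comment> \<open>The jump would overshoot n. As n < N \<le> k, the crude bound applies, and
          the term \<open>C * real k\<close> pays for it.\<close>
        have "C * real n \<le> E" unfolding E_def using False N \<beta> C
          by (intro order_trans[OF mult_left_mono[of "real n" "real k" C]]) auto
        then have "d x y * exp (C * real n) \<le> d x y * exp E"
          by (intro mult_left_mono d_nonneg) simp
        with step_expansion[OF ok C less.prems(1,2), of n] dE show ?thesis by simp
      qed
    next
      case False
      obtain m where m: "n = Suc m" using n0 by (cases n) auto
      define E' where "E' = \<beta> * real m + C * real (?v m (f x)) + C * real k"
      have "C + E' \<le> E"
        unfolding E_def E'_def using m False \<beta> by (simp add: visits_Suc algebra_simps)
      then have "d x y * exp (C + E') \<le> d x y * exp E"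
        by (intro mult_left_mono d_nonneg) simp
      moreover have "d (f x) (f y) \<le> exp C * d x y"
        using ok dxy less.prems by (simp add: scale_ok_def)
      then have "d (f x) (f y) * exp E' \<le> exp C * d x y * exp E'"
        by (intro mult_right_mono) auto
      moreover have "exp C * d x y * exp E' = d x y * exp (C + E')"
        by (simp only: exp_add mult_ac)
      ultimately have le': "d (f x) (f y) * exp E' \<le> d x y * exp E"
        by linarith
      have "d ((f ^^ m) (f x)) ((f ^^ m) (f y)) \<le> d (f x) (f y) * exp E'"
        unfolding E'_def
        by (rule less.IH) (use m less.prems f_J le' dE in \<open>auto simp: E'_def\<close>)
      with le' m show ?thesis by (simp add: funpow_swap1)
    qed
  qed
  then show ?case by (simp add: E_def)
qed

end

section \<open>Coding by blocks\<close>

lemma tendsto_exp_decay: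
  assumes "0 < b" shows "(\<lambda>n. B * exp (- b * real n)) \<longlonglongrightarrow> 0"
proof -
  have "(\<lambda>n. exp (- b) ^ n) \<longlonglongrightarrow> 0" using assms by (intro LIMSEQ_realpow_zero) auto
  then have "(\<lambda>n. B * exp (- b) ^ n) \<longlonglongrightarrow> B * 0" by (intro tendsto_mult_left)
  then show ?thesis by (simp add: exp_of_nat_mult[symmetric] mult_ac)
qed

context metric_dynamics begin

text \<open>With \<open>q\<close> = 0 these are the sets shown to be null in
  \<open>freq_set_null\<close>; a positive \<open>q\<close> is what ergodicity delivers when the bad
  set merely has measure below \<open>\<epsilon>\<close>.\<close>

definition freq_set :: "'a set \<Rightarrow> real \<Rightarrow> real \<Rightarrow> 'a set" where
  "freq_set S \<epsilon> q = {x \<in> J. \<forall>n. real (visits f (- S) n x) \<le> \<epsilon> * real n + q}"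

lemma funpow_cont: "continuous_on UNIV (f ^^ n)"
proof (induction n)
  case (Suc n)
  then show ?case
    unfolding funpow.simps by (intro continuous_on_compose continuous_on_subset[OF f_cont]) auto
qed (simp add: id_def)

lemma open_shadow: "open {y. \<forall>j<n. d ((f ^^ j) x) ((f ^^ j) y) < e}"
proof -
  have "open ((f ^^ j) -` {z. d ((f ^^ j) x) z < e})" for j
    using funpow_cont d_open by (rule open_vimage[rotated])
  then have "open (\<Inter>j\<in>{..<n}. (f ^^ j) -` {z. d ((f ^^ j) x) z < e})"
    by (intro open_INT) auto
  moreover have "(\<Inter>j\<in>{..<n}. (f ^^ j) -` {z. d ((f ^^ j) x) z < e}) =
      {y. \<forall>j<n. d ((f ^^ j) x) ((f ^^ j) y) < e}" by auto
  ultimately show ?thesis by simp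
qed

text \<open>Points of the frequency set separate at a rate of at most b = \<beta> + C \<epsilon>, up
  to a constant factor. So a covering set of diameter about exp (- b l) stays smaller than
  \<open>r\<close> for l steps, and the sum of t-th powers of diameters turns into a sum of exp (- t
  b l).\<close>

lemma cover_refine:
  assumes ok: "scale_ok C k r" and nonneg: "0 \<le> \<beta>" "0 \<le> C"
    and \<epsilon>: "0 < \<beta> + C * \<epsilon>" and t: "0 < t" and \<eta>: "0 < \<eta>"
    and Y: "Y \<subseteq> freq_set (growth_set \<alpha> \<beta> k) \<epsilon> q"
    and null: "hausdorff_outer_measure (\<lambda>x y. ennreal (d x y)) t Y = 0"
  obtains V :: "nat \<Rightarrow> 'a set" and l :: "nat \<Rightarrow> nat" where
    "Y \<subseteq> (\<Union>i. V i)" "\<And>i. open (V i)" "\<And>i. 1 \<le> l i"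
    "summable (\<lambda>i. exp (- (t * (\<beta> + C * \<epsilon>)) * real (l i)))"
    "(\<Sum>i. exp (- (t * (\<beta> + C * \<epsilon>)) * real (l i))) \<le> \<eta>"
    "\<And>i x y j. x \<in> V i \<Longrightarrow> y \<in> V i \<Longrightarrow> j < l i \<Longrightarrow> d ((f ^^ j) x) ((f ^^ j) y) < r"
proof -
  define b where "b = \<beta> + C * \<epsilon>"
  have b: "0 < b" using \<epsilon> by (simp add: b_def)
  \<comment> \<open>The factor 3 leaves room for fattening the covering sets; the exponential
    absorbs the additive constants \<open>k\<close> and \<open>q\<close> of the shadowing
    estimate.\<close>
  define c where "c = r / (3 * exp (C * (real k + q)))"
  have r: "0 < r" using ok by (simp add: scale_ok_def)
  have c: "0 < c" using r by (simp add: c_def)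
  have cr: "c * exp (C * (real k + q)) = r / 3" by (simp add: c_def)
  \<comment> \<open>The factor \<open>exp (- b)\<close> compensates for rounding times down to
    integers; the extra 1/2 makes all the times \<open>u i\<close> exceed 1.\<close>
  have pos: "0 < c * exp (- b) / 2" "0 < \<eta> * (c * exp (- b)) powr t" using c \<eta> by auto
  obtain U :: "nat \<Rightarrow> 'a set" and D :: "nat \<Rightarrow> real" where U: "Y \<subseteq> (\<Union>i. U i)"
    "\<And>i. 0 < D i" "\<And>i. D i \<le> c * exp (- b) / 2"
    "\<And>i x y. x \<in> U i \<Longrightarrow> y \<in> U i \<Longrightarrow> d x y \<le> D i"
    "summable (\<lambda>i. D i powr t)" "(\<Sum>i. D i powr t) \<le> \<eta> * (c * exp (- b)) powr t"
    using hausdorff_null_real_cover[OF null t pos] by metis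
  \<comment> \<open>\<open>u i\<close> is the real time at which a set of diameter
    \<open>D i\<close> grows to the scale at rate \<open>b\<close>; \<open>l i\<close> is the
    largest integer strictly below it.\<close>
  define u where "u i = ln (c / D i) / b" for i
  define l where "l i = nat (\<lceil>u i\<rceil> - 1)" for i
  have Du: "D i = c * exp (- b * u i)" for i
    using U(2)[of i] c b by (simp add: u_def exp_minus)
  have u1: "1 < u i" for i
  proof -
    have "D i < c * exp (- b)" using U(3)[of i] pos(1) by linarith
    then have "exp (- b * u i) < exp (- b)" unfolding Du using c by simp
    then show ?thesis using b by simp
  qed
  have l_eq: "real (l i) = of_int \<lceil>u i\<rceil> - 1" for i
    using u1[of i] by (simp add: l_def)
  have l1: "1 \<le> l i" for i
    using u1[of i] by (simp add: l_def le_nat_iff)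
  have l_less: "real (l i) < u i" for i
    unfolding l_eq using ceiling_correct[of "u i"] by linarith
  have l_ge: "u i \<le> real (l i) + 1" for i
    unfolding l_eq using ceiling_correct[of "u i"] by linarith
  \<comment> \<open>A union of open dynamical balls of radius \<open>r / 3\<close> about the
    relevant points; with the diameter bound \<open>r / 3\<close> on these points, three thirds add
    up to less than \<open>r\<close>.\<close>
  define V where "V i = (\<Union>x\<in>U i \<inter> Y. {y. \<forall>j<l i. d ((f ^^ j) x) ((f ^^ j) y) < r / 3})" for i
  have shadow: "d ((f ^^ j) x) ((f ^^ j) y) < r / 3"
    if xy: "x \<in> U i \<inter> Y" "y \<in> U i \<inter> Y" and j: "j < l i" for x y i j
  proof -
    let ?v = "real (visits f (- growth_set \<alpha> \<beta> k) j x)"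
    have J: "x \<in> J" "y \<in> J" and v: "?v \<le> \<epsilon> * real j + q" using xy Y by (auto simp: freq_set_def)
    have "\<beta> * real j + C * ?v + C * real k \<le> b * real j + C * (real k + q)"
      using mult_left_mono[OF v nonneg(2)] by (simp add: b_def algebra_simps)
    also have "\<dots> \<le> b * real (l i) + C * (real k + q)" using j b by simp
    also have "\<dots> < b * u i + C * (real k + q)" using l_less[of i] b by simp
    finally have "exp (\<beta> * real j + C * ?v + C * real k) < exp (b * u i + C * (real k + q))" by simp
    then have "D i * exp (\<beta> * real j + C * ?v + C * real k) < D i * exp (b * u i + C * (real k + q))"
      using U(2)[of i] by simp
    also have "\<dots> = r / 3" unfolding Du using cr by (simp add: mult.assoc exp_add[symmetric])
    finally have *: "D i * exp (\<beta> * real j + C * ?v + C * real k) < r / 3" .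
    have "d x y * exp (\<beta> * real j + C * ?v + C * real k) \<le> D i * exp (\<beta> * real j + C * ?v + C * real k)"
      using U(4)[of x i y] xy by (intro mult_right_mono) auto
    with * have **: "d x y * exp (\<beta> * real j + C * ?v + C * real k) < r / 3" by linarith
    with r have "d x y * exp (\<beta> * real j + C * ?v + C * real k) < r" by linarith
    from shadowing_expansion[OF ok nonneg J this] ** show ?thesis by linarith
  qed
  show ?thesis
  proof (rule that[of V l])
    show "Y \<subseteq> (\<Union>i. V i)"
    proof
      fix x assume "x \<in> Y"
      then obtain i where "x \<in> U i" using U(1) by blast
      with \<open>x \<in> Y\<close> have "x \<in> V i" unfolding V_def using r by (intro UN_I[of x]) auto
      then show "x \<in> (\<Union>i. V i)" by blast
    qed
    show "open (V i)" for i unfolding V_def by (intro open_UN ballI open_shadow)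
    show "1 \<le> l i" for i by (rule l1)
    have bound: "exp (- (t * b) * real (l i)) \<le> D i powr t / (c * exp (- b)) powr t" for i
    proof -
      have "exp (- b * real (l i)) \<le> exp (- b * (u i - 1))"
        using l_ge[of i] b by simp
      also have "\<dots> = D i / (c * exp (- b))"
        unfolding Du using c by (simp add: exp_minus exp_diff field_simps)
      finally have "exp (- b * real (l i)) powr t \<le> (D i / (c * exp (- b))) powr t"
        using t by (intro powr_mono2) auto
      then show ?thesis using U(2)[of i] c t by (simp add: powr_divide exp_powr_real mult_ac)
    qed
    have sD: "summable (\<lambda>i. D i powr t / (c * exp (- b)) powr t)"
      by (intro summable_divide U(5))
    show sm: "summable (\<lambda>i. exp (- (t * (\<beta> + C * \<epsilon>)) * real (l i)))"
      by (rule summable_comparison_test'[OF sD]) (use bound in \<open>auto simp: b_def\<close>)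
    have "(\<Sum>i. exp (- (t * (\<beta> + C * \<epsilon>)) * real (l i))) \<le> (\<Sum>i. D i powr t / (c * exp (- b)) powr t)"
      by (intro suminf_le sm sD) (use bound in \<open>auto simp: b_def\<close>)
    also have "\<dots> = (\<Sum>i. D i powr t) / (c * exp (- b)) powr t"
      by (rule suminf_divide[OF U(5)])
    also have "\<dots> \<le> \<eta>" using U(6) c by (simp add: field_simps)
    finally show "(\<Sum>i. exp (- (t * (\<beta> + C * \<epsilon>)) * real (l i))) \<le> \<eta>" .
    fix i x y j assume "x \<in> V i" "y \<in> V i" and j: "j < l i"
    then obtain x' y' where "x' \<in> U i \<inter> Y" "y' \<in> U i \<inter> Y"
      "d ((f ^^ j) x') ((f ^^ j) x) < r / 3" "d ((f ^^ j) y') ((f ^^ j) y) < r / 3"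
      unfolding V_def by auto
    moreover from this have "d ((f ^^ j) x') ((f ^^ j) y') < r / 3" using shadow j by blast
    moreover have "d ((f ^^ j) x) ((f ^^ j) y) \<le> d ((f ^^ j) x) ((f ^^ j) x') +
        (d ((f ^^ j) x') ((f ^^ j) y') + d ((f ^^ j) y') ((f ^^ j) y))"
      by (meson add_left_mono d_triangle order_trans)
    ultimately show "d ((f ^^ j) x) ((f ^^ j) y) < r"
      using d_sym[of "(f ^^ j) x" "(f ^^ j) x'"] by linarith
  qed
qed

lemma small_cover:
  assumes "compact J" "0 < r"
  obtains Ps where "J \<subseteq> \<Union>(set Ps)" "Ps \<noteq> []" "\<And>P x y. P \<in> set Ps \<Longrightarrow> x \<in> P \<Longrightarrow> y \<in> P \<Longrightarrow> d x y < r"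
proof -
  define B where "B x = {y. d x y < r / 2}" for x
  have cov: "J \<subseteq> (\<Union>x\<in>J. B x)" using assms by (auto simp: B_def)
  have op: "open (B x)" for x unfolding B_def by (rule d_open)
  obtain F where F: "F \<subseteq> J" "finite F" "J \<subseteq> (\<Union>x\<in>F. B x)"
    by (rule compactE_image[OF assms(1) op cov])
  \<comment> \<open>The empty set keeps the list non-empty even if \<open>J\<close> is empty; its
    length is a denominator later.\<close>
  have "finite (insert {} (B ` F))" using F(2) by simp
  then obtain Ps where Ps: "set Ps = insert {} (B ` F)" by (elim exE[OF finite_list])
  have "d y z < r" if "y \<in> B x" "z \<in> B x" for x y z
    using d_triangle[of y z x] d_sym[of y x] that unfolding B_def mem_Collect_eq by linarith
  moreover have "J \<subseteq> \<Union>(set Ps)" using F(3) unfolding Ps by simp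
  moreover have "Ps \<noteq> []" using Ps by (cases Ps) simp_all
  ultimately show ?thesis using Ps by (intro that[of Ps]) (simp, simp, blast)
qed

lemma sum_list_concat_map:
  "sum_list (map h (concat (map F ys))) = (\<Sum>y\<leftarrow>ys. sum_list (map h (F y)))"
  by (induction ys) auto

text \<open>An entry encodes a sequence of blocks: \<open>D\<close> consists of points that follow
  it, \<open>L\<close> is its total length and \<open>W\<close> the product of the weights of its
  blocks. Only a lower bound of \<open>W\<close> by length and bad visits is recorded, which is what
  later converts diameters into weights.\<close>

definition code_block :: "real \<Rightarrow> real \<Rightarrow> real \<Rightarrow> 'a set \<Rightarrow> nat \<Rightarrow> 'a set \<times> nat \<times> real \<Rightarrow> bool" where
  "code_block r s \<theta> S n p \<longleftrightarrow> (case p of (D, L, W) \<Rightarrow> n \<le> L \<and> 0 \<le> W \<and> D \<subseteq> J \<and>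
      (\<forall>x\<in>D. \<forall>y\<in>D. \<forall>j<L. d ((f ^^ j) x) ((f ^^ j) y) < r) \<and>
      (\<forall>x\<in>D. exp (- s * real L) * \<theta> ^ visits f (- S) L x \<le> W))"

lemma code_blockD:
  assumes "code_block r s \<theta> S n (D, L, W)"
  shows "n \<le> L" "0 \<le> W" "D \<subseteq> J"
    "\<And>x y j. x \<in> D \<Longrightarrow> y \<in> D \<Longrightarrow> j < L \<Longrightarrow> d ((f ^^ j) x) ((f ^^ j) y) < r"
    "\<And>x. x \<in> D \<Longrightarrow> exp (- s * real L) * \<theta> ^ visits f (- S) L x \<le> W"
  using assms unfolding code_block_def by auto

text \<open>The orbit of a point is cut into blocks: a long one of length \<open>l i\<close> whenever it starts
  in \<open>V i\<close>, and blocks of length 1 otherwise. The total weight of the block sequences that are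
  stopped as soon as their length reaches \<open>n\<close> stays bounded by 1 when \<open>n\<close> grows.\<close>

lemma coding_cover:
  fixes V :: "nat \<Rightarrow> 'a set" and l :: "nat \<Rightarrow> nat" and \<theta> s :: real
  assumes l: "\<And>i. i < m \<Longrightarrow> 1 \<le> l i"
    and V: "\<And>i x y j. i < m \<Longrightarrow> x \<in> V i \<Longrightarrow> y \<in> V i \<Longrightarrow> j < l i \<Longrightarrow> d ((f ^^ j) x) ((f ^^ j) y) < r"
    and Ps: "J \<subseteq> \<Union>(set Ps)" "\<And>P x y. P \<in> set Ps \<Longrightarrow> x \<in> P \<Longrightarrow> y \<in> P \<Longrightarrow> d x y < r"
    and S: "S \<subseteq> (\<Union>i<m. V i)" and s: "0 \<le> s" and \<theta>: "0 \<le> \<theta>" "\<theta> \<le> 1"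
    and weights: "(\<Sum>i<m. exp (- s * real (l i))) + \<theta> * real (length Ps) \<le> 1"
  shows "\<exists>xs. J \<subseteq> \<Union>(fst ` set xs) \<and> (\<Sum>p\<leftarrow>xs. snd (snd p)) \<le> 1 \<and> (\<forall>p\<in>set xs. code_block r s \<theta> S n p)"
    (is "\<exists>xs. ?Q n xs")
proof (induction n rule: less_induct)
  case (less n)
  show ?case
  proof (cases "n = 0")
    case True
    \<comment> \<open>The empty block sequence, followed by every point, with weight 1.\<close>
    have "?Q n [(J, 0, 1)]" using True by (simp add: code_block_def)
    then show ?thesis by (rule exI)
  next
    case n0: False
    have "\<exists>xs. ?Q (n - l i) xs" if "i < m" for i
      by (rule less.IH) (use l[OF that] n0 in auto)
    then have "\<forall>i. \<exists>xs. i < m \<longrightarrow> ?Q (n - l i) xs" by blast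
    from choice[OF this] obtain X where "\<forall>i. i < m \<longrightarrow> ?Q (n - l i) (X i)" by (elim exE)
    then have X: "J \<subseteq> \<Union>(fst ` set (X i))" "(\<Sum>p\<leftarrow>X i. snd (snd p)) \<le> 1"
      "\<And>p. p \<in> set (X i) \<Longrightarrow> code_block r s \<theta> S (n - l i) p" if "i < m" for i using that by simp_all
    have "\<exists>xs. ?Q (n - 1) xs" by (rule less.IH) (use n0 in auto)
    then obtain X' where "?Q (n - 1) X'" by (elim exE)
    then have X': "J \<subseteq> \<Union>(fst ` set X')" "(\<Sum>p\<leftarrow>X'. snd (snd p)) \<le> 1"
      "\<And>p. p \<in> set X' \<Longrightarrow> code_block r s \<theta> S (n - 1) p" by simp_all
    \<comment> \<open>\<open>gd\<close> and \<open>bd\<close> put one block in front of a sequence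
      for the remaining time: a long block for \<open>V i\<close>, or a single bad step inside
      \<open>P\<close>. The subtraction \<open>n - l i\<close> is truncated at 0, so that a sequence
      stops once its length has reached n.\<close>
    define gd where "gd = (\<lambda>i (D, L, W). ({x \<in> J. x \<in> V i \<and> (f ^^ l i) x \<in> D}, l i + L,
        exp (- s * real (l i)) * W))"
    define bd where "bd = (\<lambda>P (D, L, W). ({x \<in> J. x \<in> P \<and> x \<notin> S \<and> f x \<in> D}, Suc L, \<theta> * W))"
    define xs :: "('a set \<times> nat \<times> real) list" where
      "xs = concat (map (\<lambda>i. map (gd i) (X i)) [0..<m]) @ concat (map (\<lambda>P. map (bd P) X') Ps)"
    have set_xs: "set xs = (\<Union>i<m. gd i ` set (X i)) \<union> (\<Union>P\<in>set Ps. bd P ` set X')"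
      by (auto simp: xs_def)
    have "J \<subseteq> \<Union>(fst ` set xs)"
    proof
      fix x assume x: "x \<in> J"
      show "x \<in> \<Union>(fst ` set xs)"
      proof (cases "x \<in> S")
        case True
        then obtain i where i: "i < m" "x \<in> V i" using S by auto
        have "(f ^^ l i) x \<in> \<Union>(fst ` set (X i))" using X(1)[OF i(1)] funpow_J[OF x] by (rule subsetD)
        then obtain p where p: "p \<in> set (X i)" "(f ^^ l i) x \<in> fst p" by blast
        have "gd i p \<in> set xs" using p i by (auto simp: set_xs)
        moreover have "x \<in> fst (gd i p)" using p i x by (auto simp: gd_def case_prod_beta)
        ultimately show ?thesis by blast
      next
        case False
        obtain P where P: "P \<in> set Ps" "x \<in> P" using Ps x by blast
        have "f x \<in> \<Union>(fst ` set X')" using X'(1) f_J[OF x] by (rule subsetD)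
        then obtain p where p: "p \<in> set X'" "f x \<in> fst p" by blast
        have "bd P p \<in> set xs" using p P by (auto simp: set_xs)
        moreover have "x \<in> fst (bd P p)" using p P x False by (auto simp: bd_def case_prod_beta)
        ultimately show ?thesis by blast
      qed
    qed
    moreover have "(\<Sum>p\<leftarrow>xs. snd (snd p)) \<le> 1"
    proof -
      have gd: "snd (snd (gd i p)) = exp (- s * real (l i)) * snd (snd p)" for i p
        by (simp add: gd_def case_prod_beta)
      have bd: "snd (snd (bd P p)) = \<theta> * snd (snd p)" for P p
        by (simp add: bd_def case_prod_beta)
      \<comment> \<open>Kraft's inequality by recursion on the first block: the totals for the
        shorter times are at most 1, so the new total is at most the sum of the weights of the
        possible first blocks.\<close>
      have "(\<Sum>p\<leftarrow>xs. snd (snd p)) = (\<Sum>i\<leftarrow>[0..<m]. exp (- s * real (l i)) * (\<Sum>p\<leftarrow>X i. snd (snd p))) +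
          (\<Sum>P\<leftarrow>Ps. \<theta> * (\<Sum>p\<leftarrow>X'. snd (snd p)))"
        by (simp add: xs_def sum_list_concat_map comp_def gd bd sum_list_const_mult)
      also have "\<dots> \<le> (\<Sum>i\<leftarrow>[0..<m]. exp (- s * real (l i)) * 1) + (\<Sum>P\<leftarrow>Ps. \<theta> * 1)"
        by (intro add_mono sum_list_mono mult_left_mono) (use X(2) X'(2) \<theta> in auto)
      also have "\<dots> = (\<Sum>i<m. exp (- s * real (l i))) + \<theta> * real (length Ps)"
        by (simp add: sum_list_triv interv_sum_list_conv_sum_set_nat atLeast0LessThan)
      finally show ?thesis using weights by linarith
    qed
    moreover have "\<forall>q\<in>set xs. code_block r s \<theta> S n q"
    proof
      fix q assume "q \<in> set xs"
      then consider (good) i p where "i < m" "p \<in> set (X i)" "q = gd i p"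
        | (bad) P p where "P \<in> set Ps" "p \<in> set X'" "q = bd P p"
        unfolding set_xs by blast
      then show "code_block r s \<theta> S n q"
      proof cases
        case good
        obtain D L W where p: "p = (D, L, W)" by (cases p)
        note * = code_blockD[OF X(3)[OF good(1,2), unfolded p]]
        have "d ((f ^^ j) x) ((f ^^ j) y) < r" if "x \<in> V i" "y \<in> V i" "(f ^^ l i) x \<in> D"
          "(f ^^ l i) y \<in> D" "j < l i + L" for x y j
        proof (cases "j < l i")
          case False
          have "(f ^^ (j - l i)) ((f ^^ l i) z) = (f ^^ j) z" for z
            using False funpow_add[of "j - l i" "l i" f] by (simp add: fun_eq_iff)
          with *(4)[OF that(3,4), of "j - l i"] False that(5) show ?thesis by simp
        qed (use V[OF good(1)] that in auto)
        moreover have "exp (- s * real (l i + L)) * \<theta> ^ visits f (- S) (l i + L) x \<le>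
            exp (- s * real (l i)) * W" if "(f ^^ l i) x \<in> D" for x
        proof -
          \<comment> \<open>Bad times inside a long block are not charged; they can only lower the
            power of \<open>\<theta>\<close>.\<close>
          have "\<theta> ^ visits f (- S) (l i + L) x \<le> \<theta> ^ visits f (- S) L ((f ^^ l i) x)"
            using \<theta> by (intro power_decreasing) (auto simp: visits_add)
          then have "exp (- s * real L) * \<theta> ^ visits f (- S) (l i + L) x \<le> W"
            using *(5)[OF that] by (meson exp_ge_zero mult_left_mono order_trans)
          then have "exp (- s * real (l i)) * (exp (- s * real L) * \<theta> ^ visits f (- S) (l i + L) x)
             \<le> exp (- s * real (l i)) * W" by (intro mult_left_mono) auto
          moreover have "exp (- s * real (l i + L)) = exp (- s * real (l i)) * exp (- s * real L)"
            by (simp add: exp_add[symmetric] algebra_simps)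
          ultimately show ?thesis by (simp only: mult.assoc)
        qed
        ultimately show ?thesis
          using *(1,2) unfolding good(3) gd_def p code_block_def by auto
      next
        case bad
        obtain D L W where p: "p = (D, L, W)" by (cases p)
        note * = code_blockD[OF X'(3)[OF bad(2), unfolded p]]
        have "d ((f ^^ j) x) ((f ^^ j) y) < r" if "x \<in> P" "y \<in> P" "f x \<in> D" "f y \<in> D" "j < Suc L" for x y j
          using Ps(2)[OF bad(1) that(1,2)] *(4)[OF that(3,4), of "j - 1"] that(5)
          by (cases j) (auto simp: funpow_swap1)
        moreover have "exp (- s * real (Suc L)) * \<theta> ^ visits f (- S) (Suc L) x \<le> \<theta> * W"
          if "f x \<in> D" "x \<notin> S" for x
        proof -
          \<comment> \<open>A bad step is charged \<open>\<theta>\<close> alone; the additional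
            factor exp (- s) in the bound is at most 1.\<close>
          have "exp (- s * real (Suc L)) \<le> exp (- s * real L)" using s by (simp add: algebra_simps)
          then have "exp (- s * real (Suc L)) * \<theta> ^ visits f (- S) L (f x) \<le> W"
            using *(5)[OF that(1)] \<theta> by (meson mult_right_mono order_trans zero_le_power)
          then have "\<theta> * (exp (- s * real (Suc L)) * \<theta> ^ visits f (- S) L (f x)) \<le> \<theta> * W"
            using \<theta> by (intro mult_left_mono) auto
          then show ?thesis using that(2) by (simp add: visits_Suc mult_ac)
        qed
        ultimately show ?thesis
          using *(1,2) \<theta> unfolding bad(3) bd_def p code_block_def by auto
      qed
    qed
    ultimately have "?Q n xs" by (intro conjI)
    then show ?thesis by (rule exI)
  qed
qed

text \<open>On the set in question both kinds of bad times have small frequency. A coded piece of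
  length L then has diameter at most a constant times exp (- a L), with a = \<alpha> - (\<alpha> +
  C) \<epsilon>, and weight at least exp (- s L + \<epsilon>' L ln \<theta>). The last rate
  condition bounds the t-th power of the diameter by a constant times exp (- c L) times the weight.
  As L \<ge> n and the weights sum to at most 1, the covers become arbitrarily cheap.\<close>

lemma freq_set_null:
  fixes V :: "nat \<Rightarrow> 'a set" and l :: "nat \<Rightarrow> nat" and \<theta> s :: real
  assumes ok: "scale_ok C k r" and \<alpha>: "0 \<le> \<alpha>" and C: "0 \<le> C" and t: "0 < t"
    and l: "\<And>i. i < m \<Longrightarrow> 1 \<le> l i"
    and V: "\<And>i x y j. i < m \<Longrightarrow> x \<in> V i \<Longrightarrow> y \<in> V i \<Longrightarrow> j < l i \<Longrightarrow> d ((f ^^ j) x) ((f ^^ j) y) < r"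
    and Ps: "J \<subseteq> \<Union>(set Ps)" "\<And>P x y. P \<in> set Ps \<Longrightarrow> x \<in> P \<Longrightarrow> y \<in> P \<Longrightarrow> d x y < r"
    and S: "S \<subseteq> (\<Union>i<m. V i)" and s: "0 \<le> s" and \<theta>: "0 < \<theta>" "\<theta> \<le> 1"
    and weights: "(\<Sum>i<m. exp (- s * real (l i))) + \<theta> * real (length Ps) \<le> 1"
    and rate: "0 < \<alpha> - (\<alpha> + C) * \<epsilon>" "0 < c" "c + s - \<epsilon>' * ln \<theta> \<le> t * (\<alpha> - (\<alpha> + C) * \<epsilon>)"
  shows "hausdorff_outer_measure (\<lambda>x y. ennreal (d x y)) t
    (freq_set (growth_set \<alpha> \<beta> k) \<epsilon> 0 \<inter> freq_set S \<epsilon>' 0) = 0"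
    (is "hausdorff_outer_measure _ t ?Z = 0")
proof (rule hausdorff_null_realI[OF t])
  fix \<delta> e :: real assume pos: "0 < \<delta>" "0 < e"
  define a where "a = \<alpha> - (\<alpha> + C) * \<epsilon>"
  have a: "0 < a" using rate by (simp add: a_def)
  have r: "0 < r" using ok by (simp add: scale_ok_def)
  define R where "R = r * exp ((\<alpha> + C) * real k)"
  have R: "0 < R" using r by (simp add: R_def)
  have "\<forall>\<^sub>F n in sequentially. R * exp (- a * real n) < \<delta> \<and> R powr t * exp (- c * real n) < e \<and> 1 \<le> n"
    using order_tendstoD(2)[OF tendsto_exp_decay[OF a] pos(1)] order_tendstoD(2)[OF tendsto_exp_decay[OF rate(2)] pos(2)]
      eventually_ge_at_top[of 1] by eventually_elim blast
  then obtain n where n: "R * exp (- a * real n) < \<delta>" "R powr t * exp (- c * real n) < e" "1 \<le> n"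
    by (auto simp: eventually_sequentially)
  have "\<exists>xs. J \<subseteq> \<Union>(fst ` set xs) \<and> (\<Sum>p\<leftarrow>xs. snd (snd p)) \<le> 1 \<and> (\<forall>p\<in>set xs. code_block r s \<theta> S n p)"
    by (rule coding_cover[OF l V Ps S s _ \<theta>(2) weights]) (use \<theta> in simp_all)
  then obtain xs where xs: "J \<subseteq> \<Union>(fst ` set xs)" "(\<Sum>p\<leftarrow>xs. snd (snd p)) \<le> 1"
    "\<forall>p\<in>set xs. code_block r s \<theta> S n p" by (elim exE conjE)
  \<comment> \<open>The lower bound for the weight needs a point of the target set, so pieces that
    miss the target are given diameter bound 0.\<close>
  define h where "h = (\<lambda>(D, L, W :: real). (D \<inter> ?Z, if D \<inter> ?Z = {} then 0 else R * exp (- a * real (L :: nat))))"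
  have elem: "0 \<le> snd (h p) \<and> snd (h p) \<le> \<delta> \<and> (\<forall>x\<in>fst (h p). \<forall>y\<in>fst (h p). d x y \<le> snd (h p)) \<and>
      snd (h p) powr t \<le> R powr t * exp (- c * real n) * snd (snd p)"
    if p_in: "p \<in> set xs" for p
  proof -
    obtain D L W where p: "p = (D, L, W)" by (cases p)
    note * = code_blockD[OF bspec[OF xs(3) p_in, unfolded p]]
    show ?thesis
    proof (cases "D \<inter> ?Z = {}")
      case True
      then have h: "h p = ({}, 0)" by (simp add: h_def p)
      show ?thesis unfolding h using pos t *(2) by (simp add: p)
    next
      case False
      then have h: "h p = (D \<inter> ?Z, R * exp (- a * real L))" by (simp add: h_def p)
      have "d x y \<le> R * exp (- a * real L)" if "x \<in> D \<inter> ?Z" "y \<in> D \<inter> ?Z" for x y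
      proof -
        let ?v = "real (visits f (- growth_set \<alpha> \<beta> k) L x)"
        have "d x y \<le> r * exp ((\<alpha> + C) * real k - \<alpha> * real L + (\<alpha> + C) * ?v)"
          by (rule shadowing_contraction[OF ok \<alpha> C]) (use that * n in auto)
        also have "?v \<le> \<epsilon> * real L" using that by (simp add: freq_set_def)
        then have "(\<alpha> + C) * real k - \<alpha> * real L + (\<alpha> + C) * ?v \<le> (\<alpha> + C) * real k + - a * real L"
          using mult_left_mono[of ?v "\<epsilon> * real L" "\<alpha> + C"] \<alpha> C by (simp add: a_def algebra_simps)
        then have "r * exp ((\<alpha> + C) * real k - \<alpha> * real L + (\<alpha> + C) * ?v) \<le>
            r * exp ((\<alpha> + C) * real k + - a * real L)" using r by simp
        also have "\<dots> = R * exp (- a * real L)" unfolding R_def exp_add by simp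
        finally show ?thesis .
      qed
      moreover have "R * exp (- a * real L) \<le> R * exp (- a * real n)" using * R a by simp
      then have "R * exp (- a * real L) \<le> \<delta>" using n by linarith
      moreover have "(R * exp (- a * real L)) powr t \<le> R powr t * exp (- c * real n) * W"
      proof -
        obtain x where x: "x \<in> D" "x \<in> ?Z" using False by blast
        let ?v = "visits f (- S) L x"
        have "real ?v \<le> \<epsilon>' * real L" using x by (simp add: freq_set_def)
        then have "\<theta> powr (\<epsilon>' * real L) \<le> \<theta> powr real ?v" using \<theta> by (intro powr_mono') auto
        also have "\<dots> = \<theta> ^ ?v" using \<theta> by (simp add: powr_realpow)
        finally have "exp (- s * real L) * \<theta> powr (\<epsilon>' * real L) \<le> W"
          using *(5)[OF x(1)] by (meson exp_ge_zero mult_left_mono order_trans)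
        then have W: "exp (- s * real L + \<epsilon>' * real L * ln \<theta>) \<le> W"
          using \<theta>(1) by (simp only: exp_add powr_def mult_ac) simp
        have "(c + s - \<epsilon>' * ln \<theta>) * real L \<le> t * a * real L"
          using rate(3) by (intro mult_right_mono) (auto simp: a_def)
        then have "- a * real L * t \<le> - c * real L + (- s * real L + \<epsilon>' * real L * ln \<theta>)"
          by (simp add: algebra_simps)
        also have "- c * real L \<le> - c * real n" using * rate by simp
        finally have "exp (- a * real L * t) \<le> exp (- c * real n + (- s * real L + \<epsilon>' * real L * ln \<theta>))"
          by simp
        also have "\<dots> \<le> exp (- c * real n) * W" unfolding exp_add[of "- c * real n"] using W by simp
        finally have "R powr t * exp (- a * real L * t) \<le> R powr t * (exp (- c * real n) * W)"
          by (intro mult_left_mono) auto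
        then show ?thesis using R by (simp add: powr_mult exp_powr_real mult_ac)
      qed
      ultimately show ?thesis unfolding h using R by (simp add: p)
    qed
  qed
  show "\<exists>xs :: ('a set \<times> real) list. ?Z \<subseteq> \<Union>(fst ` set xs) \<and>
      (\<forall>(U, D)\<in>set xs. 0 \<le> D \<and> D \<le> \<delta> \<and> (\<forall>x\<in>U. \<forall>y\<in>U. d x y \<le> D)) \<and>
      (\<Sum>(U, D)\<leftarrow>xs. D powr t) \<le> e"
  proof (intro exI[of _ "map h xs"] conjI)
    have "?Z \<subseteq> J" by (auto simp: freq_set_def)
    show "?Z \<subseteq> \<Union>(fst ` set (map h xs))"
    proof
      fix x assume x: "x \<in> ?Z"
      then have "x \<in> J" using \<open>?Z \<subseteq> J\<close> by blast
      then obtain p where p: "p \<in> set xs" "x \<in> fst p" using xs(1) by blast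
      then have "x \<in> fst (h p)" using x by (simp add: h_def case_prod_beta)
      with p show "x \<in> \<Union>(fst ` set (map h xs))" by auto
    qed
    show "\<forall>(U, D)\<in>set (map h xs). 0 \<le> D \<and> D \<le> \<delta> \<and> (\<forall>x\<in>U. \<forall>y\<in>U. d x y \<le> D)"
      using elem by (simp add: case_prod_beta)
    have "(\<Sum>(U, D)\<leftarrow>map h xs. D powr t) = (\<Sum>p\<leftarrow>xs. snd (h p) powr t)"
      by (simp add: comp_def case_prod_beta)
    also have "\<dots> \<le> (\<Sum>p\<leftarrow>xs. R powr t * exp (- c * real n) * snd (snd p))"
      by (rule sum_list_mono) (use elem in blast)
    also have "\<dots> = R powr t * exp (- c * real n) * (\<Sum>p\<leftarrow>xs. snd (snd p))"
      by (simp add: sum_list_const_mult)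
    also have "\<dots> \<le> R powr t * exp (- c * real n) * 1"
      by (intro mult_left_mono xs(2)) auto
    finally show "(\<Sum>(U, D)\<leftarrow>map h xs. D powr t) \<le> e" using n(2) by linarith
  qed
qed

end

section \<open>Ergodic measures\<close>

lemma (in prob_space) prob_Int_full:
  assumes "J \<in> events" "E \<in> events" "emeasure M J = 1"
  shows "prob (J \<inter> E) = prob E"
proof (rule measure_eq_AE)
  have "prob J = 1" using assms(3) by (simp add: measure_def)
  then have "AE x in M. x \<in> J" by (rule AE_prob_1)
  then show "AE x in M. x \<in> J \<inter> E \<longleftrightarrow> x \<in> E" by (rule eventually_mono) simp
qed (use assms in auto)

context metric_dynamics begin

section \<open>Measurability of visit counts and of the frequency sets\<close>

lemma f_measurable [measurable]: "f \<in> borel \<rightarrow>\<^sub>M borel"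
  by (rule borel_measurable_continuous_onI[OF f_cont])

lemma funpow_measurable [measurable]: "f ^^ n \<in> borel \<rightarrow>\<^sub>M borel"
  by (rule borel_measurable_continuous_onI[OF funpow_cont])

lemma visits_measurable:
  assumes [measurable]: "B \<in> sets borel"
  shows "(\<lambda>x. real (visits f B n x)) \<in> borel_measurable borel"
proof -
  have "real (visits f B n x) = (\<Sum>j<n. indicator B ((f ^^ j) x))" for x
  proof -
    have "(\<Sum>j<n. indicator B ((f ^^ j) x) :: real) = (\<Sum>j\<in>{j. j < n \<and> (f ^^ j) x \<in> B}. 1)"
      by (rule sum.mono_neutral_cong_right) (auto simp: indicator_def)
    then show ?thesis by (simp add: visits_def)
  qed
  moreover have "(\<lambda>x. \<Sum>j<n. indicator B ((f ^^ j) x) :: real) \<in> borel_measurable borel"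
  proof (intro borel_measurable_sum)
    fix j
    have [measurable]: "f ^^ j \<in> borel \<rightarrow>\<^sub>M borel" by (rule funpow_measurable)
    show "(\<lambda>x. indicator B ((f ^^ j) x) :: real) \<in> borel_measurable borel" by measurable
  qed
  ultimately show ?thesis by simp
qed

lemma freq_bound_borel:
  assumes "S \<in> sets borel"
  shows "{x. \<forall>n. real (visits f (- S) n x) \<le> \<epsilon> * real n + q} \<in> sets borel"
proof -
  have [measurable]: "(\<lambda>x. real (visits f (- S) n x)) \<in> borel_measurable borel" for n
    by (rule visits_measurable) (use assms in simp)
  have "{x \<in> space borel. \<forall>n. real (visits f (- S) n x) \<le> \<epsilon> * real n + q} \<in> sets borel"
    by measurable
  then show ?thesis by simp
qed

lemma freq_set_alt: "freq_set S \<epsilon> q = J \<inter> {x. \<forall>n. real (visits f (- S) n x) \<le> \<epsilon> * real n + q}"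
  by (auto simp: freq_set_def)

lemma freq_set_borel:
  "J \<in> sets borel \<Longrightarrow> S \<in> sets borel \<Longrightarrow> freq_set S \<epsilon> q \<in> sets borel"
  unfolding freq_set_alt by (intro sets.Int freq_bound_borel)

text \<open>A pair that fails the growth condition excludes an open set of points \<open>z\<close>,
  the intersection of two \<open>d\<close>-balls. So the growth set is \<open>J\<close> minus an
  open set, however many pairs fail.\<close>

lemma growth_set_borel:
  assumes "J \<in> sets borel" shows "growth_set \<alpha> \<beta> k \<in> sets borel"
proof -
  define e where "e = 1 / real (Suc k)"
  define U where "U = (\<Union>p\<in>{(x, y). x \<in> J \<and> y \<in> J \<and> \<not> growth_pair \<alpha> \<beta> k x y}.
    {z. d z (fst p) < e} \<inter> {z. d z (snd p) < e})"
  have d_open': "open {z. d z x < e}" for x using d_open[of x e] by (simp add: d_sym[of x])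
  have "open U" unfolding U_def by (intro open_UN ballI open_Int d_open')
  moreover have "growth_set \<alpha> \<beta> k = J - U"
    unfolding growth_set_def U_def e_def[symmetric] by auto
  ultimately show ?thesis using assms by auto
qed

lemma invariant_distr:
  assumes "\<nu> \<in> invariant_measures f J" shows "distr \<nu> \<nu> f = \<nu>"
proof -
  have sets: "sets \<nu> = sets borel" using assms by (simp add: invariant_measures_def)
  have sp: "space \<nu> = UNIV" using sets_eq_imp_space_eq[OF sets] by simp
  have f: "f \<in> \<nu> \<rightarrow>\<^sub>M \<nu>" using f_measurable unfolding measurable_cong_sets[OF sets sets] .
  show ?thesis
  proof (rule measure_eqI)
    fix B assume B: "B \<in> sets (distr \<nu> \<nu> f)"
    then have B': "B \<in> sets \<nu>" by simp
    have inv: "\<forall>B\<in>sets borel. emeasure \<nu> (f -` B) = emeasure \<nu> B"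
      using assms by (simp add: invariant_measures_def)
    have "emeasure (distr \<nu> \<nu> f) B = emeasure \<nu> (f -` B)"
      unfolding emeasure_distr[OF f B'] sp by simp
    also have "\<dots> = emeasure \<nu> B" using bspec[OF inv, of B] B' unfolding sets by blast
    finally show "emeasure (distr \<nu> \<nu> f) B = emeasure \<nu> B" .
  qed simp
qed

text \<open>A point of \<open>J\<close> outside the frequency set has more than \<epsilon> n bad
  visits for some n, so it belongs to the exceptional set of the maximal inequality. The factor 1 /
  \<epsilon> is the price for a bound at all times with \<open>q\<close> = 0.\<close>

lemma freq_set_measure:
  assumes \<nu>: "\<nu> \<in> invariant_measures f J" and J: "J \<in> sets borel" and S: "S \<in> sets borel"
    and \<epsilon>: "0 < \<epsilon>"
  shows "measure \<nu> (freq_set S \<epsilon> 0) \<ge> 1 - measure \<nu> (- S) / \<epsilon>"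
proof -
  have sets: "sets \<nu> = sets borel" and "prob_space \<nu>" and \<nu>J: "emeasure \<nu> J = 1"
    using \<nu> by (simp_all add: invariant_measures_def)
  interpret prob_space \<nu> by fact
  have sp: "space \<nu> = UNIV" using sets_eq_imp_space_eq[OF sets] by simp
  define E where "E = {x. \<forall>n. real (visits f (- S) n x) \<le> \<epsilon> * real n + 0}"
  have E: "E \<in> sets borel" unfolding E_def by (rule freq_bound_borel[OF S])
  have f: "f \<in> \<nu> \<rightarrow>\<^sub>M \<nu>" using f_measurable unfolding measurable_cong_sets[OF sets sets] .
  have "measure \<nu> (- E) \<le> measure \<nu> (- S) / \<epsilon>"
    by (rule maximal_visits[OF \<open>prob_space \<nu>\<close> f invariant_distr[OF \<nu>]])
      (use E S \<epsilon> sets in \<open>auto simp: E_def not_le\<close>)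
  moreover have "measure \<nu> (- E) = 1 - measure \<nu> E"
    using prob_compl[of E] E sets sp by (simp add: Compl_eq_Diff_UNIV)
  moreover have "measure \<nu> (J \<inter> E) = measure \<nu> E"
    using J E sets \<nu>J by (intro prob_Int_full) simp_all
  ultimately show ?thesis unfolding freq_set_alt E_def[symmetric] by simp
qed

text \<open>The set of points whose visits to \<open>- S\<close> obey a linear bound up to an additive constant is
  strictly invariant, so ergodicity replaces the pointwise ergodic theorem here.\<close>

lemma ergodic_freq_set:
  assumes \<nu>: "\<nu> \<in> ergodic_measures f J" and J: "J \<in> sets borel" and S: "S \<in> sets borel"
    and \<epsilon>: "0 < \<epsilon>" and small: "measure \<nu> (- S) < \<epsilon>" and \<eta>: "0 < \<eta>"
  shows "\<exists>q::nat. measure \<nu> (freq_set S \<epsilon> (real q)) > 1 - \<eta>"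
proof -
  have inv: "\<nu> \<in> invariant_measures f J" using \<nu> by (simp add: ergodic_measures_def)
  have sets: "sets \<nu> = sets borel" and "prob_space \<nu>" and \<nu>J: "emeasure \<nu> J = 1"
    using inv by (simp_all add: invariant_measures_def)
  interpret prob_space \<nu> by fact
  have sp: "space \<nu> = UNIV" using sets_eq_imp_space_eq[OF sets] by simp
  define E where "E q = {x. \<forall>n. real (visits f (- S) n x) \<le> \<epsilon> * real n + real q}" for q :: nat
  have E: "E q \<in> sets borel" for q unfolding E_def by (rule freq_bound_borel[OF S])
  \<comment> \<open>Passing to the image or back changes the bound only by a constant: 1 when going
    back, the ceiling of \<open>\<epsilon>\<close> when going forward. The union over
    \<open>q\<close> thus equals its preimage.\<close>
  have step: "f x \<in> E q \<Longrightarrow> x \<in> E (Suc q)" for x q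
  proof -
    assume fx: "f x \<in> E q"
    have "real (visits f (- S) n x) \<le> \<epsilon> * real n + real (Suc q)" for n
    proof (cases n)
      case 0 then show ?thesis by simp
    next
      case (Suc m)
      have "real (visits f (- S) m (f x)) \<le> \<epsilon> * real m + real q" using fx by (simp add: E_def)
      then show ?thesis using \<epsilon> by (auto simp: Suc visits_Suc algebra_simps)
    qed
    then show "x \<in> E (Suc q)" by (simp add: E_def)
  qed
  have step': "x \<in> E q \<Longrightarrow> \<exists>q'. f x \<in> E q'" for x q
  proof -
    assume x: "x \<in> E q"
    have "real (visits f (- S) n (f x)) \<le> \<epsilon> * real n + real (q + nat \<lceil>\<epsilon>\<rceil>)" for n
    proof -
      have "real (visits f (- S) (Suc n) x) \<le> \<epsilon> * real (Suc n) + real q" using x unfolding E_def by blast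
      moreover have "\<epsilon> \<le> real (nat \<lceil>\<epsilon>\<rceil>)" by linarith
      ultimately show ?thesis by (auto simp: visits_Suc algebra_simps split: if_splits)
    qed
    then have "f x \<in> E (q + nat \<lceil>\<epsilon>\<rceil>)" by (simp add: E_def)
    then show ?thesis by (rule exI)
  qed
  have "x \<in> f -` (\<Union>q. E q) \<longleftrightarrow> x \<in> (\<Union>q. E q)" for x using step[of x] step'[of x] by (auto simp del: visits_Suc)
  then have "f -` (\<Union>q. E q) = (\<Union>q. E q)" by (rule set_eqI)
  moreover have UE: "(\<Union>q. E q) \<in> sets borel" using E by auto
  moreover have "\<forall>B\<in>sets borel. f -` B = B \<longrightarrow> emeasure \<nu> B = 0 \<or> emeasure \<nu> B = 1"
    using \<nu> by (simp add: ergodic_measures_def)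
  ultimately have 01: "emeasure \<nu> (\<Union>q. E q) = 0 \<or> emeasure \<nu> (\<Union>q. E q) = 1" by blast
  \<comment> \<open>The maximal inequality makes the invariant union non-null, so ergodicity gives
    it full measure; monotone convergence then provides \<open>q\<close>.\<close>
  have "measure \<nu> (- S) / \<epsilon> < 1" using small \<epsilon> by simp
  then have "0 < measure \<nu> (freq_set S \<epsilon> 0)"
    using freq_set_measure[OF inv J S \<epsilon>] by linarith
  also have "\<dots> \<le> measure \<nu> (\<Union>q. E q)"
  proof (rule finite_measure_mono)
    have "freq_set S \<epsilon> 0 \<subseteq> E 0" by (simp add: freq_set_alt E_def)
    then show "freq_set S \<epsilon> 0 \<subseteq> (\<Union>q. E q)" by blast
    show "(\<Union>q. E q) \<in> events" unfolding sets by (rule UE)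
  qed
  finally have one: "measure \<nu> (\<Union>q. E q) = 1"
    using 01 unfolding emeasure_eq_measure by auto
  have "incseq E" unfolding incseq_Suc_iff E_def by (auto intro: order_trans)
  then have "(\<lambda>q. measure \<nu> (E q)) \<longlonglongrightarrow> 1"
    using finite_Lim_measure_incseq[of E] E sets one by (simp add: image_subset_iff)
  then have "\<forall>\<^sub>F q in sequentially. 1 - \<eta> < measure \<nu> (E q)"
    by (rule order_tendstoD(1)) (use \<eta> in simp)
  then obtain q where q: "1 - \<eta> < measure \<nu> (E q)" using eventually_happens[of _ sequentially] by auto
  have "measure \<nu> (J \<inter> E q) = measure \<nu> (E q)"
    using J E sets \<nu>J by (intro prob_Int_full) simp_all
  with q have "1 - \<eta> < measure \<nu> (freq_set S \<epsilon> (real q))" by (simp add: freq_set_alt E_def)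
  then show ?thesis by (rule exI)
qed

end

section \<open>Approximation of measures from inside by finite unions of basis sets\<close>

lemma prob_open_UN_approx:
  fixes V :: "nat \<Rightarrow> 'a::topological_space set"
  assumes M: "prob_space M" and sets: "sets M = sets borel" and V: "\<And>i. open (V i)"
    and a: "a < measure M (\<Union>i. V i)"
  shows "\<exists>m. a < measure M (\<Union>i<m. V i)"
proof -
  interpret prob_space M by fact
  define W where "W m = (\<Union>i<m. V i)" for m
  have W: "W m \<in> events" for m
    unfolding sets W_def by (intro borel_open open_UN ballI V)
  have "incseq W" unfolding W_def incseq_def by force
  moreover have "(\<Union>m. W m) = (\<Union>i. V i)" unfolding W_def by auto
  ultimately have "(\<lambda>m. prob (W m)) \<longlonglongrightarrow> prob (\<Union>i. V i)"
    using finite_Lim_measure_incseq[of W] W by (simp add: image_subset_iff)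
  then have "\<forall>\<^sub>F m in sequentially. a < prob (W m)" by (rule order_tendstoD(1)[OF _ a])
  then obtain m where "a < prob (W m)" using eventually_happens[of _ sequentially] by auto
  then show ?thesis unfolding W_def by (rule exI)
qed

text \<open>Continuity from below, used twice: finitely many \<open>V i\<close> carry enough mass,
  so that only finitely many block lengths enter; then finitely many basis sets inside them do, so
  that the resulting set belongs to a countable family.\<close>

lemma prob_open_basis_approx:
  fixes M :: "'a::topological_space measure"
  assumes M: "prob_space M" and sets: "sets M = sets borel"
    and B: "countable \<B>" "topological_basis \<B>"
    and V: "\<And>i::nat. open (V i)" and Y: "Y \<subseteq> (\<Union>i. V i)" and a: "a < measure M Y"
  shows "\<exists>F m. finite F \<and> F \<subseteq> \<B> \<and> \<Union>F \<subseteq> (\<Union>i<m. V i) \<and> a < measure M (\<Union>F)"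
proof -
  interpret prob_space M by fact
  have "(\<Union>i. V i) \<in> events" unfolding sets by (intro borel_open open_UN ballI V)
  then have "a < prob (\<Union>i. V i)" using finite_measure_mono[OF Y] a by simp
  then obtain m where m: "a < prob (\<Union>i<m. V i)"
    using prob_open_UN_approx[OF M sets, of V] V by blast
  have "open (\<Union>i<m. V i)" by (intro open_UN ballI V)
  then obtain D where D: "D \<subseteq> \<B>" "\<Union>D = (\<Union>i<m. V i)"
    using B(2) unfolding topological_basis_def by meson
  show ?thesis
  proof (cases "D = {}")
    case True
    then have "\<Union>{} \<subseteq> (\<Union>i<m. V i) \<and> a < prob (\<Union>{})" using m D by simp
    then show ?thesis by blast
  next
    case False
    have "countable D" using D(1) B(1) by (rule countable_subset)
    have r: "range (from_nat_into D) = D" by (rule range_from_nat_into[OF False \<open>countable D\<close>])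
    have "open (from_nat_into D i)" for i
      using from_nat_into[OF False, of i] D(1) topological_basis_open[OF B(2)] by blast
    moreover have "a < prob (\<Union>i. from_nat_into D i)" using m unfolding r D(2) .
    ultimately obtain n where n: "a < prob (\<Union>i<n. from_nat_into D i)"
      using prob_open_UN_approx[OF M sets, of "from_nat_into D"] by blast
    define F where "F = from_nat_into D ` {..<n}"
    have F: "finite F" "F \<subseteq> D" "a < prob (\<Union>F)"
      using n r unfolding F_def by auto
    then have "\<Union>F \<subseteq> (\<Union>i<m. V i)" unfolding D(2)[symmetric] by blast
    then show ?thesis using F D(1) by (intro exI[of _ F] exI[of _ m] conjI) auto
  qed
qed

context metric_dynamics begin

definition piece :: "real \<Rightarrow> real \<Rightarrow> nat \<Rightarrow> real \<Rightarrow> real \<Rightarrow> 'a set \<Rightarrow> 'a set" where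
  "piece \<alpha> \<beta> k \<epsilon> \<epsilon>' S = freq_set (growth_set \<alpha> \<beta> k) \<epsilon> 0 \<inter> freq_set S \<epsilon>' 0"

text \<open>The order of the choices matters: \<open>\<alpha>\<close> and \<open>\<beta>\<close>
  come from the gap between \<open>t\<close> and \<open>t'\<close>, then \<open>\<epsilon>\<close>,
  then \<open>k\<close> and the scale \<open>r\<close>, then the cover \<open>Ps\<close> with
  \<open>\<theta>\<close>, and only then \<open>\<epsilon>'\<close>. The carrier has to be exhausted
  up to a fraction of \<open>\<epsilon>'\<close>, too late to enlarge the growth set; the constant
  \<open>q\<close> achieves it.\<close>

lemma ergodic_piece:
  assumes \<nu>: "\<nu> \<in> ergodic_measures f J" and cJ: "compact J" and J: "J \<in> sets borel"
    and B: "countable \<B>" "topological_basis \<B>"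
    and C: "0 \<le> C" and r0: "0 < r0"
    and base: "\<And>x y. x \<in> J \<Longrightarrow> y \<in> J \<Longrightarrow> d x y < r0 \<Longrightarrow>
      d x y \<le> exp C * d (f x) (f y) \<and> d (f x) (f y) \<le> exp C * d x y"
    and \<Lambda>: "0 < \<Lambda>"
    and growth: "\<And>\<alpha> \<beta>. 0 < \<alpha> \<Longrightarrow> \<alpha> < \<Lambda> \<Longrightarrow> \<Lambda> < \<beta> \<Longrightarrow> AE x in \<nu>. \<exists>k. x \<in> growth_set \<alpha> \<beta> k"
    and t: "0 < t" "t < t'"
    and Y: "Y \<in> sets borel" "emeasure \<nu> Y = 1"
      "hausdorff_outer_measure (\<lambda>x y. ennreal (d x y)) t (Y \<inter> J) = 0"
    and \<eta>: "0 < \<eta>" "\<eta> \<le> 1"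
  shows "\<exists>\<alpha>\<in>\<rat>. \<exists>\<beta>\<in>\<rat>. \<exists>k. \<exists>\<epsilon>\<in>\<rat>. \<exists>\<epsilon>'\<in>\<rat>. \<exists>F. finite F \<and> F \<subseteq> \<B> \<and>
    hausdorff_outer_measure (\<lambda>x y. ennreal (d x y)) t' (piece \<alpha> \<beta> k \<epsilon> \<epsilon>' (\<Union>F)) = 0 \<and>
    1 - \<eta> \<le> measure \<nu> (piece \<alpha> \<beta> k \<epsilon> \<epsilon>' (\<Union>F))"
proof -
  have inv: "\<nu> \<in> invariant_measures f J" using \<nu> by (simp add: ergodic_measures_def)
  have sets: "sets \<nu> = sets borel" and "prob_space \<nu>" and \<nu>J: "emeasure \<nu> J = 1"
    using inv by (simp_all add: invariant_measures_def)
  interpret prob_space \<nu> by fact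
  have sp: "space \<nu> = UNIV" using sets_eq_imp_space_eq[OF sets] by simp

  \<comment> \<open>\<open>u\<close> solves \<open>u_eq\<close>. This makes t (\<Lambda> + u) less
    than t' (\<Lambda> - u), so t \<beta> < t' \<alpha> for rates within \<open>u\<close> of
    \<open>\<Lambda>\<close>.\<close>
  define u where "u = \<Lambda> * (t' - t) / (2 * (t' + t))"
  have u: "0 < u" using t \<Lambda> by (simp add: u_def)
  have "u * (2 * (t' + t)) = \<Lambda> * (t' - t)" using t by (simp add: u_def)
  then have u_eq: "t * (\<Lambda> + u) + u * (t' + t) = t' * (\<Lambda> - u)" by (simp add: algebra_simps)
  have "u < \<Lambda>"
  proof -
    have "0 < t * (\<Lambda> + u) + u * (t' + t)" using t \<Lambda> u by (simp add: add_pos_pos)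
    then have "0 < t' * (\<Lambda> - u)" unfolding u_eq .
    then show ?thesis using t by (simp add: zero_less_mult_iff)
  qed
  then have "max 0 (\<Lambda> - u) < \<Lambda>" "\<Lambda> < \<Lambda> + u" using u \<Lambda> by auto
  then obtain \<alpha> \<beta> where \<alpha>: "\<alpha> \<in> \<rat>" "max 0 (\<Lambda> - u) < \<alpha>" "\<alpha> < \<Lambda>" and \<beta>: "\<beta> \<in> \<rat>" "\<Lambda> < \<beta>" "\<beta> < \<Lambda> + u"
    using Rats_dense_in_real by meson
  have \<alpha>0: "0 < \<alpha>" and \<beta>0: "0 < \<beta>" using \<alpha> \<beta> \<Lambda> by auto
  \<comment> \<open>The gap is spent in quarters: one on the terms with \<open>\<epsilon>\<close>,
    two on the price of bad steps, and one remains as the rate of decay.\<close>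
  define c where "c = (t' * \<alpha> - t * \<beta>) / 4"
  have c4: "t' * \<alpha> = t * \<beta> + 4 * c" by (simp add: c_def field_simps)
  have c: "0 < c"
  proof -
    have "t * \<beta> < t * (\<Lambda> + u)" using t \<beta> by simp
    also have "\<dots> < t' * (\<Lambda> - u)" unfolding u_eq[symmetric] using t u by simp
    also have "\<dots> < t' * \<alpha>" using t \<alpha> by simp
    finally show ?thesis by (simp add: c_def)
  qed
  define w where "w = (t' + t) * (\<alpha> + C) + 1"
  have w: "0 < w" using t C \<alpha>0 by (simp add: w_def add_nonneg_pos)
  obtain \<epsilon> where \<epsilon>: "\<epsilon> \<in> \<rat>" "0 < \<epsilon>" "\<epsilon> < min 1 (c / w)"
    using Rats_dense_in_real[of 0 "min 1 (c / w)"] c w by auto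
  have \<epsilon>w: "\<epsilon> * w < c" using \<epsilon> w by (simp add: pos_less_divide_eq)
  have \<epsilon>1: "t' * ((\<alpha> + C) * \<epsilon>) + t * (C * \<epsilon>) \<le> c"
  proof -
    have "t' * ((\<alpha> + C) * \<epsilon>) + t * (C * \<epsilon>) \<le> \<epsilon> * w"
      using t C \<alpha>0 \<epsilon> by (simp add: w_def algebra_simps)
    with \<epsilon>w show ?thesis by simp
  qed
  define s where "s = t * (\<beta> + C * \<epsilon>)"
  have s: "0 \<le> s" using t \<beta>0 C \<epsilon> by (simp add: s_def)
  have rate: "3 * c + s \<le> t' * (\<alpha> - (\<alpha> + C) * \<epsilon>)"
    using c4 \<epsilon>1 by (simp add: s_def algebra_simps)
  have a_pos: "0 < \<alpha> - (\<alpha> + C) * \<epsilon>"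
  proof -
    have "0 < t' * (\<alpha> - (\<alpha> + C) * \<epsilon>)" using rate c s by linarith
    then show ?thesis using t by (simp add: zero_less_mult_iff)
  qed

  \<comment> \<open>Small for two purposes: below \<open>\<epsilon>\<close> for the ergodic
    argument, and at most \<eta> / 4 after division by \<open>\<epsilon>\<close> in the final
    measure estimate.\<close>
  obtain k where k: "measure \<nu> (- growth_set \<alpha> \<beta> k) < \<epsilon> * (\<eta> / 4)"
  proof -
    have ev: "growth_set \<alpha> \<beta> k \<in> events" for k unfolding sets by (rule growth_set_borel[OF J])
    have "AE x in \<nu>. x \<in> (\<Union>k. growth_set \<alpha> \<beta> k)"
      using growth[OF \<alpha>0 \<alpha>(3) \<beta>(2)] by simp
    then have one: "prob (\<Union>k. growth_set \<alpha> \<beta> k) = 1"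
      using ev by (subst prob_eq_1) auto
    have "incseq (growth_set \<alpha> \<beta>)" by (simp add: incseq_def growth_set_mono)
    then have "(\<lambda>k. prob (growth_set \<alpha> \<beta> k)) \<longlonglongrightarrow> 1"
      using finite_Lim_measure_incseq[of "growth_set \<alpha> \<beta>"] ev one by (simp add: image_subset_iff)
    then have "\<forall>\<^sub>F k in sequentially. 1 - \<epsilon> * (\<eta> / 4) < prob (growth_set \<alpha> \<beta> k)"
      by (rule order_tendstoD(1)) (use \<eta> \<epsilon> in simp)
    then obtain k where "1 - \<epsilon> * (\<eta> / 4) < prob (growth_set \<alpha> \<beta> k)"
      using eventually_happens[of _ sequentially] by auto
    moreover have "prob (- growth_set \<alpha> \<beta> k) = 1 - prob (growth_set \<alpha> \<beta> k)"
      using prob_compl[OF ev[of k]] sp by (simp add: Compl_eq_Diff_UNIV)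
    ultimately show ?thesis by (intro that[of k]) linarith
  qed
  let ?G = "growth_set \<alpha> \<beta> k"
  have G: "?G \<in> sets borel" by (rule growth_set_borel[OF J])
  define r where "r = min r0 (1 / real (Suc k))"
  have r: "0 < r" using r0 by (simp add: r_def)
  have ok: "scale_ok C k r" unfolding scale_ok_def r_def using r0 base by simp
  obtain Ps where Ps: "J \<subseteq> \<Union>(set Ps)" "Ps \<noteq> []"
    "\<And>P x y. P \<in> set Ps \<Longrightarrow> x \<in> P \<Longrightarrow> y \<in> P \<Longrightarrow> d x y < r"
    using small_cover[OF cJ r] by metis
  \<comment> \<open>The bad steps share half of the total weight; the long blocks get the other half
    through the bound 1/2 demanded of the cover below.\<close>
  define \<theta> where "\<theta> = 1 / (2 * real (length Ps))"
  have lPs: "1 \<le> real (length Ps)" using Ps(2) by (cases Ps) auto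
  have \<theta>: "0 < \<theta>" "\<theta> \<le> 1"
  proof -
    have "0 < 1 / (2 * n) \<and> 1 / (2 * n) \<le> 1" if "1 \<le> n" for n :: real
      using that by (simp add: divide_le_eq)
    from this[OF lPs] show "0 < \<theta>" "\<theta> \<le> 1" unfolding \<theta>_def by blast+
  qed
  have \<theta>': "\<theta> * real (length Ps) = 1 / 2" using Ps(2) by (simp add: \<theta>_def)
  have ln: "0 < 1 - ln \<theta>" using ln_le_zero_iff[of \<theta>] \<theta> by linarith
  \<comment> \<open>Bad steps of frequency \<open>\<epsilon>'\<close> cost - \<epsilon>' ln \<theta>
    per unit of time, which has to fit into two quarters of the gap.\<close>
  obtain \<epsilon>' where \<epsilon>': "\<epsilon>' \<in> \<rat>" "0 < \<epsilon>'" "\<epsilon>' < 2 * c / (1 - ln \<theta>)"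
    using Rats_dense_in_real[of 0 "2 * c / (1 - ln \<theta>)"] c ln by auto
  have "\<epsilon>' * (1 - ln \<theta>) < 2 * c" using \<epsilon>' ln by (simp add: pos_less_divide_eq)
  then have \<epsilon>'1: "- \<epsilon>' * ln \<theta> \<le> 2 * c" using \<epsilon>' by (simp add: algebra_simps)

  have "measure \<nu> (- ?G) < \<epsilon>"
  proof -
    have "\<epsilon> * (\<eta> / 4) \<le> \<epsilon> * 1" using \<epsilon> \<eta> by (intro mult_left_mono) auto
    with k show ?thesis by simp
  qed
  moreover have "0 < \<epsilon>' * (\<eta> / 4)" using \<epsilon>' \<eta> by simp
  ultimately obtain q :: nat where q: "measure \<nu> (freq_set ?G \<epsilon> (real q)) > 1 - \<epsilon>' * (\<eta> / 4)"
    using ergodic_freq_set[OF \<nu> J G \<epsilon>(2)] by blast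
  define X where "X = Y \<inter> freq_set ?G \<epsilon> (real q)"
  have XJ: "X \<subseteq> Y \<inter> J" by (auto simp: X_def freq_set_def)
  have fs: "freq_set ?G \<epsilon> (real q) \<in> events" unfolding sets by (rule freq_set_borel[OF J G])
  have X: "X \<in> events" using fs Y(1) unfolding X_def sets by blast
  have probX: "1 - \<epsilon>' * (\<eta> / 4) < prob X"
    using q prob_Int_full[of Y, OF _ fs Y(2)] Y(1) sets unfolding X_def by simp
  have null: "hausdorff_outer_measure (\<lambda>x y. ennreal (d x y)) t X = 0"
    by (rule hausdorff_null_mono[OF Y(3) XJ])
  have b_pos: "0 < \<beta> + C * \<epsilon>" using \<beta>0 C \<epsilon> by (simp add: add_pos_nonneg)
  \<comment> \<open>\<open>X\<close> is null for the exponent \<open>t\<close> and its points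
    separate at rate \<beta> + C \<epsilon>; the product of the two is \<open>s\<close>.\<close>
  obtain V :: "nat \<Rightarrow> 'a set" and l :: "nat \<Rightarrow> nat" where V:
    "X \<subseteq> (\<Union>i. V i)" "\<And>i. open (V i)" "\<And>i. 1 \<le> l i"
    "summable (\<lambda>i. exp (- s * real (l i)))" "(\<Sum>i. exp (- s * real (l i))) \<le> 1 / 2"
    "\<And>i x y j. x \<in> V i \<Longrightarrow> y \<in> V i \<Longrightarrow> j < l i \<Longrightarrow> d ((f ^^ j) x) ((f ^^ j) y) < r"
    using cover_refine[OF ok less_imp_le[OF \<beta>0] C b_pos t(1) _ _ null, of "1/2" \<alpha> "real q"]
    unfolding X_def s_def by (metis Int_lower2 half_gt_zero zero_less_one)
  obtain F m where F: "finite F" "F \<subseteq> \<B>" "\<Union>F \<subseteq> (\<Union>i<m. V i)" "1 - \<epsilon>' * (\<eta> / 4) < prob (\<Union>F)"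
    using prob_open_basis_approx[OF \<open>prob_space \<nu>\<close> sets B V(2) V(1) probX] by metis
  let ?S = "\<Union>F"
  have S: "?S \<in> sets borel"
    using F B(2) by (intro borel_open open_Union) (auto dest: topological_basis_open)
  have "(\<Sum>i<m. exp (- s * real (l i))) \<le> (\<Sum>i. exp (- s * real (l i)))"
    by (rule sum_le_suminf[OF V(4)]) auto
  then have weights: "(\<Sum>i<m. exp (- s * real (l i))) + \<theta> * real (length Ps) \<le> 1"
    using V(5) \<theta>' by linarith
  have "hausdorff_outer_measure (\<lambda>x y. ennreal (d x y)) t' (piece \<alpha> \<beta> k \<epsilon> \<epsilon>' ?S) = 0"
    unfolding piece_def
  proof (rule freq_set_null[OF ok less_imp_le[OF \<alpha>0] C _ V(3) V(6) Ps(1) Ps(3) F(3) s \<theta> weights a_pos c])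
    show "c + s - \<epsilon>' * ln \<theta> \<le> t' * (\<alpha> - (\<alpha> + C) * \<epsilon>)" using rate \<epsilon>'1 by linarith
    show "0 < t'" using t by linarith
  qed
  moreover have "1 - \<eta> \<le> measure \<nu> (piece \<alpha> \<beta> k \<epsilon> \<epsilon>' ?S)"
  proof -
    have 1: "measure \<nu> (- ?G) / \<epsilon> \<le> \<eta> / 4" using k \<epsilon> by (simp add: pos_divide_le_eq mult.commute)
    have Sev: "?S \<in> events" unfolding sets by (rule S)
    have "measure \<nu> (- ?S) = 1 - prob ?S"
      using prob_compl[OF Sev] sp by (simp add: Compl_eq_Diff_UNIV)
    then have "measure \<nu> (- ?S) \<le> \<epsilon>' * (\<eta> / 4)" using F(4) by linarith
    then have 2: "measure \<nu> (- ?S) / \<epsilon>' \<le> \<eta> / 4" using \<epsilon>' by (simp add: pos_divide_le_eq mult.commute)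
    define P1 where "P1 = freq_set ?G \<epsilon> 0"
    define P2 where "P2 = freq_set ?S \<epsilon>' 0"
    have ev: "P1 \<in> events" "P2 \<in> events"
      unfolding sets P1_def P2_def by (rule freq_set_borel[OF J G], rule freq_set_borel[OF J S])
    have P: "1 - \<eta> / 4 \<le> prob P1" "1 - \<eta> / 4 \<le> prob P2"
      using freq_set_measure[OF inv J G \<epsilon>(2)] freq_set_measure[OF inv J S \<epsilon>'(2)] 1 2
      unfolding P1_def P2_def by linarith+
    have "prob (P1 \<inter> P2) \<ge> prob P1 + prob P2 - 1"
    proof -
      have "prob P1 = prob (P1 \<inter> P2) + prob (P1 - P2)"
        using finite_measure_Diff'[OF ev] by linarith
      moreover have "prob (P1 - P2) \<le> prob (space \<nu> - P2)"
        by (rule finite_measure_mono[OF _ sets.compl_sets[OF ev(2)]]) (simp add: sp Diff_mono)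
      ultimately show ?thesis using prob_compl[OF ev(2)] by linarith
    qed
    with P \<eta> show ?thesis unfolding piece_def P1_def[symmetric] P2_def[symmetric] by linarith
  qed
  ultimately show ?thesis
    using \<alpha>(1) \<beta>(1) \<epsilon>(1) \<epsilon>'(1) F(1,2)
    by (intro bexI[of _ \<alpha>] bexI[of _ \<beta>] exI[of _ k] bexI[of _ \<epsilon>] bexI[of _ \<epsilon>'] exI[of _ F] conjI)
qed

end

section \<open>Strict differentiability in charts\<close>

text \<open>\<open>Ck_on\<close> gives continuity of the derivative for each fixed vector. Testing
  the finitely many basis vectors makes it uniform in the vector, at the cost of the factor
  \<open>DIM('b)\<close>.\<close>

lemma continuous_on_frechet_bound:
  fixes F :: "'b::euclidean_space \<Rightarrow> 'c::real_normed_vector"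
  assumes S: "open S" "y \<in> S" and diff: "\<And>x. x \<in> S \<Longrightarrow> F differentiable (at x)"
    and cont: "\<And>v. continuous_on S (\<lambda>x. frechet_derivative F (at x) v)" and e: "0 < e"
  obtains \<delta> where "0 < \<delta>" "ball y \<delta> \<subseteq> S"
    "\<And>x v. x \<in> ball y \<delta> \<Longrightarrow> norm (frechet_derivative F (at x) v - frechet_derivative F (at y) v) \<le> e * norm v"
proof -
  let ?D = "\<lambda>x. frechet_derivative F (at x)"
  define e' where "e' = e / real (DIM('b))"
  have e': "0 < e'" using e by (simp add: e'_def)
  have "\<forall>\<^sub>F x in nhds y. dist (?D x i) (?D y i) < e'" for i :: 'b
  proof -
    have "isCont (\<lambda>x. ?D x i) y" using cont S by (simp add: continuous_on_eq_continuous_at)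
    then have "((\<lambda>x. ?D x i) \<longlongrightarrow> ?D y i) (nhds y)"
      unfolding continuous_at by (rule tendsto_at_iff_tendsto_nhds[THEN iffD1])
    then show ?thesis using e' by (rule tendstoD)
  qed
  then have "\<forall>\<^sub>F x in nhds y. \<forall>i\<in>Basis. dist (?D x i) (?D y i) < e'"
    by (intro eventually_ball_finite) auto
  moreover have "\<forall>\<^sub>F x in nhds y. x \<in> S" using S by (rule eventually_nhds_in_open)
  ultimately have "\<forall>\<^sub>F x in nhds y. x \<in> S \<and> (\<forall>i\<in>Basis. dist (?D x i) (?D y i) < e')"
    by (rule eventually_conj[rotated])
  then obtain \<delta> where \<delta>: "0 < \<delta>" "\<And>x. dist x y < \<delta> \<Longrightarrow> x \<in> S \<and> (\<forall>i\<in>Basis. dist (?D x i) (?D y i) < e')"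
    unfolding eventually_nhds_metric by blast
  show ?thesis
  proof (rule that[OF \<delta>(1)])
    show "ball y \<delta> \<subseteq> S" using \<delta>(2) by (auto simp: dist_commute)
    fix x v assume "x \<in> ball y \<delta>"
    then have x: "x \<in> S" "\<And>i. i \<in> Basis \<Longrightarrow> norm (?D x i - ?D y i) \<le> e'"
      using \<delta>(2)[of x] by (auto simp: dist_commute dist_norm less_imp_le)
    have lin: "linear (?D x)" "linear (?D y)"
      using diff x S by (auto intro: linear_frechet_derivative)
    have rep: "?D z v = (\<Sum>i\<in>Basis. (v \<bullet> i) *\<^sub>R ?D z i)" if "linear (?D z)" for z
    proof -
      have "?D z v = ?D z (\<Sum>i\<in>Basis. (v \<bullet> i) *\<^sub>R i)" by (simp add: euclidean_representation)
      also have "\<dots> = (\<Sum>i\<in>Basis. (v \<bullet> i) *\<^sub>R ?D z i)"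
        by (simp add: linear_sum[OF that] linear_scale[OF that])
      finally show ?thesis .
    qed
    have "?D x v - ?D y v = (\<Sum>i\<in>Basis. (v \<bullet> i) *\<^sub>R (?D x i - ?D y i))"
      unfolding rep[OF lin(1)] rep[OF lin(2)] by (simp add: sum_subtractf scaleR_diff_right)
    also have "norm \<dots> \<le> (\<Sum>i\<in>(Basis :: 'b set). norm v * e')"
      by (intro sum_norm_le) (use x(2) in \<open>auto intro!: mult_mono Basis_le_norm\<close>)
    also have "\<dots> = e * norm v" by (simp add: e'_def)
    finally show "norm (?D x v - ?D y v) \<le> e * norm v" .
  qed
qed

text \<open>The mean value inequality for \<open>F\<close> minus its derivative at \<open>y\<close>,
  on a ball where the derivative hardly varies. Both points vary, as growth concerns pairs neither
  of which is the base point.\<close>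

lemma C1_strict_derivative:
  fixes F :: "'b::euclidean_space \<Rightarrow> 'c::real_normed_vector"
  assumes "Ck_on 1 S F" and S: "open S" "y \<in> S" and e: "0 < e"
  shows "\<exists>\<delta>>0. ball y \<delta> \<subseteq> S \<and> (\<forall>u\<in>ball y \<delta>. \<forall>v\<in>ball y \<delta>.
    norm (F v - F u - frechet_derivative F (at y) (v - u)) \<le> e * norm (v - u))"
proof -
  let ?D = "\<lambda>x. frechet_derivative F (at x)"
  have diff: "\<And>x. x \<in> S \<Longrightarrow> F differentiable (at x)"
    and cont: "\<And>v. continuous_on S (\<lambda>x. frechet_derivative F (at x) v)"
    using assms(1) by auto
  obtain \<delta> where \<delta>: "0 < \<delta>" "ball y \<delta> \<subseteq> S"
    "\<And>x v. x \<in> ball y \<delta> \<Longrightarrow> norm (?D x v - ?D y v) \<le> e * norm v"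
    using continuous_on_frechet_bound[OF S diff cont e] by metis
  have lin: "linear (?D y)" using diff S by (intro linear_frechet_derivative)
  have "norm (F v - F u - ?D y (v - u)) \<le> e * norm (v - u)" if "u \<in> ball y \<delta>" "v \<in> ball y \<delta>" for u v
  proof -
    define h where "h x = F x - ?D y x" for x
    have "norm (h v - h u) \<le> e * norm (v - u)"
    proof (rule differentiable_bound[where S="ball y \<delta>" and f'="\<lambda>x v. ?D x v - ?D y v"])
      fix x assume x: "x \<in> ball y \<delta>"
      have "(F has_derivative ?D x) (at x)"
        using diff[of x] x \<delta>(2) by (simp add: frechet_derivative_works subset_eq)
      moreover have "(?D y has_derivative ?D y) (at x)"
        using lin by (rule linear_imp_has_derivative)
      ultimately have "(h has_derivative (\<lambda>v. ?D x v - ?D y v)) (at x)"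
        unfolding h_def by (rule has_derivative_diff)
      then show "(h has_derivative (\<lambda>v. ?D x v - ?D y v)) (at x within ball y \<delta>)"
        by (rule has_derivative_at_withinI)
      show "onorm (\<lambda>v. ?D x v - ?D y v) \<le> e"
        using \<delta>(3)[OF x] by (intro onorm_bound) (use e in auto)
    qed (use that in auto)
    then show ?thesis by (simp add: h_def linear_diff[OF lin] algebra_simps)
  qed
  then show ?thesis using \<delta>(1,2) by blast
qed

section \<open>Elementary facts about a single chart\<close>

context
  fixes c :: "('a::topological_space, 'b::euclidean_space) chart"
  assumes c: "is_chart c"
begin

lemma chart_open: "open (fst c)" "open (snd c ` fst c)"
  using c by (simp_all add: is_chart_def)

lemma chart_inj: "inj_on (snd c) (fst c)"
  using c unfolding is_chart_def homeomorphism_def by (metis inj_onI)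

lemma chart_inv: "x \<in> fst c \<Longrightarrow> inv_into (fst c) (snd c) (snd c x) = x"
  by (rule inv_into_f_f[OF chart_inj])

lemma chart_cont: "continuous_on (fst c) (snd c)"
  using c by (simp add: is_chart_def homeomorphism_def)

lemma chart_inv_cont: "continuous_on (snd c ` fst c) (inv_into (fst c) (snd c))"
  using c by (simp add: is_chart_def homeomorphism_def)

lemma chart_open_image:
  assumes "open W" "W \<subseteq> fst c" shows "open (snd c ` W)"
proof -
  have "snd c ` W = inv_into (fst c) (snd c) -` W \<inter> snd c ` fst c"
    using assms(2) by (auto simp: chart_inv subset_eq)
  moreover have "open (inv_into (fst c) (snd c) -` W \<inter> snd c ` fst c)"
    using continuous_open_preimage[OF chart_inv_cont chart_open(2) assms(1)] by (simp add: Int_commute)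
  ultimately show ?thesis by simp
qed

lemma chart_open_vimage:
  assumes "open V" shows "open (fst c \<inter> snd c -` V)"
  using continuous_open_preimage[OF chart_cont chart_open(1) assms] .

end

text \<open>A strict derivative at \<open>p\<close> read in charts. The neighbourhoods lie in the
  manifold instead of the model space, so that compositions involve no inverse charts.\<close>

definition chart_deriv ::
  "('a::topological_space, 'b::euclidean_space) chart \<Rightarrow> ('a, 'b) chart \<Rightarrow> ('a \<Rightarrow> 'a) \<Rightarrow> 'a \<Rightarrow>
     ('b \<Rightarrow> 'b) \<Rightarrow> bool" where
  "chart_deriv c c' F p D \<longleftrightarrow> p \<in> fst c \<and> F p \<in> fst c' \<and> bounded_linear D \<and>
     (\<forall>e>0. \<exists>W. open W \<and> p \<in> W \<and> W \<subseteq> fst c \<and> F ` W \<subseteq> fst c' \<and>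
       (\<forall>x\<in>W. \<forall>y\<in>W. norm (snd c' (F y) - snd c' (F x) - D (snd c y - snd c x))
          \<le> e * norm (snd c y - snd c x)))"

lemma chart_derivE:
  assumes "chart_deriv c c' F p D" "0 < e"
  obtains W where "open W" "p \<in> W" "W \<subseteq> fst c" "F ` W \<subseteq> fst c'"
    "\<And>x y. x \<in> W \<Longrightarrow> y \<in> W \<Longrightarrow> norm (snd c' (F y) - snd c' (F x) - D (snd c y - snd c x))
          \<le> e * norm (snd c y - snd c x)"
  using assms unfolding chart_deriv_def by (elim conjE allE[of _ e] impE exE) (assumption, metis)

lemma chart_deriv_of_C1:
  fixes c c' :: "('a::topological_space, 'b::euclidean_space) chart"
  assumes c: "is_chart c" "is_chart c'" and F: "continuous_on UNIV F"
    and C1: "Ck_on 1 (snd c ` (fst c \<inter> F -` fst c')) (local_rep c c' F)"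
    and p: "p \<in> fst c" "F p \<in> fst c'"
  shows "chart_deriv c c' F p (frechet_derivative (local_rep c c' F) (at (snd c p)))"
  unfolding chart_deriv_def
proof (intro conjI allI impI)
  let ?D = "frechet_derivative (local_rep c c' F) (at (snd c p))"
  let ?W = "fst c \<inter> F -` fst c'"
  have W: "open ?W" using chart_open(1)[OF c(1)] open_vimage[OF chart_open(1)[OF c(2)] F] by (rule open_Int)
  have S: "open (snd c ` ?W)" by (rule chart_open_image[OF c(1) W]) simp
  have pS: "snd c p \<in> snd c ` ?W" using p by simp
  have "local_rep c c' F differentiable (at (snd c p))" using C1 pS by (metis One_nat_def Ck_on.simps(2))
  then show "bounded_linear ?D" using frechet_derivative_works has_derivative_bounded_linear by blast
  fix e :: real assume "0 < e"
  from C1_strict_derivative[OF C1 S pS this]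
  obtain \<delta> where \<delta>: "0 < \<delta>" "ball (snd c p) \<delta> \<subseteq> snd c ` ?W"
    "\<forall>u\<in>ball (snd c p) \<delta>. \<forall>v\<in>ball (snd c p) \<delta>. norm (local_rep c c' F v - local_rep c c' F u - ?D (v - u)) \<le> e * norm (v - u)"
    by (elim exE conjE)
  define W' where "W' = (fst c \<inter> snd c -` ball (snd c p) \<delta>) \<inter> ?W"
  have rep: "local_rep c c' F (snd c x) = snd c' (F x)" if "x \<in> fst c" for x
    using chart_inv[OF c(1) that] by (simp add: local_rep_def)
  have "open W'" unfolding W'_def by (intro open_Int chart_open_vimage c W open_ball)
  moreover have "\<forall>x\<in>W'. \<forall>y\<in>W'. norm (snd c' (F y) - snd c' (F x) - ?D (snd c y - snd c x))
      \<le> e * norm (snd c y - snd c x)"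
  proof (intro ballI)
    fix x y assume "x \<in> W'" "y \<in> W'"
    then show "norm (snd c' (F y) - snd c' (F x) - ?D (snd c y - snd c x)) \<le> e * norm (snd c y - snd c x)"
      using bspec[OF bspec[OF \<delta>(3), of "snd c x"], of "snd c y"] by (simp add: W'_def rep)
  qed
  moreover have "p \<in> W'" "W' \<subseteq> fst c" "F ` W' \<subseteq> fst c'" using p \<delta>(1) by (auto simp: W'_def)
  ultimately show "\<exists>W. open W \<and> p \<in> W \<and> W \<subseteq> fst c \<and> F ` W \<subseteq> fst c' \<and>
       (\<forall>x\<in>W. \<forall>y\<in>W. norm (snd c' (F y) - snd c' (F x) - ?D (snd c y - snd c x)) \<le> e * norm (snd c y - snd c x))"
    by (intro exI[of _ W'] conjI)
qed (use p in auto)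

lemma chart_deriv_lipschitz:
  assumes "chart_deriv c c' F p D"
  obtains W K where "open W" "p \<in> W" "W \<subseteq> fst c" "F ` W \<subseteq> fst c'" "0 < K"
    "\<And>x y. x \<in> W \<Longrightarrow> y \<in> W \<Longrightarrow> norm (snd c' (F y) - snd c' (F x)) \<le> K * norm (snd c y - snd c x)"
proof -
  obtain W where W: "open W" "p \<in> W" "W \<subseteq> fst c" "F ` W \<subseteq> fst c'"
    "\<And>x y. x \<in> W \<Longrightarrow> y \<in> W \<Longrightarrow> norm (snd c' (F y) - snd c' (F x) - D (snd c y - snd c x))
          \<le> 1 * norm (snd c y - snd c x)"
    using chart_derivE[OF assms zero_less_one] by metis
  have "bounded_linear D" using assms by (simp add: chart_deriv_def)
  then obtain K where K: "0 < K" "\<And>v. norm (D v) \<le> norm v * K"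
    using bounded_linear.pos_bounded by blast
  have "norm (snd c' (F y) - snd c' (F x)) \<le> (K + 1) * norm (snd c y - snd c x)" if "x \<in> W" "y \<in> W" for x y
  proof -
    have "norm (snd c' (F y) - snd c' (F x)) \<le> norm (D (snd c y - snd c x)) +
        norm (snd c' (F y) - snd c' (F x) - D (snd c y - snd c x))"
      by (metis norm_triangle_sub)
    then show ?thesis using W(5)[OF that] K(2)[of "snd c y - snd c x"] by (simp add: algebra_simps)
  qed
  then show ?thesis using that[of W "K + 1"] W K by auto
qed

text \<open>The regularity of \<open>f\<close> is given for one step only, while repellers and
  exponents involve the differentials of the iterates; this chain rule, with any chart in the
  middle, leads from one to the other.\<close>

lemma chart_deriv_compose:
  assumes 1: "chart_deriv c c' F p D" and 2: "chart_deriv c' c'' G (F p) E" and F: "continuous_on UNIV F"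
  shows "chart_deriv c c'' (G \<circ> F) p (E \<circ> D)"
  unfolding chart_deriv_def
proof (intro conjI allI impI)
  have DE: "bounded_linear D" "bounded_linear E" using 1 2 by (simp_all add: chart_deriv_def)
  then show "bounded_linear (E \<circ> D)" unfolding comp_def by (rule bounded_linear_compose[rotated])
  obtain K where K: "0 < K" "\<And>v. norm (E v) \<le> norm v * K"
    using bounded_linear.pos_bounded[OF DE(2)] by blast
  obtain W1 L where W1: "open W1" "p \<in> W1" "W1 \<subseteq> fst c" "F ` W1 \<subseteq> fst c'" "0 < L"
    "\<And>x y. x \<in> W1 \<Longrightarrow> y \<in> W1 \<Longrightarrow> norm (snd c' (F y) - snd c' (F x)) \<le> L * norm (snd c y - snd c x)"
    using chart_deriv_lipschitz[OF 1] by metis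
  fix e :: real assume e: "0 < e"
  have pos: "0 < e / (2 * K)" "0 < e / (2 * L)" using e K W1 by auto
  obtain W2 where W2: "open W2" "p \<in> W2" "W2 \<subseteq> fst c" "F ` W2 \<subseteq> fst c'"
    "\<And>x y. x \<in> W2 \<Longrightarrow> y \<in> W2 \<Longrightarrow> norm (snd c' (F y) - snd c' (F x) - D (snd c y - snd c x))
          \<le> e / (2 * K) * norm (snd c y - snd c x)"
    using chart_derivE[OF 1 pos(1)] by metis
  obtain V where V: "open V" "F p \<in> V" "V \<subseteq> fst c'" "G ` V \<subseteq> fst c''"
    "\<And>x y. x \<in> V \<Longrightarrow> y \<in> V \<Longrightarrow> norm (snd c'' (G y) - snd c'' (G x) - E (snd c' y - snd c' x))
          \<le> e / (2 * L) * norm (snd c' y - snd c' x)"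
    using chart_derivE[OF 2 pos(2)] by metis
  define W where "W = W1 \<inter> W2 \<inter> F -` V"
  have "open W" unfolding W_def using W1 W2 open_vimage[OF V(1) F] by (intro open_Int)
  moreover have "p \<in> W" "W \<subseteq> fst c" "(G \<circ> F) ` W \<subseteq> fst c''" using W1 W2 V by (auto simp: W_def)
  moreover have "\<forall>x\<in>W. \<forall>y\<in>W. norm (snd c'' ((G \<circ> F) y) - snd c'' ((G \<circ> F) x) - (E \<circ> D) (snd c y - snd c x))
      \<le> e * norm (snd c y - snd c x)"
  proof (intro ballI)
    fix x y assume xy: "x \<in> W" "y \<in> W"
    define u where "u = snd c' (F y) - snd c' (F x)"
    define v where "v = snd c y - snd c x"
    have "norm (snd c'' (G (F y)) - snd c'' (G (F x)) - E u) \<le> e / (2 * L) * norm u"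
      unfolding u_def by (rule V(5)) (use xy in \<open>auto simp: W_def\<close>)
    also have "\<dots> \<le> e / (2 * L) * (L * norm v)"
      unfolding u_def v_def using xy pos by (intro mult_left_mono W1(6)) (auto simp: W_def)
    finally have a: "norm (snd c'' (G (F y)) - snd c'' (G (F x)) - E u) \<le> e / 2 * norm v"
      using W1(5) by simp
    have "norm (E (u - D v)) \<le> norm (u - D v) * K" by (rule K(2))
    also have "\<dots> \<le> (e / (2 * K) * norm v) * K"
      unfolding u_def v_def using xy K by (intro mult_right_mono W2(5)) (auto simp: W_def)
    finally have b: "norm (E u - E (D v)) \<le> e / 2 * norm v"
      using K(1) by (simp add: linear_diff[OF bounded_linear.linear[OF DE(2)]])
    have "norm (snd c'' (G (F y)) - snd c'' (G (F x)) - E (D v)) \<le>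
        norm (snd c'' (G (F y)) - snd c'' (G (F x)) - E u) + norm (E u - E (D v))"
      using dist_triangle[of "snd c'' (G (F y)) - snd c'' (G (F x))" "E (D v)" "E u"]
      unfolding dist_norm .
    with a b show "norm (snd c'' ((G \<circ> F) y) - snd c'' ((G \<circ> F) x) - (E \<circ> D) (snd c y - snd c x))
      \<le> e * norm (snd c y - snd c x)" unfolding v_def[symmetric] by simp
  qed
  ultimately show "\<exists>W. open W \<and> p \<in> W \<and> W \<subseteq> fst c \<and> (G \<circ> F) ` W \<subseteq> fst c'' \<and>
     (\<forall>x\<in>W. \<forall>y\<in>W. norm (snd c'' ((G \<circ> F) y) - snd c'' ((G \<circ> F) x) - (E \<circ> D) (snd c y - snd c x))
      \<le> e * norm (snd c y - snd c x))" by (intro exI[of _ W] conjI)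
qed (use 1 2 in \<open>simp_all add: chart_deriv_def\<close>)

lemma chart_deriv_imp_derivative:
  assumes c: "is_chart c" and F: "chart_deriv c c' F p D"
  shows "(local_rep c c' F has_derivative D) (at (snd c p))"
  unfolding has_derivative_at_alt
proof (intro conjI allI impI)
  show "bounded_linear D" using F by (simp add: chart_deriv_def)
  fix e :: real assume e: "0 < e"
  obtain W where W: "open W" "p \<in> W" "W \<subseteq> fst c" "F ` W \<subseteq> fst c'"
    "\<And>x y. x \<in> W \<Longrightarrow> y \<in> W \<Longrightarrow> norm (snd c' (F y) - snd c' (F x) - D (snd c y - snd c x))
          \<le> e * norm (snd c y - snd c x)"
    using chart_derivE[OF F e] by metis
  have "open (snd c ` W)" by (rule chart_open_image[OF c W(1,3)])
  then obtain \<delta> where \<delta>: "0 < \<delta>" "ball (snd c p) \<delta> \<subseteq> snd c ` W"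
    using W(2) by (meson imageI open_contains_ball)
  have rep: "local_rep c c' F (snd c x) = snd c' (F x)" if "x \<in> W" for x
    using chart_inv[OF c, of x] that W(3) by (auto simp: local_rep_def)
  have "norm (local_rep c c' F y - local_rep c c' F (snd c p) - D (y - snd c p)) \<le> e * norm (y - snd c p)"
    if "norm (y - snd c p) < \<delta>" for y
  proof -
    have "y \<in> ball (snd c p) \<delta>" using that by (simp add: dist_norm norm_minus_commute)
    then obtain z where z: "z \<in> W" "y = snd c z" using \<delta>(2) by auto
    show ?thesis using W(5)[OF W(2) z(1)] by (simp add: z rep W(2))
  qed
  then show "\<exists>\<delta>>0. \<forall>y. norm (y - snd c p) < \<delta> \<longrightarrow>
     norm (local_rep c c' F y - local_rep c c' F (snd c p) - D (y - snd c p)) \<le> e * norm (y - snd c p)"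
    using \<delta>(1) by (intro exI[of _ \<delta>]) simp
qed

text \<open>Derivatives are unique, so the choice in \<open>frechet_derivative\<close> agrees with a
  derivative obtained from the chain rule.\<close>

lemma chart_deriv_unique:
  assumes "is_chart c" "chart_deriv c c' F p D"
  shows "frechet_derivative (local_rep c c' F) (at (snd c p)) = D"
  using frechet_derivative_at[OF chart_deriv_imp_derivative[OF assms]] by simp

section \<open>A metric adapted to the charts\<close>

text \<open>A Lipschitz map that crushes the complement of the open unit ball to 0 and is injective
  on that ball: the second component is the distance to the unit sphere, nonzero exactly inside, and
  undoes the scaling of the first.\<close>

definition collapse :: "'b::euclidean_space \<Rightarrow> 'b \<times> real" where
  "collapse y = (max 0 (1 - norm y) *\<^sub>R y, max 0 (1 - norm y))"

lemma collapse_eq_0: "1 \<le> norm y \<Longrightarrow> collapse y = 0"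
  by (simp add: collapse_def zero_prod_def)

lemma collapse_lipschitz:
  fixes x y :: "'b::euclidean_space"
  shows "norm (collapse x - collapse y) \<le> 3 * norm (x - y)"
proof -
  have *: "norm (collapse x - collapse y) \<le> 3 * norm (x - y)" if y: "norm y \<le> 1" for x y :: 'b
  proof -
    define s where "s = max 0 (1 - norm x)"
    define s' where "s' = max 0 (1 - norm y)"
    have s: "0 \<le> s" "s \<le> 1" by (auto simp: s_def)
    have ss: "\<bar>s - s'\<bar> \<le> norm (x - y)"
      using norm_triangle_ineq3[of x y] unfolding s_def s'_def by linarith
    have "s *\<^sub>R x - s' *\<^sub>R y = s *\<^sub>R (x - y) + (s - s') *\<^sub>R y" by (simp add: algebra_simps)
    then have "norm (s *\<^sub>R x - s' *\<^sub>R y) \<le> norm (s *\<^sub>R (x - y)) + norm ((s - s') *\<^sub>R y)"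
      by (simp only: norm_triangle_ineq)
    also have "\<dots> \<le> 1 * norm (x - y) + norm (x - y) * 1"
      unfolding norm_scaleR by (intro add_mono mult_mono) (use s ss y in auto)
    finally have "norm (s *\<^sub>R x - s' *\<^sub>R y) \<le> 2 * norm (x - y)" by simp
    moreover have "norm (collapse x - collapse y) \<le> norm (s *\<^sub>R x - s' *\<^sub>R y) + norm (s - s')"
      unfolding collapse_def s_def s'_def diff_Pair by (rule norm_Pair_le)
    ultimately show ?thesis using ss by simp
  qed
  consider "norm y \<le> 1" | "norm x \<le> 1" | "1 \<le> norm x" "1 \<le> norm y" by linarith
  then show ?thesis
  proof cases
    case 2
    then show ?thesis using *[of x y] by (simp add: norm_minus_commute)
  qed (use * in \<open>auto simp: collapse_eq_0\<close>)
qed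

text \<open>On the half ball the scaling factor is at least 1/2, and undoing it costs a factor 2;
  the two components of \<open>collapse\<close> contribute the other factor 2.\<close>

lemma collapse_lower:
  assumes "norm x \<le> 1 / 2" "norm y \<le> 1 / 2"
  shows "norm (x - y) \<le> 4 * norm (collapse x - collapse y)"
proof -
  define s where "s = 1 - norm x"
  define s' where "s' = 1 - norm y"
  have s: "1 / 2 \<le> s" "1 / 2 \<le> s'" using assms by (auto simp: s_def s'_def)
  have collapse: "collapse x - collapse y = (s *\<^sub>R x - s' *\<^sub>R y, s - s')"
    using assms by (simp add: collapse_def s_def s'_def)
  have 1: "norm (s *\<^sub>R x - s' *\<^sub>R y) \<le> norm (collapse x - collapse y)" "norm (s - s') \<le> norm (collapse x - collapse y)"
    unfolding collapse using norm_fst_le norm_snd_le by (metis fst_conv, metis snd_conv)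
  have "s *\<^sub>R (x - y) = (s *\<^sub>R x - s' *\<^sub>R y) - (s - s') *\<^sub>R y" by (simp add: algebra_simps)
  then have "norm (s *\<^sub>R (x - y)) \<le> norm (s *\<^sub>R x - s' *\<^sub>R y) + norm ((s - s') *\<^sub>R y)"
    by (simp only: norm_triangle_ineq4)
  also have "norm ((s - s') *\<^sub>R y) \<le> norm (s - s') * 1"
    unfolding norm_scaleR using assms by (intro mult_mono) auto
  finally have "s * norm (x - y) \<le> 2 * norm (collapse x - collapse y)" using 1 s by simp
  moreover have "1 / 2 * norm (x - y) \<le> s * norm (x - y)" using s by (intro mult_right_mono) auto
  ultimately show ?thesis by simp
qed

lemma collapse_inj: "collapse x = collapse y \<Longrightarrow> norm x < 1 \<Longrightarrow> x = y"
  by (auto simp: collapse_def max_def split: if_splits)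

locale riemannian_manifold =
  fixes A :: "('a::t2_space, 'b::euclidean_space) chart set" and g :: "'a \<Rightarrow> 'b \<Rightarrow> 'b \<Rightarrow> real"
  assumes atlas: "smooth_atlas A" and metric: "riemannian_metric A g"
begin

lemma chart: "c \<in> A \<Longrightarrow> is_chart c"
  using atlas by (simp add: smooth_atlas_def)

lemma chart_at: "chart_at A x \<in> A" "x \<in> fst (chart_at A x)"
proof -
  have "x \<in> (\<Union>c\<in>A. fst c)" using atlas by (simp add: smooth_atlas_def)
  then have "\<exists>c. c \<in> A \<and> x \<in> fst c" by blast
  from someI_ex[OF this] show "chart_at A x \<in> A" "x \<in> fst (chart_at A x)"
    by (simp_all add: chart_at_def)
qed

lemma transition_deriv:
  assumes "c \<in> A" "c' \<in> A" "p \<in> fst c" "p \<in> fst c'"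
  shows "chart_deriv c c' id p (frechet_derivative (local_rep c c' id) (at (snd c p)))"
proof (rule chart_deriv_of_C1[OF chart[OF assms(1)] chart[OF assms(2)]])
  have "smooth_on (snd c ` (fst c \<inter> fst c')) (local_rep c c' id)"
    using atlas assms by (simp add: smooth_atlas_def)
  then show "Ck_on 1 (snd c ` (fst c \<inter> id -` fst c')) (local_rep c c' id)"
    unfolding smooth_on_def by simp
qed (use assms in auto)

lemma transition_lipschitz:
  assumes "c \<in> A" "c' \<in> A" "p \<in> fst c" "p \<in> fst c'"
  obtains W K where "open W" "p \<in> W" "W \<subseteq> fst c" "W \<subseteq> fst c'" "0 < K"
    "\<And>x y. x \<in> W \<Longrightarrow> y \<in> W \<Longrightarrow> norm (snd c' y - snd c' x) \<le> K * norm (snd c y - snd c x)"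
  using chart_deriv_lipschitz[OF transition_deriv[OF assms]] by (metis id_apply image_id)

lemma norm_divideR: "0 < R \<Longrightarrow> norm (v /\<^sub>R R) = norm v / R"
  by (simp add: divide_inverse mult.commute)

section \<open>Chart maps extended to the whole manifold by bumps\<close>

definition bump :: "('a, 'b) chart \<Rightarrow> 'a \<Rightarrow> real \<Rightarrow> 'a \<Rightarrow> 'b \<times> real" where
  "bump c q R x = (if x \<in> fst c then collapse ((snd c x - snd c q) /\<^sub>R R) else 0)"

definition good_radius :: "('a, 'b) chart \<Rightarrow> 'a \<Rightarrow> real \<Rightarrow> bool" where
  "good_radius c q R \<longleftrightarrow> c \<in> A \<and> q \<in> fst c \<and> 0 < R \<and> cball (snd c q) R \<subseteq> snd c ` fst c"

lemma good_radius_exists: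
  assumes "c \<in> A" "q \<in> fst c" obtains R where "good_radius c q R"
proof -
  have "open (snd c ` fst c)" "snd c q \<in> snd c ` fst c"
    using chart_open(2)[OF chart[OF assms(1)]] assms by auto
  then obtain R where "0 < R" "cball (snd c q) R \<subseteq> snd c ` fst c"
    using open_contains_cball by blast
  then show ?thesis using assms by (intro that[of R]) (simp add: good_radius_def)
qed

text \<open>The set is the image of a compact ball under the inverse chart, hence compact, hence
  closed in a Hausdorff space. This is what makes extension by 0 beyond the chart
  continuous.\<close>

lemma closed_chart_ball:
  assumes "good_radius c q R" "R' \<le> R"
  shows "closed {x \<in> fst c. norm (snd c x - snd c q) \<le> R'}"
proof -
  have c: "is_chart c" using assms chart by (simp add: good_radius_def)
  have sub: "cball (snd c q) R' \<subseteq> snd c ` fst c"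
    using assms by (auto simp: good_radius_def subset_eq)
  have "{x \<in> fst c. norm (snd c x - snd c q) \<le> R'} = inv_into (fst c) (snd c) ` cball (snd c q) R'"
  proof (intro set_eqI iffI)
    fix x assume "x \<in> {x \<in> fst c. norm (snd c x - snd c q) \<le> R'}"
    then show "x \<in> inv_into (fst c) (snd c) ` cball (snd c q) R'"
      using chart_inv[OF c, of x] by (intro image_eqI[of _ _ "snd c x"]) (auto simp: dist_norm norm_minus_commute)
  next
    fix x assume "x \<in> inv_into (fst c) (snd c) ` cball (snd c q) R'"
    then obtain v where v: "v \<in> cball (snd c q) R'" "x = inv_into (fst c) (snd c) v" by blast
    then obtain y where "y \<in> fst c" "v = snd c y" using sub by blast
    then show "x \<in> {x \<in> fst c. norm (snd c x - snd c q) \<le> R'}"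
      using v chart_inv[OF c, of y] by (auto simp: dist_norm norm_minus_commute)
  qed
  moreover have "compact (inv_into (fst c) (snd c) ` cball (snd c q) R')"
    by (intro compact_continuous_image continuous_on_subset[OF chart_inv_cont[OF c] sub] compact_cball)
  ultimately show ?thesis by (simp add: compact_imp_closed)
qed

text \<open>Inside the domain of \<open>c\<close> the transition map is locally Lipschitz. A point
  outside the domain has a neighbourhood disjoint from the closed ball that carries the bump, and
  there the bump vanishes.\<close>

lemma bump_lipschitz:
  assumes R: "good_radius c q R" and p: "c' \<in> A" "p \<in> fst c'"
  shows "\<exists>W K. open W \<and> p \<in> W \<and> W \<subseteq> fst c' \<and> 0 < K \<and>
    (\<forall>x\<in>W. \<forall>y\<in>W. norm (bump c q R x - bump c q R y) \<le> K * norm (snd c' x - snd c' y))"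
proof (cases "p \<in> fst c")
  case True
  have cA: "c \<in> A" and R0: "0 < R" using R by (simp_all add: good_radius_def)
  obtain W K where W: "open W" "p \<in> W" "W \<subseteq> fst c'" "W \<subseteq> fst c" "0 < K"
    "\<And>x y. x \<in> W \<Longrightarrow> y \<in> W \<Longrightarrow> norm (snd c y - snd c x) \<le> K * norm (snd c' y - snd c' x)"
    using transition_lipschitz[OF p(1) cA p(2) True] by metis
  have "norm (bump c q R x - bump c q R y) \<le> (3 / R * K) * norm (snd c' x - snd c' y)"
    if "x \<in> W" "y \<in> W" for x y
  proof -
    have "norm (bump c q R x - bump c q R y) \<le>
        3 * norm ((snd c x - snd c q) /\<^sub>R R - (snd c y - snd c q) /\<^sub>R R)"
      using that W(4) collapse_lipschitz by (auto simp: bump_def subset_eq)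
    also have "(snd c x - snd c q) /\<^sub>R R - (snd c y - snd c q) /\<^sub>R R = (snd c x - snd c y) /\<^sub>R R"
      by (simp add: scaleR_diff_right[symmetric])
    also have "3 * norm ((snd c x - snd c y) /\<^sub>R R) = 3 / R * norm (snd c x - snd c y)"
      using R0 by (simp add: divide_inverse)
    also have "\<dots> \<le> 3 / R * (K * norm (snd c' x - snd c' y))"
      using R0 by (intro mult_left_mono W(6)[OF that(2,1)]) auto
    finally show ?thesis by (simp add: mult.assoc)
  qed
  moreover have "0 < 3 / R * K" using R0 W by simp
  ultimately show ?thesis using W(1-3) by (intro exI[of _ W] exI[of _ "3 / R * K"] conjI ballI)
next
  case False
  define W where "W = fst c' - {x \<in> fst c. norm (snd c x - snd c q) \<le> R}"
  have "open W" unfolding W_def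
    by (intro open_Diff chart_open(1)[OF chart[OF p(1)]] closed_chart_ball[OF R order_refl])
  moreover have "bump c q R x = 0" if "x \<in> W" for x
  proof -
    have "1 \<le> norm ((snd c x - snd c q) /\<^sub>R R)" if "x \<in> fst c"
      using that \<open>x \<in> W\<close> R norm_divideR[of R "snd c x - snd c q"]
      by (simp add: W_def good_radius_def pos_le_divide_eq)
    then show ?thesis by (simp add: bump_def collapse_eq_0)
  qed
  ultimately show ?thesis using False p
    by (intro exI[of _ W] exI[of _ "1::real"] conjI ballI) (auto simp: W_def)
qed

lemma bump_lower:
  assumes R: "good_radius c q R" and x: "x \<in> fst c" "norm (snd c x - snd c q) \<le> R / 2"
    and y: "y \<in> fst c" "norm (snd c y - snd c q) \<le> R / 2"
  shows "norm (snd c x - snd c y) \<le> 4 * R * norm (bump c q R x - bump c q R y)"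
proof -
  have R0: "0 < R" using R by (simp add: good_radius_def)
  define u v where "u = (snd c x - snd c q) /\<^sub>R R" and "v = (snd c y - snd c q) /\<^sub>R R"
  have "norm u \<le> 1 / 2" "norm v \<le> 1 / 2"
    unfolding u_def v_def norm_divideR[OF R0] using x y R0 by (simp_all add: pos_divide_le_eq)
  then have "norm (u - v) \<le> 4 * norm (bump c q R x - bump c q R y)"
    using collapse_lower[of u v] x y by (simp add: bump_def u_def v_def)
  moreover have "u - v = (snd c x - snd c y) /\<^sub>R R"
    by (simp add: u_def v_def scaleR_diff_right[symmetric])
  then have "norm (snd c x - snd c y) = R * norm (u - v)" using R0 by simp
  ultimately show ?thesis using R0 by simp
qed

text \<open>The second component is nonzero at \<open>x\<close>, hence at \<open>y\<close>, which
  forces \<open>y\<close> into the domain of the chart; there \<open>collapse\<close> and the chart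
  are injective in turn.\<close>

lemma bump_inj:
  assumes R: "good_radius c q R" and x: "x \<in> fst c" "norm (snd c x - snd c q) \<le> R / 2"
    and eq: "bump c q R x = bump c q R y"
  shows "x = y"
proof -
  have R0: "0 < R" using R by (simp add: good_radius_def)
  define u where "u = (snd c x - snd c q) /\<^sub>R R"
  have u: "norm u < 1" unfolding u_def norm_divideR[OF R0] using x R0 by (simp add: pos_divide_less_eq)
  have "snd (collapse u) \<noteq> 0" using u by (simp add: collapse_def)
  moreover have bx: "bump c q R x = collapse u" using x by (simp add: bump_def u_def)
  ultimately have y: "y \<in> fst c" using eq by (cases "y \<in> fst c") (simp_all add: bump_def)
  then have "collapse u = collapse ((snd c y - snd c q) /\<^sub>R R)" using eq bx by (simp add: bump_def)
  then have "(snd c x - snd c q) /\<^sub>R R = (snd c y - snd c q) /\<^sub>R R"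
    using collapse_inj[OF _ u] unfolding u_def by blast
  then have "snd c x = snd c y" using R0 by simp
  then show ?thesis using inj_onD[OF chart_inj[OF chart] _ x(1) y] R by (simp add: good_radius_def)
qed

end

section \<open>Tangent norms\<close>

context riemannian_manifold begin

lemma
  shows g_bilinear: "bilinear (g x)" and g_sym: "g x v w = g x w v"
    and g_pos: "v \<noteq> 0 \<Longrightarrow> 0 < g x v v"
  using metric by (simp_all add: riemannian_metric_def)

lemma g_nonneg: "0 \<le> g x v v"
  using g_pos[of v x] bilinear_lzero[OF g_bilinear, of x 0] by (cases "v = 0") auto

abbreviation "tn \<equiv> tangent_norm g"

lemma tn_nonneg [simp]: "0 \<le> tn x v"
  by (simp add: tangent_norm_def g_nonneg)

lemma tn_0 [simp]: "tn x 0 = 0"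
  by (simp add: tangent_norm_def bilinear_lzero[OF g_bilinear])

lemma tn_pos: "v \<noteq> 0 \<Longrightarrow> 0 < tn x v"
  by (simp add: tangent_norm_def g_pos)

lemma tn_square: "(tn x v)\<^sup>2 = g x v v"
  by (simp add: tangent_norm_def g_nonneg)

lemma tn_scale: "tn x (r *\<^sub>R v) = \<bar>r\<bar> * tn x v"
  by (simp add: tangent_norm_def bilinear_lmul[OF g_bilinear] bilinear_rmul[OF g_bilinear]
      real_sqrt_mult mult.assoc[symmetric])

lemma tn_uminus: "tn x (- v) = tn x v"
  using tn_scale[of x "-1" v] by simp

lemma cauchy_schwarz: "g x v w \<le> tn x v * tn x w"
proof (cases "w = 0")
  case True
  then show ?thesis by (simp add: bilinear_rzero[OF g_bilinear])
next
  case False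
  define a where "a = g x w w"
  define b where "b = g x v w"
  have a: "0 < a" using g_pos[OF False] by (simp add: a_def)
  define t where "t = b / a"
  have ta: "t * a = b" using a by (simp add: t_def)
  have "0 \<le> g x (v - t *\<^sub>R w) (v - t *\<^sub>R w)" by (rule g_nonneg)
  also have "\<dots> = g x v v - t * b - t * b + t * t * a"
    using g_sym[of x w v]
    by (simp add: bilinear_lsub[OF g_bilinear] bilinear_rsub[OF g_bilinear] a_def b_def
        bilinear_lmul[OF g_bilinear] bilinear_rmul[OF g_bilinear] algebra_simps)
  also have "t * t * a = t * b" by (simp add: ta mult.assoc)
  finally have "t * b \<le> g x v v" by (simp add: mult.commute)
  then have "t * b * a \<le> g x v v * a" using a by (intro mult_right_mono) auto
  then have "b\<^sup>2 \<le> (tn x v * tn x w)\<^sup>2"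
  proof -
    have "b\<^sup>2 = t * a * b" by (simp add: ta power2_eq_square)
    also have "\<dots> = t * b * a" by simp
    finally have "b\<^sup>2 = t * b * a" .
    moreover have "(tn x v * tn x w)\<^sup>2 = g x v v * a" by (simp add: power_mult_distrib tn_square a_def)
    ultimately show ?thesis using \<open>t * b * a \<le> g x v v * a\<close> by simp
  qed
  then have "b \<le> tn x v * tn x w" by (rule power2_le_imp_le) simp
  then show ?thesis unfolding b_def .
qed

lemma tn_triangle: "tn x (v + w) \<le> tn x v + tn x w"
proof (rule power2_le_imp_le)
  have "(tn x (v + w))\<^sup>2 = (tn x v)\<^sup>2 + 2 * g x v w + (tn x w)\<^sup>2"
    using g_sym[of x w v]
    by (simp add: tn_square bilinear_ladd[OF g_bilinear] bilinear_radd[OF g_bilinear])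
  also have "\<dots> \<le> (tn x v)\<^sup>2 + 2 * (tn x v * tn x w) + (tn x w)\<^sup>2"
    using cauchy_schwarz by simp
  finally show "(tn x (v + w))\<^sup>2 \<le> (tn x v + tn x w)\<^sup>2" by (simp add: power2_sum)
qed simp

lemma tn_diff: "tn x v \<le> tn x w + tn x (v - w)"
  using tn_triangle[of x w "v - w"] by simp

lemma tn_sum: "finite I \<Longrightarrow> tn x (\<Sum>i\<in>I. h i) \<le> (\<Sum>i\<in>I. tn x (h i))"
proof (induction I rule: finite_induct)
  case (insert i I)
  then show ?case using tn_triangle[of x "h i" "\<Sum>i\<in>I. h i"] by simp
qed simp

lemma tn_upper: "\<exists>B>0. \<forall>v. tn x v \<le> B * norm v"
proof -
  define B where "B = (\<Sum>i\<in>Basis. tn x i) + 1"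
  have B: "0 < B" unfolding B_def by (intro add_nonneg_pos sum_nonneg) auto
  have "tn x v \<le> B * norm v" for v
  proof -
    have "tn x v = tn x (\<Sum>i\<in>Basis. (v \<bullet> i) *\<^sub>R i)" by (simp add: euclidean_representation)
    also have "\<dots> \<le> (\<Sum>i\<in>Basis. tn x ((v \<bullet> i) *\<^sub>R i))" by (rule tn_sum) simp
    also have "\<dots> \<le> (\<Sum>i\<in>Basis. norm v * tn x i)"
      by (intro sum_mono) (auto simp: tn_scale intro!: mult_right_mono Basis_le_norm)
    also have "\<dots> \<le> B * norm v" by (simp add: B_def sum_distrib_left[symmetric] algebra_simps)
    finally show ?thesis .
  qed
  with B show ?thesis by blast
qed

lemma tn_cont: "continuous_on S (tn x)"
proof -
  obtain B where B: "0 < B" "\<And>v. tn x v \<le> B * norm v" using tn_upper by blast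
  have "\<bar>tn x v - tn x w\<bar> \<le> B * norm (v - w)" for v w
    using tn_diff[of x v w] tn_diff[of x w v] B(2)[of "v - w"] tn_uminus[of x "v - w"] by simp
  then have "B-lipschitz_on UNIV (tn x)"
    using B(1) by (intro lipschitz_onI) (auto simp: dist_norm)
  then show ?thesis using lipschitz_on_continuous_on continuous_on_subset by blast
qed

lemma tn_lower: "\<exists>B>0. \<forall>v. norm v \<le> B * tn x v"
proof -
  have "\<exists>u\<in>sphere 0 1. \<forall>v\<in>sphere (0::'b) 1. tn x u \<le> tn x v"
    by (intro continuous_attains_inf tn_cont) (auto intro: vector_choose_size[of 1])
  then obtain u where u: "norm u = 1" "\<And>v. norm v = 1 \<Longrightarrow> tn x u \<le> tn x v" by auto
  have pos: "0 < tn x u" using u(1) by (intro tn_pos) auto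
  have "norm v \<le> (1 / tn x u) * tn x v" for v
  proof (cases "v = 0")
    case False
    then have "tn x u \<le> tn x (v /\<^sub>R norm v)" by (intro u(2)) simp
    then have "tn x u * norm v \<le> tn x v" using False by (simp add: tn_scale field_simps)
    then show ?thesis using pos by (simp add: field_simps)
  qed simp
  then show ?thesis using pos by (intro exI[of _ "1 / tn x u"]) simp
qed

section \<open>Comparison of the preferred charts with a fixed chart\<close>

lemma from_chart_deriv:
  assumes "c \<in> A" "p \<in> fst c" shows "chart_deriv c (chart_at A p) id p (from_chart A c p)"
  unfolding from_chart_def by (rule transition_deriv[OF assms(1) chart_at(1) assms(2) chart_at(2)])

lemma from_chart_linear:
  assumes "c \<in> A" "p \<in> fst c" shows "linear (from_chart A c p)"
  using from_chart_deriv[OF assms] bounded_linear.linear by (auto simp: chart_deriv_def)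

lemma chart_deriv_id:
  assumes "c \<in> A" "p \<in> fst c" shows "chart_deriv c c id p id"
  unfolding chart_deriv_def
  using assms chart_open(1)[OF chart[OF assms(1)]] by (auto simp: bounded_linear_ident id_def)

text \<open>By the chain rule the derivative of the reverse transition map is a left
  inverse.\<close>

lemma from_chart_nonzero:
  assumes "c \<in> A" "p \<in> fst c" "v \<noteq> 0" shows "from_chart A c p v \<noteq> 0"
proof
  assume 0: "from_chart A c p v = 0"
  define E where "E = frechet_derivative (local_rep (chart_at A p) c id) (at (snd (chart_at A p) p))"
  have E: "chart_deriv (chart_at A p) c id (id p) E"
    using transition_deriv[OF chart_at(1) assms(1) chart_at(2) assms(2)] by (simp add: E_def)
  have "continuous_on UNIV (id :: 'a \<Rightarrow> 'a)" by (simp add: id_def)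
  from chart_deriv_compose[OF from_chart_deriv[OF assms(1,2)] E this]
  have "chart_deriv c c id p (E \<circ> from_chart A c p)" by simp
  then have "E \<circ> from_chart A c p = id"
    using chart_deriv_unique[OF chart[OF assms(1)]] chart_deriv_id[OF assms(1,2)] by metis
  then have "E (from_chart A c p v) = v" by (metis comp_apply id_apply)
  moreover have "E 0 = 0"
    using E by (simp add: chart_deriv_def linear_0 bounded_linear.linear)
  ultimately show False using 0 assms(3) by simp
qed

text \<open>The preferred chart jumps with the point, so neither \<open>tn\<close> nor
  \<open>from_chart\<close> need be continuous in it. Their combination is: its square is a
  quadratic form \<open>Q\<close> whose coefficients in the chart \<open>c\<close> are smooth by the
  definition of a metric. \<open>Q\<close> is positive on the compact product of a ball and the unit
  sphere, and homogeneity does the rest.\<close>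

lemma metric_bound:
  assumes c: "c \<in> A" and p: "p \<in> fst c"
  shows "\<exists>W K. open W \<and> p \<in> W \<and> W \<subseteq> fst c \<and> 1 \<le> K \<and>
    (\<forall>x\<in>W. \<forall>v. norm v \<le> K * tn x (from_chart A c x v) \<and> tn x (from_chart A c x v) \<le> K * norm v)"
proof -
  have ch: "is_chart c" by (rule chart[OF c])
  let ?S = "snd c ` fst c"
  let ?inv = "inv_into (fst c) (snd c)"
  define G where "G i j y = (let p = ?inv y in g p (from_chart A c p i) (from_chart A c p j))" for i j y
  have G_cont: "continuous_on ?S (G i j)" if "i \<in> Basis" "j \<in> Basis" for i j
  proof -
    have "smooth_on ?S (G i j)"
      using metric c that by (simp add: riemannian_metric_def G_def[abs_def])
    then have "Ck_on 0 ?S (G i j)" unfolding smooth_on_def by (rule spec)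
    then show ?thesis by simp
  qed
  define Q where "Q z = (\<Sum>i\<in>Basis. \<Sum>j\<in>Basis. (snd z \<bullet> i) * (snd z \<bullet> j) * G i j (fst z))" for z :: "'b \<times> 'b"
  have Q_eq: "Q (snd c x, v) = (tn x (from_chart A c x v))\<^sup>2" if x: "x \<in> fst c" for x v
  proof -
    let ?L = "from_chart A c x"
    have lin: "linear ?L" by (rule from_chart_linear[OF c x])
    have "?L v = ?L (\<Sum>i\<in>Basis. (v \<bullet> i) *\<^sub>R i)" by (simp add: euclidean_representation)
    also have "\<dots> = (\<Sum>i\<in>Basis. (v \<bullet> i) *\<^sub>R ?L i)" by (simp add: linear_sum[OF lin] linear_scale[OF lin])
    finally have "g x (?L v) (?L v) =
        g x (\<Sum>i\<in>Basis. (v \<bullet> i) *\<^sub>R ?L i) (\<Sum>j\<in>Basis. (v \<bullet> j) *\<^sub>R ?L j)" by simp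
    also have "\<dots> = (\<Sum>(i, j)\<in>Basis \<times> Basis. g x ((v \<bullet> i) *\<^sub>R ?L i) ((v \<bullet> j) *\<^sub>R ?L j))"
      by (rule bilinear_sum[OF g_bilinear])
    also have "\<dots> = (\<Sum>i\<in>Basis. \<Sum>j\<in>Basis. (v \<bullet> i) * (v \<bullet> j) * g x (?L i) (?L j))"
      unfolding sum.cartesian_product[symmetric]
      by (intro sum.cong refl) (simp add: bilinear_lmul[OF g_bilinear] bilinear_rmul[OF g_bilinear])
    finally show ?thesis
      by (simp add: Q_def G_def Let_def chart_inv[OF ch x] tn_square)
  qed
  have "open ?S" "snd c p \<in> ?S" using chart_open(2)[OF ch] p by auto
  then obtain R where R: "0 < R" "cball (snd c p) R \<subseteq> ?S" using open_contains_cball by blast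
  define T where "T = cball (snd c p) R \<times> sphere (0::'b) 1"
  have T: "compact T" "T \<noteq> {}"
  proof -
    have "(snd c p, SOME i. i \<in> Basis) \<in> T" using R(1) by (simp add: T_def)
    then show "T \<noteq> {}" by blast
    show "compact T" unfolding T_def by (intro compact_Times compact_cball compact_sphere)
  qed
  have Q_cont: "continuous_on T Q"
    unfolding Q_def
  proof (intro continuous_on_sum continuous_on_mult continuous_on_inner continuous_on_snd continuous_on_id continuous_on_const)
    fix i j :: 'b assume "i \<in> Basis" "j \<in> Basis"
    then have "continuous_on (fst ` T) (G i j)"
      using R by (intro continuous_on_subset[OF G_cont]) (auto simp: T_def)
    then show "continuous_on T (\<lambda>z. G i j (fst z))"
      by (rule continuous_on_compose2[OF _ continuous_on_fst[OF continuous_on_id]]) auto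
  qed
  have Q_pos: "0 < Q z" if "z \<in> T" for z
  proof -
    have "fst z \<in> ?S" "norm (snd z) = 1" using that R by (auto simp: T_def)
    then obtain x where x: "x \<in> fst c" "fst z = snd c x" by blast
    have "snd z \<noteq> 0" using \<open>norm (snd z) = 1\<close> by auto
    then have "0 < tn x (from_chart A c x (snd z))" by (intro tn_pos from_chart_nonzero[OF c x(1)])
    then have "0 < Q (snd c x, snd z)" unfolding Q_eq[OF x(1)] by simp
    then show ?thesis unfolding x(2)[symmetric] by simp
  qed
  obtain a where a: "a \<in> T" "\<And>z. z \<in> T \<Longrightarrow> Q a \<le> Q z"
    using continuous_attains_inf[OF T Q_cont] by blast
  obtain b where b: "b \<in> T" "\<And>z. z \<in> T \<Longrightarrow> Q z \<le> Q b"
    using continuous_attains_sup[OF T Q_cont] by blast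
  define m M where "m = sqrt (Q a)" and "M = sqrt (Q b)"
  have m: "0 < m" using Q_pos[OF a(1)] by (simp add: m_def)
  define K where "K = max 1 (max (1 / m) M)"
  define W where "W = fst c \<inter> snd c -` ball (snd c p) R"
  have bounds: "m * norm v \<le> tn x (from_chart A c x v) \<and> tn x (from_chart A c x v) \<le> M * norm v"
    if "x \<in> W" for x v
  proof (cases "v = 0")
    case True
    have "x \<in> fst c" using that by (simp add: W_def)
    then show ?thesis using True linear_0[OF from_chart_linear[OF c]] by simp
  next
    case False
    have x: "x \<in> fst c" "snd c x \<in> cball (snd c p) R" using that by (auto simp: W_def)
    define u where "u = v /\<^sub>R norm v"
    have uT: "(snd c x, u) \<in> T" using False x by (simp add: T_def u_def)
    have "m \<le> tn x (from_chart A c x u)" "tn x (from_chart A c x u) \<le> M"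
      using a(2)[OF uT] b(2)[OF uT] unfolding Q_eq[OF x(1)] m_def M_def
      by (simp_all add: real_le_lsqrt real_le_rsqrt)
    moreover have "v = norm v *\<^sub>R u" using False by (simp add: u_def)
    then have "tn x (from_chart A c x v) = norm v * tn x (from_chart A c x u)"
      using linear_scale[OF from_chart_linear[OF c x(1)], of "norm v" u] tn_scale[of x "norm v"] by simp
    ultimately show ?thesis by (simp add: mult.commute[of _ "norm v"] mult_left_mono)
  qed
  have "norm v \<le> K * tn x (from_chart A c x v) \<and> tn x (from_chart A c x v) \<le> K * norm v"
    if "x \<in> W" for x v
  proof
    have "norm v = 1 / m * (m * norm v)" using m by simp
    also have "\<dots> \<le> 1 / m * tn x (from_chart A c x v)"
      using bounds[OF that, of v] m by (intro mult_left_mono) auto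
    also have "\<dots> \<le> K * tn x (from_chart A c x v)" by (intro mult_right_mono) (auto simp: K_def)
    finally show "norm v \<le> K * tn x (from_chart A c x v)" .
    have "tn x (from_chart A c x v) \<le> M * norm v" using bounds[OF that, of v] by simp
    also have "\<dots> \<le> K * norm v" by (intro mult_right_mono) (auto simp: K_def)
    finally show "tn x (from_chart A c x v) \<le> K * norm v" .
  qed
  moreover have "open W" unfolding W_def by (intro chart_open_vimage[OF ch] open_ball)
  moreover have "p \<in> W" "W \<subseteq> fst c" "1 \<le> K" using p R by (auto simp: W_def K_def)
  ultimately show ?thesis by (intro exI[of _ W] exI[of _ K] conjI ballI allI) auto
qed

text \<open>The properties of the Riemannian distance that the argument uses, for a real-valued
  function on the whole space: balls are open, points of \<open>J\<close> are separated from all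
  others, and near \<open>J\<close> the function is comparable with the Euclidean distance in some
  chart.\<close>

definition adapted_metric :: "'a set \<Rightarrow> ('a \<Rightarrow> 'a \<Rightarrow> real) \<Rightarrow> bool" where
  "adapted_metric J d \<longleftrightarrow> (\<forall>x. d x x = 0) \<and> (\<forall>x y. d x y = d y x) \<and>
     (\<forall>x y z. d x z \<le> d x y + d y z) \<and> (\<forall>x e. open {y. d x y < e}) \<and>
     (\<forall>x\<in>J. \<forall>y. d x y = 0 \<longrightarrow> x = y) \<and>
     (\<forall>p\<in>J. \<exists>c\<in>A. \<exists>W K. open W \<and> p \<in> W \<and> W \<subseteq> fst c \<and> 0 < K \<and>
        (\<forall>x\<in>W. \<forall>y\<in>W. d x y \<le> K * norm (snd c x - snd c y) \<and> norm (snd c x - snd c y) \<le> K * d x y))"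

lemma bump_continuous:
  assumes R: "good_radius c q R" shows "continuous_on UNIV (bump c q R)"
proof -
  have "isCont (bump c q R) p" for p
    unfolding isCont_def
  proof (rule tendstoI)
    fix e :: real assume e: "0 < e"
    let ?c = "chart_at A p"
    from bump_lipschitz[OF R chart_at(1) chart_at(2)[of p]]
    obtain W K where W: "open W" "p \<in> W" "W \<subseteq> fst ?c" "0 < K"
      "\<forall>x\<in>W. \<forall>y\<in>W. norm (bump c q R x - bump c q R y) \<le> K * norm (snd ?c x - snd ?c y)"
      by (elim exE conjE)
    define V where "V = W \<inter> (fst ?c \<inter> snd ?c -` ball (snd ?c p) (e / K))"
    have "open V" unfolding V_def by (intro open_Int W(1) chart_open_vimage[OF chart[OF chart_at(1)]] open_ball)
    moreover have "p \<in> V" using W e chart_at(2) by (simp add: V_def)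
    moreover have "dist (bump c q R x) (bump c q R p) < e" if "x \<in> V" for x
    proof -
      have x: "x \<in> W" "norm (snd ?c x - snd ?c p) < e / K"
        using that by (auto simp: V_def dist_norm norm_minus_commute)
      have "norm (bump c q R x - bump c q R p) \<le> K * norm (snd ?c x - snd ?c p)"
        using W(5) x(1) W(2) by blast
      also have "\<dots> < e" using x(2) W(4) by (simp add: pos_less_divide_eq mult.commute)
      finally show ?thesis by (simp add: dist_norm)
    qed
    ultimately show "\<forall>\<^sub>F x in at p. dist (bump c q R x) (bump c q R p) < e"
      unfolding eventually_at_topological by blast
  qed
  then show ?thesis by (simp add: continuous_on_eq_continuous_at)
qed

text \<open>\<open>d\<close> is the pullback of a sum of norms under finitely many bumps whose half
  balls cover \<open>J\<close>. Near a point, the bump of a half ball containing it gives the lower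
  bound and the injectivity; all bumps together, being locally Lipschitz, give the upper
  bound.\<close>

lemma adapted_metric_exists:
  assumes J: "compact J" shows "\<exists>d. adapted_metric J d"
proof -
  define R where "R q = (SOME R. good_radius (chart_at A q) q R)" for q
  have R: "good_radius (chart_at A q) q (R q)" for q
  proof -
    obtain r where "good_radius (chart_at A q) q r" using good_radius_exists[OF chart_at] by blast
    then show ?thesis unfolding R_def by (rule someI)
  qed
  have R0: "0 < R q" for q using R[of q] by (simp add: good_radius_def)
  define W where "W q = fst (chart_at A q) \<inter> snd (chart_at A q) -` ball (snd (chart_at A q) q) (R q / 2)" for q
  have W: "open (W q)" for q
    unfolding W_def by (intro chart_open_vimage chart chart_at open_ball)
  have W_norm: "x \<in> fst (chart_at A q)" "norm (snd (chart_at A q) x - snd (chart_at A q) q) \<le> R q / 2"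
    if "x \<in> W q" for x q
    using that by (auto simp: W_def dist_norm norm_minus_commute)
  have "q \<in> W q" for q using R0 chart_at(2) by (simp add: W_def)
  then have cov: "J \<subseteq> (\<Union>q\<in>J. W q)" by blast
  obtain F where F: "F \<subseteq> J" "finite F" "J \<subseteq> (\<Union>q\<in>F. W q)"
    by (rule compactE_image[OF J W cov])
  define b where "b q = bump (chart_at A q) q (R q)" for q
  define d where "d x y = (\<Sum>q\<in>F. norm (b q x - b q y))" for x y
  have le_d: "norm (b q x - b q y) \<le> d x y" if "q \<in> F" for q x y
    unfolding d_def using F(2) that by (rule member_le_sum[rotated 2]) auto
  have b_cont: "continuous_on UNIV (b q)" for q unfolding b_def by (rule bump_continuous[OF R])
  have "open {y. d x y < e}" for x e
    unfolding d_def by (intro open_Collect_less continuous_intros b_cont)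
  moreover have "d x z \<le> d x y + d y z" for x y z
    unfolding d_def sum.distrib[symmetric]
    unfolding dist_norm[symmetric] by (intro sum_mono dist_triangle)
  moreover have "d x y = d y x" for x y unfolding d_def by (simp add: norm_minus_commute)
  moreover have "x = y" if x: "x \<in> J" and 0: "d x y = 0" for x y
  proof -
    obtain q where q: "q \<in> F" "x \<in> W q" using F(3) x by blast
    have "b q x = b q y" using le_d[OF q(1), of x y] 0 by simp
    then show ?thesis unfolding b_def by (rule bump_inj[OF R W_norm[OF q(2)]])
  qed
  moreover have "\<exists>c\<in>A. \<exists>W K. open W \<and> p \<in> W \<and> W \<subseteq> fst c \<and> 0 < K \<and>
        (\<forall>x\<in>W. \<forall>y\<in>W. d x y \<le> K * norm (snd c x - snd c y) \<and> norm (snd c x - snd c y) \<le> K * d x y)"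
    if p: "p \<in> J" for p
  proof -
    obtain q where q: "q \<in> F" "p \<in> W q" using F(3) p by blast
    let ?c = "chart_at A q"
    have "\<forall>q'. \<exists>V K. open V \<and> p \<in> V \<and> V \<subseteq> fst ?c \<and> 0 < K \<and>
        (\<forall>x\<in>V. \<forall>y\<in>V. norm (b q' x - b q' y) \<le> K * norm (snd ?c x - snd ?c y))"
      unfolding b_def using bump_lipschitz[OF R chart_at(1) W_norm(1)[OF q(2)]] by simp
    then obtain V K where VK: "\<And>q'. open (V q') \<and> p \<in> V q' \<and> V q' \<subseteq> fst ?c \<and> 0 < K q' \<and>
        (\<forall>x\<in>V q'. \<forall>y\<in>V q'. norm (b q' x - b q' y) \<le> K q' * norm (snd ?c x - snd ?c y))"
      by metis
    define U where "U = W q \<inter> (\<Inter>q'\<in>F. V q')"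
    define L where "L = (\<Sum>q'\<in>F. K q') + 4 * R q"
    have "open U" unfolding U_def using VK by (intro open_Int W open_INT F(2)) auto
    moreover have "p \<in> U" using VK q by (simp add: U_def)
    moreover have "U \<subseteq> fst ?c" by (auto simp: U_def W_def)
    moreover have sK: "0 \<le> (\<Sum>q'\<in>F. K q')" using VK by (intro sum_nonneg) (simp add: less_imp_le)
    then have "0 < L" using R0[of q] by (simp add: L_def add_nonneg_pos)
    moreover have "d x y \<le> L * norm (snd ?c x - snd ?c y) \<and> norm (snd ?c x - snd ?c y) \<le> L * d x y"
      if xy: "x \<in> U" "y \<in> U" for x y
    proof
      have "d x y \<le> (\<Sum>q'\<in>F. K q' * norm (snd ?c x - snd ?c y))"
        unfolding d_def using VK xy by (intro sum_mono) (simp add: U_def)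
      also have "\<dots> = (\<Sum>q'\<in>F. K q') * norm (snd ?c x - snd ?c y)" by (simp add: sum_distrib_right)
      also have "\<dots> \<le> L * norm (snd ?c x - snd ?c y)"
        using R0[of q] by (intro mult_right_mono) (auto simp: L_def)
      finally show "d x y \<le> L * norm (snd ?c x - snd ?c y)" .
      have xy': "x \<in> W q" "y \<in> W q" using xy by (auto simp: U_def)
      have "norm (snd ?c x - snd ?c y) \<le> 4 * R q * norm (b q x - b q y)"
        unfolding b_def by (rule bump_lower[OF R W_norm[OF xy'(1)] W_norm[OF xy'(2)]])
      also have "\<dots> \<le> 4 * R q * d x y" using R0[of q] le_d[OF q(1)] by (intro mult_left_mono) auto
      also have "\<dots> \<le> L * d x y"
        using sK by (intro mult_right_mono) (auto simp: L_def d_def sum_nonneg)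
      finally show "norm (snd ?c x - snd ?c y) \<le> L * d x y" .
    qed
    ultimately show ?thesis using chart_at(1)
      by (intro bexI[of _ ?c] exI[of _ U] exI[of _ L] conjI ballI) auto
  qed
  moreover have "d x x = 0" for x by (simp add: d_def)
  ultimately have "adapted_metric J d" unfolding adapted_metric_def by (intro conjI allI ballI impI)
  then show ?thesis by (rule exI[of _ d])
qed

lemma adapted_metric_basic:
  assumes "adapted_metric J d"
  shows "d x x = 0" "d x y = d y x" "d x z \<le> d x y + d y z" "open {y. d x y < e}"
    "x \<in> J \<Longrightarrow> d x y = 0 \<Longrightarrow> x = y"
proof -
  note conjs = assms[unfolded adapted_metric_def]
  show "d x x = 0" using conjunct1[OF conjs] by (rule spec)
  show "d x y = d y x" using conjunct1[OF conjunct2[OF conjs]] by (elim allE)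
  show "d x z \<le> d x y + d y z" using conjunct1[OF conjunct2[OF conjunct2[OF conjs]]] by (elim allE)
  show "open {y. d x y < e}" using conjunct1[OF conjunct2[OF conjunct2[OF conjunct2[OF conjs]]]] by (elim allE)
  show "x \<in> J \<Longrightarrow> d x y = 0 \<Longrightarrow> x = y"
    using conjunct1[OF conjunct2[OF conjunct2[OF conjunct2[OF conjunct2[OF conjs]]]]] by blast
qed

lemma adapted_metric_local:
  assumes "adapted_metric J d" "p \<in> J"
  obtains c W K where "c \<in> A" "open W" "p \<in> W" "W \<subseteq> fst c" "0 < K"
    "\<And>x y. x \<in> W \<Longrightarrow> y \<in> W \<Longrightarrow> d x y \<le> K * norm (snd c x - snd c y)"
    "\<And>x y. x \<in> W \<Longrightarrow> y \<in> W \<Longrightarrow> norm (snd c x - snd c y) \<le> K * d x y"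
proof -
  have "\<exists>c\<in>A. \<exists>W K. open W \<and> p \<in> W \<and> W \<subseteq> fst c \<and> 0 < K \<and>
        (\<forall>x\<in>W. \<forall>y\<in>W. d x y \<le> K * norm (snd c x - snd c y) \<and> norm (snd c x - snd c y) \<le> K * d x y)"
    using assms(1)[unfolded adapted_metric_def, THEN conjunct2, THEN conjunct2, THEN conjunct2,
      THEN conjunct2, THEN conjunct2] assms(2) by (rule bspec)
  then obtain c W K where "c \<in> A" "open W" "p \<in> W" "W \<subseteq> fst c" "0 < K"
    "\<forall>x\<in>W. \<forall>y\<in>W. d x y \<le> K * norm (snd c x - snd c y) \<and> norm (snd c x - snd c y) \<le> K * d x y"
    by (elim bexE exE conjE)
  then show ?thesis by (intro that[of c W K]) simp_all
qed

text \<open>The growth sets are defined with \<open>d\<close>-balls, so within \<open>J\<close> such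
  balls must fit into given neighbourhoods. Outside \<open>W\<close> the distance from
  \<open>p\<close> is positive on a compact set, and balls of half that distance cover it; since
  only the openness of \<open>d\<close>-balls is at hand, a finite subcover yields the lower
  bound.\<close>

lemma adapted_metric_nhd:
  assumes d: "adapted_metric J d" and J: "compact J" and p: "p \<in> J" and W: "open W" "p \<in> W"
  shows "\<exists>e>0. \<forall>y\<in>J. d p y < e \<longrightarrow> y \<in> W"
proof -
  note dm = adapted_metric_basic[OF d]
  have nonneg: "0 \<le> d x y" for x y using dm(3)[of x x y] dm(1)[of x] dm(2)[of y x] by linarith
  have pos: "0 < d p y" if "y \<in> J - W" for y
  proof -
    have "d p y \<noteq> 0" using dm(5)[OF p, of y] that W(2) by blast
    then show ?thesis using nonneg[of p y] by linarith
  qed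
  define B where "B y = {z. d y z < d p y / 2}" for y
  have cov: "J - W \<subseteq> (\<Union>y\<in>J - W. B y)"
  proof
    fix y assume y: "y \<in> J - W"
    then have "y \<in> B y" using pos[OF y] by (simp add: B_def dm(1))
    with y show "y \<in> (\<Union>y\<in>J - W. B y)" by blast
  qed
  have op: "open (B y)" for y unfolding B_def by (rule dm(4))
  have "compact (J - W)" using J W(1) by (rule compact_diff)
  then obtain F where F: "F \<subseteq> J - W" "finite F" "J - W \<subseteq> (\<Union>y\<in>F. B y)"
    by (rule compactE_image[OF _ op cov])
  define e where "e = Min (insert 1 ((\<lambda>y. d p y / 2) ` F))"
  have e: "0 < e" unfolding e_def using F pos by (subst Min_gr_iff) auto
  have "z \<in> W" if z: "z \<in> J" "d p z < e" for z
  proof (rule ccontr)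
    assume "z \<notin> W"
    then obtain y where y: "y \<in> F" "d y z < d p y / 2" using F(3) z by (auto simp: B_def)
    have "e \<le> d p y / 2" unfolding e_def using F(2) y(1) by (intro Min_le) auto
    then show False using dm(3)[of p y z] dm(2)[of z y] y z(2) by linarith
  qed
  with e show ?thesis by blast
qed

text \<open>The neighbourhood depends on the arbitrary preferred chart at \<open>p\<close>, but \<open>K\<close> can be chosen
  uniformly for \<open>p\<close> in a compact set, since the tangent norm compensates for the choice of chart.\<close>

definition tangent_compare :: "('a \<Rightarrow> 'a \<Rightarrow> real) \<Rightarrow> real \<Rightarrow> 'a \<Rightarrow> bool" where
  "tangent_compare d K p \<longleftrightarrow> (\<exists>W. open W \<and> p \<in> W \<and> W \<subseteq> fst (chart_at A p) \<and>
     (\<forall>x\<in>W. \<forall>y\<in>W. d x y \<le> K * tn p (snd (chart_at A p) y - snd (chart_at A p) x) \<and>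
       tn p (snd (chart_at A p) y - snd (chart_at A p) x) \<le> K * d x y))"

lemma tangent_compare_local:
  assumes d: "adapted_metric J d" and p0: "p0 \<in> J"
  shows "\<exists>W K. open W \<and> p0 \<in> W \<and> 0 < K \<and> (\<forall>p\<in>W. tangent_compare d K p)"
proof -
  obtain c W1 K1 where 1: "c \<in> A" "open W1" "p0 \<in> W1" "W1 \<subseteq> fst c" "0 < K1"
    "\<And>x y. x \<in> W1 \<Longrightarrow> y \<in> W1 \<Longrightarrow> d x y \<le> K1 * norm (snd c x - snd c y)"
    "\<And>x y. x \<in> W1 \<Longrightarrow> y \<in> W1 \<Longrightarrow> norm (snd c x - snd c y) \<le> K1 * d x y"
    using adapted_metric_local[OF d p0] by metis
  have "p0 \<in> fst c" using 1(3,4) by blast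
  note metric_bound[OF 1(1) this]
  then obtain W2 K2 where 2: "open W2" "p0 \<in> W2" "W2 \<subseteq> fst c" "1 \<le> K2"
    "\<forall>x\<in>W2. \<forall>v. norm v \<le> K2 * tn x (from_chart A c x v) \<and> tn x (from_chart A c x v) \<le> K2 * norm v"
    by (elim exE conjE)
  have "tangent_compare d (2 * K2 * K1) p" if p: "p \<in> W1 \<inter> W2" for p
  proof -
    have pc: "p \<in> fst c" using p 1(4) by blast
    let ?c = "chart_at A p"
    obtain B where B: "0 < B" "\<And>v. tn p v \<le> B * norm v" using tn_upper by blast
    \<comment> \<open>The linearisation error is then at most half of the lower bound for
      \<open>tn p L\<close>. \<open>B\<close>, \<open>e\<close> and the neighbourhood depend on
      \<open>p\<close>, but the final constant \<open>2 * K2 * K1\<close> does not.\<close>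
    define e where "e = 1 / (2 * K2 * B)"
    have e: "0 < e" using 2(4) B by (simp add: e_def)
    obtain V where V: "open V" "p \<in> V" "V \<subseteq> fst c" "id ` V \<subseteq> fst ?c"
      "\<And>x y. x \<in> V \<Longrightarrow> y \<in> V \<Longrightarrow> norm (snd ?c (id y) - snd ?c (id x) - from_chart A c p (snd c y - snd c x))
          \<le> e * norm (snd c y - snd c x)"
      using chart_derivE[OF from_chart_deriv[OF 1(1) pc] e] by metis
    define U where "U = V \<inter> W1"
    have "d x y \<le> 2 * K2 * K1 * tn p (snd ?c y - snd ?c x) \<and>
       tn p (snd ?c y - snd ?c x) \<le> 2 * K2 * K1 * d x y" if xy: "x \<in> U" "y \<in> U" for x y
    proof -
      define v where "v = snd c y - snd c x"
      define w where "w = snd ?c y - snd ?c x"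
      define L where "L = from_chart A c p v"
      have dv: "d x y \<le> K1 * norm v" "norm v \<le> K1 * d x y"
        using 1(6,7)[of x y] xy by (simp_all add: U_def v_def norm_minus_commute)
      have "norm (w - L) \<le> e * norm v" using V(5)[of x y] xy by (simp add: U_def v_def w_def L_def)
      then have "tn p (w - L) \<le> B * (e * norm v)"
        using order_trans[OF B(2)[of "w - L"] mult_left_mono[of _ _ B]] B(1) by simp
      also have "\<dots> = norm v / (2 * K2)" using B(1) by (simp add: e_def)
      finally have err: "tn p (w - L) \<le> norm v / (2 * K2)" .
      have L: "norm v \<le> K2 * tn p L" "tn p L \<le> K2 * norm v" using 2(5) p by (simp_all add: L_def)
      have up: "tn p w \<le> 2 * K2 * norm v"
      proof -
        have "tn p w \<le> tn p L + tn p (w - L)" by (rule tn_diff)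
        also have "norm v / (2 * K2) \<le> norm v * K2"
        proof -
          have "norm v / (2 * K2) \<le> norm v / 1" using 2(4) by (intro divide_left_mono) auto
          also have "\<dots> \<le> norm v * K2" using 2(4) mult_left_mono[of 1 K2 "norm v"] by simp
          finally show ?thesis .
        qed
        then have "tn p (w - L) \<le> norm v * K2" using err by simp
        then have "tn p L + tn p (w - L) \<le> 2 * K2 * norm v" using L(2) by (simp add: algebra_simps)
        finally show ?thesis .
      qed
      have low: "norm v \<le> 2 * K2 * tn p w"
      proof -
        have "tn p L \<le> tn p w + tn p (w - L)"
          using tn_diff[of p L w] tn_uminus[of p "w - L"] by simp
        then have "tn p L \<le> tn p w + norm v / (2 * K2)" using err by simp
        then have "K2 * tn p L \<le> K2 * (tn p w + norm v / (2 * K2))" using 2(4) by (intro mult_left_mono) auto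
        also have "\<dots> = K2 * tn p w + norm v / 2" using 2(4) by (simp add: distrib_left)
        finally show ?thesis using L(1) by simp
      qed
      have "d x y \<le> K1 * (2 * K2 * tn p w)"
        by (rule order_trans[OF dv(1) mult_left_mono[OF low]]) (use 1(5) in simp)
      moreover have "tn p w \<le> 2 * K2 * (K1 * d x y)"
        by (rule order_trans[OF up mult_left_mono[OF dv(2)]]) (use 2(4) in simp)
      ultimately show ?thesis unfolding w_def by (simp add: mult_ac)
    qed
    moreover have "open U" unfolding U_def using V(1) 1(2) by (rule open_Int)
    moreover have "p \<in> U" "U \<subseteq> fst ?c" using V(2,4) p by (auto simp: U_def)
    ultimately show ?thesis unfolding tangent_compare_def by (intro exI[of _ U]) simp
  qed
  moreover have "open (W1 \<inter> W2)" using 1(2) 2(1) by (rule open_Int)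
  moreover have "p0 \<in> W1 \<inter> W2" "0 < 2 * K2 * K1" using 1(3,5) 2(2,4) by simp_all
  ultimately show ?thesis by (intro exI[of _ "W1 \<inter> W2"] exI[of _ "2 * K2 * K1"] conjI ballI)
qed

lemma tangent_compare_mono:
  assumes "tangent_compare d K p" "K \<le> L" and "\<And>x y. 0 \<le> d x y"
  shows "tangent_compare d L p"
proof -
  have le: "K * d x y \<le> L * d x y" "K * tn p v \<le> L * tn p v" for x y v
    using assms by (auto intro!: mult_right_mono)
  obtain W where "open W" "p \<in> W" "W \<subseteq> fst (chart_at A p)"
     "\<forall>x\<in>W. \<forall>y\<in>W. d x y \<le> K * tn p (snd (chart_at A p) y - snd (chart_at A p) x) \<and>
       tn p (snd (chart_at A p) y - snd (chart_at A p) x) \<le> K * d x y"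
    using assms(1) unfolding tangent_compare_def by (elim exE conjE)
  then show ?thesis unfolding tangent_compare_def
    by (intro exI[of _ W] conjI ballI) (auto intro: order_trans[OF _ le(1)] order_trans[OF _ le(2)])
qed

lemma tangent_compare_uniform:
  assumes d: "adapted_metric J d" and J: "compact J"
  shows "\<exists>K>0. \<forall>p\<in>J. tangent_compare d K p"
proof -
  note dm = adapted_metric_basic[OF d]
  have nonneg: "0 \<le> d x y" for x y using dm(3)[of x x y] dm(1)[of x] dm(2)[of y x] by linarith
  have "\<forall>p. \<exists>W K. p \<in> J \<longrightarrow> open W \<and> p \<in> W \<and> 0 < K \<and> (\<forall>q\<in>W. tangent_compare d K q)"
    using tangent_compare_local[OF d] by blast
  then obtain W K where WK: "\<And>p. p \<in> J \<Longrightarrow> open (W p) \<and> p \<in> W p \<and> 0 < K p \<and> (\<forall>q\<in>W p. tangent_compare d (K p) q)"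
    by metis
  have cov: "J \<subseteq> (\<Union>p\<in>J. W p)" and op: "\<And>p. p \<in> J \<Longrightarrow> open (W p)" using WK by blast+
  obtain F where F: "F \<subseteq> J" "finite F" "J \<subseteq> (\<Union>p\<in>F. W p)"
    by (rule compactE_image[OF J op cov])
  define L where "L = (\<Sum>p\<in>F. K p) + 1"
  have K0: "0 \<le> K p" if "p \<in> F" for p using WK[of p] F(1) that by force
  have "0 < L" unfolding L_def using K0 by (intro add_nonneg_pos sum_nonneg) auto
  moreover have "tangent_compare d L q" if q: "q \<in> J" for q
  proof -
    obtain p where p: "p \<in> F" "q \<in> W p" using F(3) q by blast
    have "tangent_compare d (K p) q" using WK[of p] p F(1) by blast
    moreover have "K p \<le> (\<Sum>p\<in>F. K p)" using p(1) F(2) K0 by (intro member_le_sum) auto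
    then have "K p \<le> L" by (simp add: L_def)
    ultimately show ?thesis using nonneg by (rule tangent_compare_mono)
  qed
  ultimately show ?thesis by blast
qed

end

section \<open>Growth along Lyapunov regular orbits\<close>

locale expanding_dynamics = riemannian_manifold A g
  for A :: "('a::t2_space, 'b::euclidean_space) chart set" and g :: "'a \<Rightarrow> 'b \<Rightarrow> 'b \<Rightarrow> real" +
  fixes f :: "'a \<Rightarrow> 'a" and J :: "'a set" and d :: "'a \<Rightarrow> 'a \<Rightarrow> real"
  assumes C1: "C1_map A f" and rep: "repeller A g f J" and adapted: "adapted_metric J d"
begin

lemma compact_J: "compact J" and f_J: "x \<in> J \<Longrightarrow> f x \<in> J"
  using rep by (auto simp: repeller_def)

sublocale metric_dynamics f J d
proof
  show "d x x = 0" "d x y = d y x" "d x z \<le> d x y + d y z" "open {y. d x y < e}" for x y z e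
    by (rule adapted_metric_basic[OF adapted])+
  show "continuous_on UNIV f" using C1 by (simp add: C1_map_def)
  show "x \<in> J \<Longrightarrow> f x \<in> J" for x by (rule f_J)
qed

abbreviation "coord x \<equiv> snd (chart_at A x)"
abbreviation "Df n x \<equiv> differential A (f ^^ n) x"

section \<open>Differentials of the iterates in the preferred charts\<close>

lemma f_deriv: "\<exists>D. chart_deriv (chart_at A x) (chart_at A (f x)) f x D"
proof -
  have "Ck_on 1 (coord x ` (fst (chart_at A x) \<inter> f -` fst (chart_at A (f x))))
      (local_rep (chart_at A x) (chart_at A (f x)) f)"
    using C1 chart_at(1) unfolding C1_map_def by blast
  from chart_deriv_of_C1[OF chart[OF chart_at(1)] chart[OF chart_at(1)] f_cont this chart_at(2) chart_at(2)]
  show ?thesis by blast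
qed

lemma funpow_deriv_exists: "\<exists>D. chart_deriv (chart_at A x) (chart_at A ((f ^^ n) x)) (f ^^ n) x D"
proof (induction n)
  case 0
  have "chart_deriv (chart_at A x) (chart_at A ((f ^^ 0) x)) (f ^^ 0) x id"
    using chart_deriv_id[OF chart_at(1) chart_at(2)] by (simp add: id_def)
  then show ?case by blast
next
  case (Suc n)
  then obtain D where D: "chart_deriv (chart_at A x) (chart_at A ((f ^^ n) x)) (f ^^ n) x D" by (elim exE)
  obtain E where E: "chart_deriv (chart_at A ((f ^^ n) x)) (chart_at A (f ((f ^^ n) x))) f ((f ^^ n) x) E"
    using f_deriv by (elim exE[OF f_deriv])
  from chart_deriv_compose[OF D E funpow_cont]
  have "chart_deriv (chart_at A x) (chart_at A ((f ^^ Suc n) x)) (f ^^ Suc n) x (E \<circ> D)" by simp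
  then show ?case by blast
qed

lemma funpow_deriv: "chart_deriv (chart_at A x) (chart_at A ((f ^^ n) x)) (f ^^ n) x (Df n x)"
proof -
  obtain D where D: "chart_deriv (chart_at A x) (chart_at A ((f ^^ n) x)) (f ^^ n) x D"
    using funpow_deriv_exists by (elim exE[OF funpow_deriv_exists])
  then have "Df n x = D"
    unfolding differential_def by (rule chart_deriv_unique[OF chart[OF chart_at(1)]])
  with D show ?thesis by simp
qed

lemma Df_bounded_linear: "bounded_linear (Df n x)"
  using funpow_deriv[of x n] by (simp add: chart_deriv_def)

lemma Df_linear: "linear (Df n x)"
  by (rule bounded_linear.linear[OF Df_bounded_linear])

text \<open>One constant for all of \<open>J\<close>: the comparison is made at \<open>x\<close> and
  at its image under the n-th iterate, and its cost must not depend on n in order to be absorbed by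
  exponential growth.\<close>

definition compare_const :: real where
  "compare_const = (SOME K. 0 < K \<and> (\<forall>p\<in>J. tangent_compare d K p))"

lemma compare_const: "0 < compare_const" "p \<in> J \<Longrightarrow> tangent_compare d compare_const p"
proof -
  have "\<exists>K. 0 < K \<and> (\<forall>p\<in>J. tangent_compare d K p)"
    using tangent_compare_uniform[OF adapted compact_J] by blast
  from someI_ex[OF this]
  show "0 < compare_const" "p \<in> J \<Longrightarrow> tangent_compare d compare_const p"
    unfolding compare_const_def by blast+
qed

text \<open>The coordinate difference of \<open>y\<close> and \<open>z\<close> plays the role of a
  tangent vector at \<open>x\<close>. Strict differentiability of the iterate bounds the error
  relative to this vector, and \<open>tangent_compare\<close> translates norms into distances at
  both ends.\<close>

lemma funpow_linearize:
  assumes x: "x \<in> J" and e: "0 < e"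
  shows "\<exists>W. open W \<and> x \<in> W \<and> (\<forall>y\<in>W. \<forall>z\<in>W. let w = coord x z - coord x y in
    d y z \<le> compare_const * tn x w \<and> tn x w \<le> compare_const * d y z \<and>
    d ((f ^^ N) y) ((f ^^ N) z) \<le> compare_const * (tn ((f ^^ N) x) (Df N x w) + e * tn x w) \<and>
    tn ((f ^^ N) x) (Df N x w) - e * tn x w \<le> compare_const * d ((f ^^ N) y) ((f ^^ N) z))"
proof -
  let ?K = compare_const and ?x' = "(f ^^ N) x"
  note K = compare_const(1)
  from compare_const(2)[OF x] obtain W1 where W1: "open W1" "x \<in> W1" "W1 \<subseteq> fst (chart_at A x)"
     "\<forall>y\<in>W1. \<forall>z\<in>W1. d y z \<le> ?K * tn x (coord x z - coord x y) \<and> tn x (coord x z - coord x y) \<le> ?K * d y z"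
    unfolding tangent_compare_def by (elim exE conjE)
  from compare_const(2)[OF funpow_J[OF x, of N]] obtain W2 where W2: "open W2" "?x' \<in> W2" "W2 \<subseteq> fst (chart_at A ?x')"
     "\<forall>y\<in>W2. \<forall>z\<in>W2. d y z \<le> ?K * tn ?x' (coord ?x' z - coord ?x' y) \<and> tn ?x' (coord ?x' z - coord ?x' y) \<le> ?K * d y z"
    unfolding tangent_compare_def by (elim exE conjE)
  obtain B where B: "0 < B" "\<And>v. tn ?x' v \<le> B * norm v" using tn_upper by blast
  obtain B' where B': "0 < B'" "\<And>v. norm v \<le> B' * tn x v" using tn_lower by blast
  \<comment> \<open>\<open>B\<close> and \<open>B'\<close> convert the Euclidean error into tangent
    norms, \<open>B\<close> at the image and \<open>B'\<close> at \<open>x\<close>.\<close>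
  have e': "0 < e / (B * B')" using e B B' by simp
  obtain W3 where W3: "open W3" "x \<in> W3" "W3 \<subseteq> fst (chart_at A x)" "(f ^^ N) ` W3 \<subseteq> fst (chart_at A ?x')"
    "\<And>y z. y \<in> W3 \<Longrightarrow> z \<in> W3 \<Longrightarrow> norm (coord ?x' ((f ^^ N) z) - coord ?x' ((f ^^ N) y) - Df N x (coord x z - coord x y))
          \<le> e / (B * B') * norm (coord x z - coord x y)"
    using chart_derivE[OF funpow_deriv e', of x N] by metis
  define W where "W = W1 \<inter> W3 \<inter> (f ^^ N) -` W2"
  have "open W" unfolding W_def by (intro open_Int W1(1) W3(1) open_vimage[OF W2(1) funpow_cont])
  moreover have "x \<in> W" using W1 W2 W3 by (simp add: W_def)
  moreover have "let w = coord x z - coord x y in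
    d y z \<le> ?K * tn x w \<and> tn x w \<le> ?K * d y z \<and>
    d ((f ^^ N) y) ((f ^^ N) z) \<le> ?K * (tn ?x' (Df N x w) + e * tn x w) \<and>
    tn ?x' (Df N x w) - e * tn x w \<le> ?K * d ((f ^^ N) y) ((f ^^ N) z)" if yz: "y \<in> W" "z \<in> W" for y z
  proof -
    define w where "w = coord x z - coord x y"
    define u where "u = coord ?x' ((f ^^ N) z) - coord ?x' ((f ^^ N) y)"
    have yz': "y \<in> W1" "z \<in> W1" "y \<in> W3" "z \<in> W3" "(f ^^ N) y \<in> W2" "(f ^^ N) z \<in> W2"
      using yz by (auto simp: W_def)
    have 1: "d y z \<le> ?K * tn x w" "tn x w \<le> ?K * d y z"
      using W1(4) yz'(1,2) unfolding w_def by blast+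
    have 2: "d ((f ^^ N) y) ((f ^^ N) z) \<le> ?K * tn ?x' u" "tn ?x' u \<le> ?K * d ((f ^^ N) y) ((f ^^ N) z)"
      using W2(4) yz'(5,6) unfolding u_def by blast+
    have "norm (u - Df N x w) \<le> e / (B * B') * norm w" unfolding u_def w_def by (rule W3(5)[OF yz'(3,4)])
    also have "\<dots> \<le> e / (B * B') * (B' * tn x w)" using e' by (intro mult_left_mono B'(2)) simp
    also have "\<dots> = e / B * tn x w" using B'(1) by simp
    finally have "B * norm (u - Df N x w) \<le> B * (e / B * tn x w)" using B(1) by (intro mult_left_mono) simp_all
    then have err: "tn ?x' (u - Df N x w) \<le> e * tn x w" using B(2)[of "u - Df N x w"] B(1) by simp
    have "tn ?x' u \<le> tn ?x' (Df N x w) + e * tn x w"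
      using tn_diff[of ?x' u "Df N x w"] err by linarith
    then have "?K * tn ?x' u \<le> ?K * (tn ?x' (Df N x w) + e * tn x w)" using K by (intro mult_left_mono) simp_all
    moreover have "tn ?x' (Df N x w - u) \<le> e * tn x w"
      using err tn_uminus[of ?x' "u - Df N x w"] by simp
    then have "tn ?x' (Df N x w) \<le> tn ?x' u + e * tn x w"
      using tn_diff[of ?x' "Df N x w" u] by linarith
    ultimately show ?thesis using 1 2 unfolding Let_def w_def[symmetric] by linarith
  qed
  ultimately show ?thesis by (intro exI[of _ W] conjI ballI)
qed

text \<open>The expansion of the repeller at n = 1 gives a lower factor a = c \<kappa>, possibly
  below 1 but positive; linearising with error a / 2 leaves half of it. The upper factor is a bound
  of \<open>Df 1 x\<close> between the two tangent norms.\<close>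

lemma step_compare_local:
  assumes x: "x \<in> J"
  shows "\<exists>W C. open W \<and> x \<in> W \<and> 0 \<le> C \<and> (\<forall>y\<in>W. \<forall>z\<in>W.
    d y z \<le> exp C * d (f y) (f z) \<and> d (f y) (f z) \<le> exp C * d y z)"
proof -
  let ?K = compare_const
  note K = compare_const(1)
  obtain \<kappa> c where \<kappa>: "1 < \<kappa>" "0 < c" "\<forall>x\<in>J. \<forall>v. \<forall>n\<ge>1. c * \<kappa> ^ n * tn x v \<le> tn ((f ^^ n) x) (Df n x v)"
    using rep unfolding repeller_def by (elim exE conjE)
  define a where "a = c * \<kappa>"
  have a: "0 < a" using \<kappa> by (simp add: a_def)
  have low: "a * tn x v \<le> tn (f x) (Df 1 x v)" for v
    using \<kappa>(3)[rule_format, OF x, of 1 v] by (simp add: a_def)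
  have "\<exists>B>0. \<forall>v. tn (f x) (Df 1 x v) \<le> B * tn x v"
  proof -
    obtain B where B: "0 < B" "\<And>v. tn (f x) v \<le> B * norm v" using tn_upper by blast
    obtain B' where B': "0 < B'" "\<And>v. norm v \<le> B' * tn x v" using tn_lower by blast
    obtain L where L: "0 < L" "\<And>v. norm (Df 1 x v) \<le> L * norm v"
      using linear_bounded_pos[OF Df_linear[of 1 x]] by metis
    have "tn (f x) (Df 1 x v) \<le> B * (L * (B' * tn x v))" for v
      by (rule order_trans[OF B(2) mult_left_mono[OF order_trans[OF L(2) mult_left_mono[OF B'(2)]]]])
        (use B L in simp_all)
    then show ?thesis using B(1) B'(1) L(1) by (intro exI[of _ "B * L * B'"]) (simp add: mult.assoc)
  qed
  then obtain B where B: "0 < B" "\<And>v. tn (f x) (Df 1 x v) \<le> B * tn x v" by blast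
  from funpow_linearize[OF x half_gt_zero[OF a], of 1] obtain W where W: "open W" "x \<in> W"
    "\<forall>y\<in>W. \<forall>z\<in>W. let w = coord x z - coord x y in
    d y z \<le> ?K * tn x w \<and> tn x w \<le> ?K * d y z \<and>
    d ((f ^^ 1) y) ((f ^^ 1) z) \<le> ?K * (tn ((f ^^ 1) x) (Df 1 x w) + a / 2 * tn x w) \<and>
    tn ((f ^^ 1) x) (Df 1 x w) - a / 2 * tn x w \<le> ?K * d ((f ^^ 1) y) ((f ^^ 1) z)" by (elim exE conjE)
  define M where "M = max 1 (max (2 * ?K * ?K / a) (?K * (B + a / 2) * ?K))"
  have M: "1 \<le> M" by (simp add: M_def)
  have "d y z \<le> M * d (f y) (f z) \<and> d (f y) (f z) \<le> M * d y z" if yz: "y \<in> W" "z \<in> W" for y z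
  proof -
    define w where "w = coord x z - coord x y"
    have *: "d y z \<le> ?K * tn x w" "tn x w \<le> ?K * d y z"
      "d (f y) (f z) \<le> ?K * (tn (f x) (Df 1 x w) + a / 2 * tn x w)"
      "tn (f x) (Df 1 x w) - a / 2 * tn x w \<le> ?K * d (f y) (f z)"
      using W(3)[rule_format, OF yz] unfolding Let_def w_def[symmetric] by simp_all
    have "a / 2 * tn x w \<le> ?K * d (f y) (f z)" using *(4) low[of w] by simp
    then have "tn x w \<le> 2 * ?K / a * d (f y) (f z)" using a by (simp add: field_simps)
    then have "?K * tn x w \<le> ?K * (2 * ?K / a * d (f y) (f z))" using K by (intro mult_left_mono) simp_all
    then have "d y z \<le> 2 * ?K * ?K / a * d (f y) (f z)" using *(1) by (simp add: mult_ac)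
    also have "\<dots> \<le> M * d (f y) (f z)" by (intro mult_right_mono d_nonneg) (simp add: M_def)
    finally have 1: "d y z \<le> M * d (f y) (f z)" .
    have "d (f y) (f z) \<le> ?K * ((B + a / 2) * tn x w)"
    proof (rule order_trans[OF *(3) mult_left_mono])
      show "tn (f x) (Df 1 x w) + a / 2 * tn x w \<le> (B + a / 2) * tn x w"
        using B(2)[of w] by (simp add: distrib_right)
    qed (use K in simp)
    also have "\<dots> \<le> ?K * ((B + a / 2) * (?K * d y z))" using K B(1) a *(2) by (intro mult_left_mono) simp_all
    also have "\<dots> = ?K * (B + a / 2) * ?K * d y z" by (simp add: mult_ac)
    also have "\<dots> \<le> M * d y z" by (intro mult_right_mono d_nonneg) (simp add: M_def)
    finally show ?thesis using 1 by simp
  qed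
  moreover have "exp (ln M) = M" using M by simp
  moreover have "0 \<le> ln M" using M by simp
  ultimately show ?thesis using W(1,2) by (intro exI[of _ W] exI[of _ "ln M"]) simp
qed

text \<open>A Lebesgue number argument: the local estimate holds on balls of radius
  \<open>2 * e x\<close>, while balls of radius \<open>e x\<close> cover \<open>J\<close>, so points
  closer than every \<open>e x\<close> of a finite subcover lie in a common larger ball.\<close>

lemma step_compare:
  "\<exists>C r. 0 \<le> C \<and> 0 < r \<and> (\<forall>y\<in>J. \<forall>z\<in>J. d y z < r \<longrightarrow>
    d y z \<le> exp C * d (f y) (f z) \<and> d (f y) (f z) \<le> exp C * d y z)"
proof -
  have "\<exists>e C. 0 < e \<and> 0 \<le> C \<and> (\<forall>y\<in>J. \<forall>z\<in>J. d x y < 2 * e \<and> d x z < 2 * e \<longrightarrow>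
    d y z \<le> exp C * d (f y) (f z) \<and> d (f y) (f z) \<le> exp C * d y z)" if x: "x \<in> J" for x
  proof -
    from step_compare_local[OF x] obtain W C where W: "open W" "x \<in> W" "0 \<le> C" "\<forall>y\<in>W. \<forall>z\<in>W.
      d y z \<le> exp C * d (f y) (f z) \<and> d (f y) (f z) \<le> exp C * d y z" by (elim exE conjE)
    from adapted_metric_nhd[OF adapted compact_J x W(1,2)]
    obtain e where e: "0 < e" "\<forall>y\<in>J. d x y < e \<longrightarrow> y \<in> W" by (elim exE conjE)
    show ?thesis using e W(3,4) by (intro exI[of _ "e / 2"] exI[of _ C]) simp
  qed
  then have "\<forall>x. \<exists>e C. x \<in> J \<longrightarrow> 0 < e \<and> 0 \<le> C \<and> (\<forall>y\<in>J. \<forall>z\<in>J. d x y < 2 * e \<and> d x z < 2 * e \<longrightarrow>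
    d y z \<le> exp C * d (f y) (f z) \<and> d (f y) (f z) \<le> exp C * d y z)" by blast
  from choice[OF this] obtain e where "\<forall>x. \<exists>C. x \<in> J \<longrightarrow> 0 < e x \<and> 0 \<le> C \<and> (\<forall>y\<in>J. \<forall>z\<in>J. d x y < 2 * e x \<and> d x z < 2 * e x \<longrightarrow>
    d y z \<le> exp C * d (f y) (f z) \<and> d (f y) (f z) \<le> exp C * d y z)" by (elim exE)
  from choice[OF this] obtain C where eC: "\<forall>x. x \<in> J \<longrightarrow> 0 < e x \<and> 0 \<le> C x \<and> (\<forall>y\<in>J. \<forall>z\<in>J. d x y < 2 * e x \<and> d x z < 2 * e x \<longrightarrow>
    d y z \<le> exp (C x) * d (f y) (f z) \<and> d (f y) (f z) \<le> exp (C x) * d y z)" by (elim exE)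
  define B where "B x = {y. d x y < e x}" for x
  have op: "open (B x)" for x unfolding B_def by (rule d_open)
  have "x \<in> B x" if "x \<in> J" for x using eC that by (simp add: B_def)
  then have cov: "J \<subseteq> (\<Union>x\<in>J. B x)" by blast
  obtain F where F: "F \<subseteq> J" "finite F" "J \<subseteq> (\<Union>x\<in>F. B x)"
    by (rule compactE_image[OF compact_J op cov])
  define r where "r = Min (insert 1 (e ` F))"
  define L where "L = (\<Sum>x\<in>F. C x)"
  have C0: "0 \<le> C x" if "x \<in> F" for x using eC F(1) that by blast
  have e0: "0 < e x" if "x \<in> F" for x using eC F(1) that by blast
  have "0 < r" unfolding r_def using F(2) e0 by (subst Min_gr_iff) auto
  moreover have "0 \<le> L" unfolding L_def by (intro sum_nonneg C0)
  moreover have "d y z \<le> exp L * d (f y) (f z) \<and> d (f y) (f z) \<le> exp L * d y z"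
    if yz: "y \<in> J" "z \<in> J" "d y z < r" for y z
  proof -
    obtain x where x: "x \<in> F" "d x y < e x" using F(3) yz(1) unfolding B_def by blast
    have "r \<le> e x" unfolding r_def using F(2) x(1) by (intro Min_le) auto
    then have "d x z < 2 * e x" using d_triangle[of x z y] x(2) yz(3) by linarith
    moreover have "d x y < 2 * e x" using x(2) e0[OF x(1)] by linarith
    ultimately have *: "d y z \<le> exp (C x) * d (f y) (f z)" "d (f y) (f z) \<le> exp (C x) * d y z"
      using eC x(1) F(1) yz(1,2) by blast+
    have "C x \<le> L" unfolding L_def using x(1) F(2) C0 by (intro member_le_sum) auto
    then have "exp (C x) * d (f y) (f z) \<le> exp L * d (f y) (f z)" "exp (C x) * d y z \<le> exp L * d y z"
      using d_nonneg by (auto intro!: mult_right_mono)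
    with * show ?thesis by linarith
  qed
  ultimately show ?thesis by (intro exI[of _ L] exI[of _ r] conjI ballI impI) auto
qed

text \<open>Passing between \<open>d\<close> and tangent norms costs \<open>compare_const\<close> at
  each end of an orbit segment, and the linearisation error costs a factor 2; the hypotheses carry
  these factors in advance. Only finitely many times occur, so one neighbourhood serves them
  all.\<close>

lemma growth_set_local:
  assumes x: "x \<in> J" and N: "1 \<le> N"
    and up: "\<And>v. 2 * compare_const\<^sup>2 * tn ((f ^^ N) x) (Df N x v) \<le> exp (\<beta> * real N) * tn x v"
    and low: "\<And>v. v \<noteq> 0 \<Longrightarrow> \<exists>n\<in>{1..k}. 2 * compare_const\<^sup>2 * exp (\<alpha> * real n) * tn x v \<le> tn ((f ^^ n) x) (Df n x v)"
    and k: "1 \<le> k"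
  shows "\<exists>l. x \<in> growth_set \<alpha> \<beta> l"
proof -
  let ?K = compare_const
  note K = compare_const(1)
  define m where "m = max k N"
  \<comment> \<open>The error takes up at most half of either bound.\<close>
  define e where "e n = min (exp (\<beta> * real n) / (2 * ?K\<^sup>2)) (?K\<^sup>2 * exp (\<alpha> * real n))" for n
  have e: "0 < e n" for n using K by (simp add: e_def)
  have "\<forall>n. \<exists>W. open W \<and> x \<in> W \<and> (\<forall>y\<in>W. \<forall>z\<in>W. let w = coord x z - coord x y in
    d y z \<le> ?K * tn x w \<and> tn x w \<le> ?K * d y z \<and>
    d ((f ^^ n) y) ((f ^^ n) z) \<le> ?K * (tn ((f ^^ n) x) (Df n x w) + e n * tn x w) \<and>
    tn ((f ^^ n) x) (Df n x w) - e n * tn x w \<le> ?K * d ((f ^^ n) y) ((f ^^ n) z))"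
    using funpow_linearize[OF x e] by (intro allI)
  from choice[OF this] obtain W where W: "\<forall>n. open (W n) \<and> x \<in> W n \<and> (\<forall>y\<in>W n. \<forall>z\<in>W n. let w = coord x z - coord x y in
    d y z \<le> ?K * tn x w \<and> tn x w \<le> ?K * d y z \<and>
    d ((f ^^ n) y) ((f ^^ n) z) \<le> ?K * (tn ((f ^^ n) x) (Df n x w) + e n * tn x w) \<and>
    tn ((f ^^ n) x) (Df n x w) - e n * tn x w \<le> ?K * d ((f ^^ n) y) ((f ^^ n) z))" by (elim exE)
  define V where "V = (\<Inter>n\<in>{1..m}. W n)"
  have "open V" unfolding V_def using W by (intro open_INT) auto
  moreover have "x \<in> V" using W by (simp add: V_def)
  ultimately obtain r where r: "0 < r" "\<forall>y\<in>J. d x y < r \<longrightarrow> y \<in> V"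
    using adapted_metric_nhd[OF adapted compact_J x] by blast
  obtain q :: nat where q: "1 / real (Suc q) < r"
    using r(1) nat_approx_posE by metis
  define l where "l = max m q"
  have "1 / real (Suc l) \<le> 1 / real (Suc q)" by (intro divide_left_mono) (auto simp: l_def)
  then have rl: "1 / real (Suc l) < r" using q by simp
  have pair: "growth_pair \<alpha> \<beta> l y z" if yz: "y \<in> V" "z \<in> V" for y z
  proof -
    define w where "w = coord x z - coord x y"
    have *: "d y z \<le> ?K * tn x w" "tn x w \<le> ?K * d y z"
      "d ((f ^^ n) y) ((f ^^ n) z) \<le> ?K * (tn ((f ^^ n) x) (Df n x w) + e n * tn x w)"
      "tn ((f ^^ n) x) (Df n x w) - e n * tn x w \<le> ?K * d ((f ^^ n) y) ((f ^^ n) z)" if "n \<in> {1..m}" for n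
    proof -
      have "y \<in> W n" "z \<in> W n" using yz that by (simp_all add: V_def)
      then show "d y z \<le> ?K * tn x w" "tn x w \<le> ?K * d y z"
      "d ((f ^^ n) y) ((f ^^ n) z) \<le> ?K * (tn ((f ^^ n) x) (Df n x w) + e n * tn x w)"
      "tn ((f ^^ n) x) (Df n x w) - e n * tn x w \<le> ?K * d ((f ^^ n) y) ((f ^^ n) z)"
        using spec[OF W, of n] unfolding Let_def w_def by blast+
    qed
    have Nm: "N \<in> {1..m}" using N by (simp add: m_def)
    have "d ((f ^^ N) y) ((f ^^ N) z) \<le> exp (\<beta> * real N) * d y z"
    proof -
      have "tn ((f ^^ N) x) (Df N x w) \<le> exp (\<beta> * real N) / (2 * ?K\<^sup>2) * tn x w"
        using up[of w] K by (simp add: field_simps)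
      moreover have "e N * tn x w \<le> exp (\<beta> * real N) / (2 * ?K\<^sup>2) * tn x w"
        by (intro mult_right_mono) (simp_all add: e_def)
      ultimately have "tn ((f ^^ N) x) (Df N x w) + e N * tn x w \<le> exp (\<beta> * real N) / ?K\<^sup>2 * tn x w"
        by (simp add: field_simps)
      then have "?K * (tn ((f ^^ N) x) (Df N x w) + e N * tn x w) \<le> ?K * (exp (\<beta> * real N) / ?K\<^sup>2 * tn x w)"
        using K by (intro mult_left_mono) simp_all
      also have "\<dots> \<le> ?K * (exp (\<beta> * real N) / ?K\<^sup>2 * (?K * d y z))"
        using K *(2)[OF Nm] by (intro mult_left_mono) simp_all
      also have "\<dots> = exp (\<beta> * real N) * d y z" using K by (simp add: power2_eq_square)
      finally show ?thesis using *(3)[OF Nm] by linarith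
    qed
    moreover have "\<exists>n\<in>{1..k}. exp (\<alpha> * real n) * d y z \<le> d ((f ^^ n) y) ((f ^^ n) z)"
    proof (cases "w = 0")
      case True
      then have "d y z = 0" using *(1)[OF Nm] d_nonneg[of y z] by simp
      then show ?thesis using k d_nonneg by (intro bexI[of _ 1]) simp_all
    next
      case False
      from low[OF this] obtain n where n: "n \<in> {1..k}"
        "2 * ?K\<^sup>2 * exp (\<alpha> * real n) * tn x w \<le> tn ((f ^^ n) x) (Df n x w)" by (elim bexE)
      have nm: "n \<in> {1..m}" using n(1) by (auto simp: m_def)
      have "e n * tn x w \<le> ?K\<^sup>2 * exp (\<alpha> * real n) * tn x w"
        by (intro mult_right_mono) (simp_all add: e_def)
      then have "?K\<^sup>2 * exp (\<alpha> * real n) * tn x w \<le> ?K * d ((f ^^ n) y) ((f ^^ n) z)"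
        using n(2) *(4)[OF nm] by linarith
      then have "?K * (?K * exp (\<alpha> * real n) * tn x w) \<le> ?K * d ((f ^^ n) y) ((f ^^ n) z)"
        by (simp add: power2_eq_square mult.assoc)
      then have a: "?K * exp (\<alpha> * real n) * tn x w \<le> d ((f ^^ n) y) ((f ^^ n) z)"
        using K by simp
      have "exp (\<alpha> * real n) * d y z \<le> exp (\<alpha> * real n) * (?K * tn x w)"
        using *(1)[OF nm] by (intro mult_left_mono) simp_all
      also have "\<dots> = ?K * exp (\<alpha> * real n) * tn x w" by (simp add: mult_ac)
      finally show ?thesis using n(1) a by (intro bexI[of _ n]) linarith+
    qed
    moreover have "k \<le> l" "N \<le> l" by (simp_all add: l_def m_def)
    ultimately show ?thesis unfolding growth_pair_def using N
      by (meson atLeastAtMost_iff order_trans)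
  qed
  have "x \<in> growth_set \<alpha> \<beta> l"
    unfolding growth_set_def
  proof (intro CollectI conjI ballI impI x)
    fix y z assume "y \<in> J" "z \<in> J" "d x y < 1 / real (Suc l) \<and> d x z < 1 / real (Suc l)"
    then have "y \<in> V" "z \<in> V" using r(2) rl by auto
    then show "growth_pair \<alpha> \<beta> l y z" by (rule pair)
  qed
  then show ?thesis by (rule exI)
qed

text \<open>Uniform expansion keeps the arguments of \<open>ln\<close> in the Lyapunov exponents
  positive, so that \<open>exp\<close> undoes the logarithm.\<close>

lemma Df_pos:
  assumes x: "x \<in> J" and n: "1 \<le> n" and v: "v \<noteq> 0" shows "0 < tn ((f ^^ n) x) (Df n x v)"
proof -
  obtain \<kappa> c where \<kappa>: "1 < \<kappa>" "0 < c" "\<forall>x\<in>J. \<forall>v. \<forall>n\<ge>1. c * \<kappa> ^ n * tn x v \<le> tn ((f ^^ n) x) (Df n x v)"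
    using rep unfolding repeller_def by (elim exE conjE)
  have "0 < c * \<kappa> ^ n * tn x v" using \<kappa> tn_pos[OF v] by simp
  also have "\<dots> \<le> tn ((f ^^ n) x) (Df n x v)" using \<kappa>(3) x n by blast
  finally show ?thesis .
qed

lemma exponent_upper:
  assumes x: "x \<in> J" and v: "v \<noteq> 0" and L: "l < \<gamma>"
    and lim: "(\<lambda>n. ln (tn ((f ^^ n) x) (Df n x v)) / real n) \<longlonglongrightarrow> l"
  shows "\<forall>\<^sub>F n in sequentially. tn ((f ^^ n) x) (Df n x v) < exp (\<gamma> * real n)"
  using order_tendstoD(2)[OF lim L] eventually_ge_at_top[of 1]
proof eventually_elim
  case (elim n)
  then have "ln (tn ((f ^^ n) x) (Df n x v)) < \<gamma> * real n" by (simp add: pos_divide_less_eq)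
  then have "exp (ln (tn ((f ^^ n) x) (Df n x v))) < exp (\<gamma> * real n)" by simp
  then show ?case using Df_pos[OF x elim(2) v] by simp
qed

lemma exponent_lower:
  assumes x: "x \<in> J" and v: "v \<noteq> 0" and L: "\<gamma> < l"
    and lim: "(\<lambda>n. ln (tn ((f ^^ n) x) (Df n x v)) / real n) \<longlonglongrightarrow> l"
  shows "\<forall>\<^sub>F n in sequentially. exp (\<gamma> * real n) < tn ((f ^^ n) x) (Df n x v)"
  using order_tendstoD(1)[OF lim L] eventually_ge_at_top[of 1]
proof eventually_elim
  case (elim n)
  then have "\<gamma> * real n < ln (tn ((f ^^ n) x) (Df n x v))" by (simp add: pos_less_divide_eq)
  then have "exp (\<gamma> * real n) < exp (ln (tn ((f ^^ n) x) (Df n x v)))" by simp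
  then show ?case using Df_pos[OF x elim(2) v] by simp
qed

text \<open>Vectors growing at most like exp (\<gamma> n) form a subspace, which contains those of
  exponent at most \<open>L\<close>, and these span. So all basis vectors obey such a bound, and by
  linearity one time \<open>N\<close> serves all directions. The gap between \<open>\<gamma>\<close>
  and \<open>\<beta>\<close> absorbs \<open>M\<close> and the constants of the basis
  expansion.\<close>

lemma uniform_upper_growth:
  assumes x: "x \<in> J"
    and lim: "\<And>v. v \<noteq> 0 \<Longrightarrow> (\<lambda>n. ln (tn ((f ^^ n) x) (Df n x v)) / real n) \<longlonglongrightarrow> ell v"
    and span: "span {v. v = 0 \<or> ell v \<le> L} = UNIV" and L: "L < \<beta>"
  shows "\<exists>N\<ge>1. \<forall>v. M * tn ((f ^^ N) x) (Df N x v) \<le> exp (\<beta> * real N) * tn x v"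
proof -
  define \<gamma> where "\<gamma> = (L + \<beta>) / 2"
  have \<gamma>: "L < \<gamma>" "\<gamma> < \<beta>" using L by (simp_all add: \<gamma>_def)
  let ?T = "\<lambda>n v. tn ((f ^^ n) x) (Df n x v)"
  define S where "S = {v. \<exists>B. \<forall>\<^sub>F n in sequentially. ?T n v \<le> B * exp (\<gamma> * real n)}"
  have "subspace S"
  proof (rule subspaceI)
    have "?T n 0 \<le> 0 * exp (\<gamma> * real n)" for n by (simp add: linear_0[OF Df_linear])
    then show "0 \<in> S" unfolding S_def by (intro CollectI exI[of _ 0]) simp
  next
    fix v w assume "v \<in> S" "w \<in> S"
    then obtain B B' where B: "\<forall>\<^sub>F n in sequentially. ?T n v \<le> B * exp (\<gamma> * real n)"
      "\<forall>\<^sub>F n in sequentially. ?T n w \<le> B' * exp (\<gamma> * real n)" unfolding S_def by blast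
    from B have "\<forall>\<^sub>F n in sequentially. ?T n (v + w) \<le> (B + B') * exp (\<gamma> * real n)"
    proof eventually_elim
      case (elim n)
      then show ?case using tn_triangle[of "(f ^^ n) x" "Df n x v" "Df n x w"]
        by (simp add: linear_add[OF Df_linear] distrib_right)
    qed
    then show "v + w \<in> S" unfolding S_def by blast
  next
    fix r :: real and v assume "v \<in> S"
    then obtain B where B: "\<forall>\<^sub>F n in sequentially. ?T n v \<le> B * exp (\<gamma> * real n)" unfolding S_def by blast
    then have "\<forall>\<^sub>F n in sequentially. ?T n (r *\<^sub>R v) \<le> (\<bar>r\<bar> * B) * exp (\<gamma> * real n)"
    proof eventually_elim
      case (elim n)
      then show ?case using mult_left_mono[OF elim, of "\<bar>r\<bar>"]
        by (simp add: linear_scale[OF Df_linear] tn_scale mult.assoc)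
    qed
    then show "r *\<^sub>R v \<in> S" unfolding S_def by blast
  qed
  moreover have "{v. v = 0 \<or> ell v \<le> L} \<subseteq> S"
  proof
    fix v assume v: "v \<in> {v. v = 0 \<or> ell v \<le> L}"
    show "v \<in> S"
    proof (cases "v = 0")
      case True
      then show ?thesis using subspace_0[OF \<open>subspace S\<close>] by simp
    next
      case False
      then have "ell v < \<gamma>" using v \<gamma> by simp
      from exponent_upper[OF x False this lim[OF False]]
      have "\<forall>\<^sub>F n in sequentially. ?T n v \<le> 1 * exp (\<gamma> * real n)"
        by eventually_elim simp
      then show ?thesis unfolding S_def by blast
    qed
  qed
  ultimately have "span {v. v = 0 \<or> ell v \<le> L} \<subseteq> S" by (intro span_minimal)
  then have all: "\<forall>i. \<exists>B. \<forall>\<^sub>F n in sequentially. ?T n i \<le> B * exp (\<gamma> * real n)"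
    unfolding span S_def by blast
  from choice[OF all] obtain B where B: "\<forall>i. \<forall>\<^sub>F n in sequentially. ?T n i \<le> B i * exp (\<gamma> * real n)"
    by (elim exE)
  define S' where "S' = (\<Sum>i\<in>(Basis :: 'b set). \<bar>B i\<bar>)"
  obtain B' where B': "0 < B'" "\<And>v. norm v \<le> B' * tn x v" using tn_lower by blast
  have "\<forall>\<^sub>F n in sequentially. \<forall>i\<in>Basis. ?T n i \<le> B i * exp (\<gamma> * real n)"
    using B by (intro eventually_ball_finite) auto
  moreover have "\<forall>\<^sub>F n in sequentially. \<bar>M\<bar> * S' * B' * exp (- (\<beta> - \<gamma>) * real n) < 1"
    by (rule order_tendstoD(2)[OF tendsto_exp_decay]) (use \<gamma> in simp_all)
  ultimately have "\<forall>\<^sub>F n in sequentially. (\<forall>i\<in>Basis. ?T n i \<le> B i * exp (\<gamma> * real n)) \<and>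
      \<bar>M\<bar> * S' * B' * exp (- (\<beta> - \<gamma>) * real n) < 1 \<and> 1 \<le> n"
    using eventually_ge_at_top[of 1] by eventually_elim blast
  then obtain N where N: "\<And>i. i \<in> Basis \<Longrightarrow> ?T N i \<le> B i * exp (\<gamma> * real N)"
      "\<bar>M\<bar> * S' * B' * exp (- (\<beta> - \<gamma>) * real N) < 1" "1 \<le> N"
    unfolding eventually_sequentially by (metis order_refl)
  have "M * ?T N v \<le> exp (\<beta> * real N) * tn x v" for v
  proof -
    have "Df N x v = Df N x (\<Sum>i\<in>Basis. (v \<bullet> i) *\<^sub>R i)" by (simp add: euclidean_representation)
    also have "\<dots> = (\<Sum>i\<in>Basis. (v \<bullet> i) *\<^sub>R Df N x i)"
      by (simp add: linear_sum[OF Df_linear] linear_scale[OF Df_linear])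
    finally have "?T N v \<le> (\<Sum>i\<in>Basis. tn ((f ^^ N) x) ((v \<bullet> i) *\<^sub>R Df N x i))"
      using tn_sum[of Basis "(f ^^ N) x" "\<lambda>i. (v \<bullet> i) *\<^sub>R Df N x i"] by simp
    also have "\<dots> \<le> (\<Sum>i\<in>(Basis :: 'b set). norm v * (\<bar>B i\<bar> * exp (\<gamma> * real N)))"
    proof (intro sum_mono)
      fix i :: 'b assume i: "i \<in> Basis"
      have "B i * exp (\<gamma> * real N) \<le> \<bar>B i\<bar> * exp (\<gamma> * real N)" by (intro mult_right_mono) simp_all
      then have "?T N i \<le> \<bar>B i\<bar> * exp (\<gamma> * real N)" using N(1)[OF i] by linarith
      then show "tn ((f ^^ N) x) ((v \<bullet> i) *\<^sub>R Df N x i) \<le> norm v * (\<bar>B i\<bar> * exp (\<gamma> * real N))"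
        unfolding tn_scale using Basis_le_norm[OF i, of v] by (intro mult_mono) simp_all
    qed
    also have "\<dots> = norm v * S' * exp (\<gamma> * real N)"
      by (simp add: S'_def sum_distrib_left sum_distrib_right mult.assoc)
    finally have T: "?T N v \<le> norm v * S' * exp (\<gamma> * real N)" .
    have S0: "0 \<le> S'" by (simp add: S'_def sum_nonneg)
    have "M * ?T N v \<le> \<bar>M\<bar> * ?T N v" by (intro mult_right_mono) simp_all
    also have "\<dots> \<le> \<bar>M\<bar> * (B' * tn x v * S' * exp (\<gamma> * real N))"
      by (intro mult_left_mono order_trans[OF T] mult_right_mono B'(2)) (use S0 in simp_all)
    also have "\<dots> = (\<bar>M\<bar> * S' * B' * exp (- (\<beta> - \<gamma>) * real N)) * (exp (\<beta> * real N) * tn x v)"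
    proof -
      have "exp (\<gamma> * real N) = exp (- (\<beta> - \<gamma>) * real N) * exp (\<beta> * real N)"
        by (simp add: exp_add[symmetric] algebra_simps)
      then show ?thesis by simp
    qed
    also have "\<dots> \<le> 1 * (exp (\<beta> * real N) * tn x v)"
      using N(2) by (intro mult_right_mono) simp_all
    finally show ?thesis by simp
  qed
  then show ?thesis using N(3) by blast
qed

text \<open>For each direction some time gives the right growth; compactness of the unit sphere bounds
  these times, so the regularity part of the multiplicative ergodic theorem is not needed.\<close>

lemma uniform_lower_growth:
  assumes x: "x \<in> J"
    and lim: "\<And>v. v \<noteq> 0 \<Longrightarrow> (\<lambda>n. ln (tn ((f ^^ n) x) (Df n x v)) / real n) \<longlonglongrightarrow> ell v"
    and L: "\<And>v. v \<noteq> 0 \<Longrightarrow> \<alpha> < ell v"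
  shows "\<exists>k\<ge>1. \<forall>v. v \<noteq> 0 \<longrightarrow> (\<exists>n\<in>{1..k}. M * exp (\<alpha> * real n) * tn x v \<le> tn ((f ^^ n) x) (Df n x v))"
proof -
  let ?T = "\<lambda>n v. tn ((f ^^ n) x) (Df n x v)"
  define U where "U n = {v. M * exp (\<alpha> * real n) * tn x v < ?T n v}" for n
  have op: "open (U n)" for n
    unfolding U_def
  proof (rule open_Collect_less)
    show "continuous_on UNIV (\<lambda>v. M * exp (\<alpha> * real n) * tn x v)"
      by (intro continuous_on_mult continuous_on_const tn_cont)
    show "continuous_on UNIV (?T n)"
      by (rule continuous_on_compose2[OF tn_cont[of UNIV] linear_continuous_on[OF Df_bounded_linear]]) simp
  qed
  have cov: "v \<in> (\<Union>n\<in>{1..}. U n)" if v: "v \<noteq> 0" for v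
  proof -
    \<comment> \<open>The room between \<open>\<alpha>\<close> and the exponent of \<open>v\<close>
      absorbs \<open>M\<close> and the norm of \<open>v\<close>.\<close>
    define \<gamma> where "\<gamma> = (\<alpha> + ell v) / 2"
    have \<gamma>: "\<alpha> < \<gamma>" "\<gamma> < ell v" using L[OF v] by (simp_all add: \<gamma>_def)
    have "\<forall>\<^sub>F n in sequentially. M * tn x v * exp (- (\<gamma> - \<alpha>) * real n) < 1"
      by (rule order_tendstoD(2)[OF tendsto_exp_decay]) (use \<gamma> in simp_all)
    then have "\<forall>\<^sub>F n in sequentially. v \<in> U n \<and> 1 \<le> n"
      using exponent_lower[OF x v \<gamma>(2) lim[OF v]] eventually_ge_at_top[of 1]
    proof eventually_elim
      case (elim n)
      have "exp (\<alpha> * real n) = exp (- (\<gamma> - \<alpha>) * real n) * exp (\<gamma> * real n)"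
        by (simp add: exp_add[symmetric] algebra_simps)
      then have "M * exp (\<alpha> * real n) * tn x v = (M * tn x v * exp (- (\<gamma> - \<alpha>) * real n)) * exp (\<gamma> * real n)"
        by simp
      also have "\<dots> \<le> 1 * exp (\<gamma> * real n)" using elim(1) by (intro mult_right_mono) simp_all
      also have "\<dots> < ?T n v" using elim(2) by simp
      finally show ?case using elim(3) by (simp add: U_def)
    qed
    then obtain n where "v \<in> U n" "1 \<le> n" unfolding eventually_sequentially by blast
    then show ?thesis by auto
  qed
  have "sphere 0 1 \<subseteq> (\<Union>n\<in>{1..}. U n)"
  proof
    fix v :: 'b assume "v \<in> sphere 0 1"
    then have "v \<noteq> 0" by auto
    then show "v \<in> (\<Union>n\<in>{1..}. U n)" by (rule cov)
  qed
  then obtain F where F: "F \<subseteq> {1..}" "finite F" "sphere 0 1 \<subseteq> (\<Union>n\<in>F. U n)"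
    by (rule compactE_image[OF compact_sphere op])
  define k where "k = Max (insert 1 F)"
  have "\<exists>n\<in>{1..k}. M * exp (\<alpha> * real n) * tn x v \<le> ?T n v" if v: "v \<noteq> 0" for v
  proof -
    define u where "u = v /\<^sub>R norm v"
    have vu: "v = norm v *\<^sub>R u" using v by (simp add: u_def)
    have "u \<in> sphere 0 1" using v by (simp add: u_def)
    then obtain n where n: "n \<in> F" "u \<in> U n" using F(3) by blast
    have "norm v * (M * exp (\<alpha> * real n) * tn x u) \<le> norm v * ?T n u"
      using n(2) by (intro mult_left_mono) (simp_all add: U_def)
    moreover have "tn x v = norm v * tn x u"
      using tn_scale[of x "norm v" u] unfolding vu[symmetric] by simp
    moreover have "?T n v = norm v * ?T n u"
      using tn_scale[of "(f ^^ n) x" "norm v" "Df n x u"] linear_scale[OF Df_linear, of n x "norm v" u]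
      unfolding vu[symmetric] by simp
    ultimately have "M * exp (\<alpha> * real n) * tn x v \<le> ?T n v" by (simp add: mult_ac)
    moreover have "n \<in> {1..k}" unfolding k_def using n(1) F by (auto intro!: Max_ge)
    ultimately show ?thesis by blast
  qed
  moreover have "1 \<le> k" unfolding k_def using F(2) by (intro Max_ge) auto
  ultimately show ?thesis by blast
qed

text \<open>Equality of the exponents makes the filtration trivial: its dimension is full at t = l
  1, so the vectors of exponent at most \<open>l 1\<close> span, and it is 0 at t = \<alpha>, so
  every nonzero vector has exponent above \<open>\<alpha>\<close>.\<close>

lemma growth_of_exponents:
  assumes L: "lyapunov_exponents A g f \<nu> l" and eq: "\<forall>i\<in>{1..DIM('b)}. l i = l 1"
    and \<nu>J: "AE x in \<nu>. x \<in> J" and ab: "\<alpha> < l 1" "l 1 < \<beta>"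
  shows "AE x in \<nu>. \<exists>k. x \<in> growth_set \<alpha> \<beta> k"
proof -
  have "AE x in \<nu>. \<exists>ell :: 'b \<Rightarrow> real.
        (\<forall>v. v \<noteq> 0 \<longrightarrow> (\<lambda>n. ln (tn ((f ^^ n) x) (Df n x v)) / real n) \<longlonglongrightarrow> ell v) \<and>
        (\<forall>t. dim {v. v = 0 \<or> ell v \<le> t} = card {i \<in> {1..DIM('b)}. l i \<le> t})"
    using L unfolding lyapunov_exponents_def by (rule conjunct2)
  then show ?thesis using \<nu>J
  proof eventually_elim
    case (elim x)
    note x = elim(2)
    obtain ell :: "'b \<Rightarrow> real" where ell:
        "\<forall>v. v \<noteq> 0 \<longrightarrow> (\<lambda>n. ln (tn ((f ^^ n) x) (Df n x v)) / real n) \<longlonglongrightarrow> ell v"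
        "\<forall>t. dim {v. v = 0 \<or> ell v \<le> t} = card {i \<in> {1..DIM('b)}. l i \<le> t}"
      using elim(1) by (elim exE conjE)
    have lim: "\<And>v. v \<noteq> 0 \<Longrightarrow> (\<lambda>n. ln (tn ((f ^^ n) x) (Df n x v)) / real n) \<longlonglongrightarrow> ell v"
      using ell(1) by blast
    have le: "l i \<le> l 1" "\<not> l i \<le> \<alpha>" if "i \<in> {1..DIM('b)}" for i
      using bspec[OF eq that] ab(1) by linarith+
    have "{i \<in> {1..DIM('b)}. l i \<le> l 1} = {1..DIM('b)}" using le(1) by blast
    then have "dim {v. v = 0 \<or> ell v \<le> l 1} = DIM('b)" using ell(2) by simp
    then have span: "span {v. v = 0 \<or> ell v \<le> l 1} = UNIV" by (simp add: dim_eq_full)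
    have low: "\<alpha> < ell v" if v: "v \<noteq> 0" for v
    proof (rule ccontr)
      assume "\<not> \<alpha> < ell v"
      then have mem: "v \<in> {v. v = 0 \<or> ell v \<le> \<alpha>}" by simp
      have "{i \<in> {1..DIM('b)}. l i \<le> \<alpha>} = {}" using le(2) by blast
      then have "dim {v. v = 0 \<or> ell v \<le> \<alpha>} = 0" using spec[OF ell(2), of \<alpha>] by simp
      then have "{v. v = 0 \<or> ell v \<le> \<alpha>} \<subseteq> {0}" by (simp only: dim_eq_0)
      with mem v show False by blast
    qed
    obtain N where N: "1 \<le> N" "\<forall>v. 2 * compare_const\<^sup>2 * tn ((f ^^ N) x) (Df N x v) \<le> exp (\<beta> * real N) * tn x v"
      using uniform_upper_growth[OF x lim span ab(2)] by blast
    obtain k where k: "1 \<le> k" "\<forall>v. v \<noteq> 0 \<longrightarrow> (\<exists>n\<in>{1..k}. 2 * compare_const\<^sup>2 * exp (\<alpha> * real n) * tn x v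
        \<le> tn ((f ^^ n) x) (Df n x v))"
      using uniform_lower_growth[OF x lim low] by blast
    show ?case
      by (rule growth_set_local[OF x N(1) _ _ k(1)]) (use N(2) k(2) in blast)+
  qed
qed

end

section \<open>The Riemannian distance in charts\<close>

lemma nn_integral_norm_deriv_ge:
  fixes h :: "real \<Rightarrow> 'b::euclidean_space"
  assumes T: "0 \<le> T" and S: "finite S" and h: "continuous_on {0..T} h"
    and D: "continuous_on ({0..T} - S) D" "\<And>t. t \<in> {0..T} - S \<Longrightarrow> (h has_vector_derivative D t) (at t)"
  shows "ennreal (norm (h T - h 0)) \<le> (\<integral>\<^sup>+t\<in>{0..T} - S. ennreal (norm (D t)) \<partial>lborel)"
proof -
  let ?E = "{0..T} - S"
  define k where "k t = indicator ?E t *\<^sub>R D t" for t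
  have E: "?E \<in> sets borel" using S by (intro sets.Diff) (auto intro: finite_imp_closed borel_closed)
  have k: "k \<in> borel_measurable lborel"
    unfolding k_def using borel_measurable_continuous_on_indicator[OF E D(1)] by simp
  have eq: "(\<integral>\<^sup>+t\<in>?E. ennreal (norm (D t)) \<partial>lborel) = (\<integral>\<^sup>+t. ennreal (norm (k t)) \<partial>lborel)"
    by (intro nn_integral_cong) (simp add: k_def indicator_def)
  \<comment> \<open>\<open>D\<close> may be unbounded near \<open>S\<close>. If its norm has
    infinite integral, the claim is trivial; otherwise the Lebesgue integral agrees with the gauge
    integral of the fundamental theorem.\<close>
  show ?thesis
  proof (cases "(\<integral>\<^sup>+t. ennreal (norm (k t)) \<partial>lborel) = \<infinity>")
    case True
    then show ?thesis unfolding eq by simp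
  next
    case False
    then have int: "integrable lborel k"
      by (intro integrableI_bounded k) (simp add: less_top)
    have "(D has_integral (h T - h 0)) {0..T}"
    proof (rule fundamental_theorem_of_calculus_interior_strong[OF S T])
      fix t assume "t \<in> {0<..<T} - S"
      then show "(h has_vector_derivative D t) (at t)" by (intro D(2)) auto
    qed (rule h)
    then have "(k has_integral (h T - h 0)) {0..T}"
      by (rule has_integral_spike_finite[OF S, rotated]) (simp add: k_def)
    then have "(k has_integral (h T - h 0)) UNIV"
      by (rule has_integral_on_superset) (auto simp: k_def)
    moreover have "(k has_integral (LINT t|lborel. k t)) UNIV"
      by (rule has_integral_integral_lborel[OF int])
    ultimately have "h T - h 0 = (LINT t|lborel. k t)" by (rule has_integral_unique)
    then have "norm (h T - h 0) \<le> (LINT t|lborel. norm (k t))"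
      by (simp add: integral_norm_bound)
    then have "ennreal (norm (h T - h 0)) \<le> ennreal (LINT t|lborel. norm (k t))" by (rule ennreal_leI)
    also have "\<dots> = (\<integral>\<^sup>+t. ennreal (norm (k t)) \<partial>lborel)"
      by (rule nn_integral_eq_integral[symmetric]) (use int in auto)
    finally show ?thesis unfolding eq .
  qed
qed

lemma has_vector_derivative_compose:
  assumes "(h has_vector_derivative D) (at t)" "(F has_derivative L) (at (h t))"
  shows "(F \<circ> h has_vector_derivative L D) (at t)"
  by (rule vector_derivative_diff_chain_within[OF assms(1) has_derivative_at_withinI[OF assms(2)]])

context riemannian_manifold begin

lemma local_rep_C1:
  assumes "c \<in> A" "c' \<in> A"
  shows "Ck_on 1 (snd c ` (fst c \<inter> fst c')) (local_rep c c' id)"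
  using atlas assms by (simp add: smooth_atlas_def smooth_on_def del: Ck_on.simps)

lemma from_chart_has_derivative:
  assumes "c \<in> A" "p \<in> fst c"
  shows "(local_rep c (chart_at A p) id has_derivative from_chart A c p) (at (snd c p))"
  by (rule chart_deriv_imp_derivative[OF chart[OF assms(1)] from_chart_deriv[OF assms]])

text \<open>Segments in a chart are the test curves for the upper bound of the distance. Their
  velocity, read in the preferred chart of the moving point, comes from the constant vector
  \<open>b - a\<close>.\<close>

lemma segment_length:
  assumes c: "c \<in> A" and sub: "closed_segment a b \<subseteq> snd c ` fst c"
  defines "\<gamma> \<equiv> \<lambda>t. inv_into (fst c) (snd c) (a + t *\<^sub>R (b - a))"
  shows "piecewise_C1_curve A \<gamma>"
    and "t \<in> {0..1} \<Longrightarrow> \<gamma> t \<in> fst c \<and> snd c (\<gamma> t) = a + t *\<^sub>R (b - a) \<and>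
      velocity A \<gamma> t = from_chart A c (\<gamma> t) (b - a)"
proof -
  have ch: "is_chart c" by (rule chart[OF c])
  let ?l = "\<lambda>t. a + t *\<^sub>R (b - a)"
  have l: "?l t \<in> snd c ` fst c" if "t \<in> {0..1}" for t
  proof -
    have "?l t \<in> closed_segment a b"
      unfolding closed_segment_def using that by (intro CollectI exI[of _ t]) (simp add: algebra_simps)
    then show ?thesis using sub by blast
  qed
  have \<gamma>: "\<gamma> t \<in> fst c" "snd c (\<gamma> t) = ?l t" if "t \<in> {0..1}" for t
    unfolding \<gamma>_def using inv_into_into[OF l[OF that]] f_inv_into_f[OF l[OF that]] by blast+
  have l_deriv: "(?l has_vector_derivative (b - a)) (at t)" for t
    by (auto intro!: derivative_eq_intros simp: has_vector_derivative_def)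
  have rep: "snd c' \<circ> \<gamma> = local_rep c c' id \<circ> ?l" for c'
    by (simp add: \<gamma>_def local_rep_def fun_eq_iff)
  have deriv: "(snd c' \<circ> \<gamma> has_vector_derivative
      frechet_derivative (local_rep c c' id) (at (?l t)) (b - a)) (at t)"
    if c': "c' \<in> A" and t: "t \<in> {0..1}" "\<gamma> t \<in> fst c'" for c' t
  proof -
    have "?l t \<in> snd c ` (fst c \<inter> fst c')" using \<gamma>[OF t(1)] t(2) by (metis IntI imageI)
    then have "local_rep c c' id differentiable (at (?l t))"
      using local_rep_C1[OF c c'] by (metis One_nat_def Ck_on.simps(2))
    then have "(local_rep c c' id has_derivative frechet_derivative (local_rep c c' id) (at (?l t))) (at (?l t))"
      by (simp add: frechet_derivative_works)
    then show ?thesis unfolding rep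
      by (rule has_vector_derivative_compose[OF l_deriv])
  qed
  show "piecewise_C1_curve A \<gamma>"
    unfolding piecewise_C1_curve_def
  proof (intro conjI ballI allI impI)
    show "path \<gamma>" unfolding path_def \<gamma>_def
      by (rule continuous_on_compose2[OF chart_inv_cont[OF ch]]) (use l in \<open>auto intro!: continuous_on_add continuous_on_scaleR continuous_on_id continuous_on_const\<close>)
  next
    fix c' s e assume c': "c' \<in> A" and se: "0 \<le> s \<and> s \<le> e \<and> e \<le> 1 \<and> \<gamma> ` {s..e} \<subseteq> fst c'"
    have t: "t \<in> {0..1}" "\<gamma> t \<in> fst c'" if "t \<in> {s..e}" for t
      using se that by auto
    have mem: "?l t \<in> snd c ` (fst c \<inter> fst c')" if "t \<in> {s..e}" for t
      using \<gamma>[OF t(1)[OF that]] t(2)[OF that] by (metis IntI imageI)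
    have "continuous_on (snd c ` (fst c \<inter> fst c')) (\<lambda>y. frechet_derivative (local_rep c c' id) (at y) (b - a))"
      using local_rep_C1[OF c c'] by simp
    then have "continuous_on {s..e} (\<lambda>t. frechet_derivative (local_rep c c' id) (at (?l t)) (b - a))"
      by (rule continuous_on_compose2) (use mem in \<open>auto intro!: continuous_intros\<close>)
    then have "snd c' \<circ> \<gamma> C1_differentiable_on {s..e}"
      unfolding C1_differentiable_on_def
      by (intro exI[of _ "\<lambda>t. frechet_derivative (local_rep c c' id) (at (?l t)) (b - a)"] conjI ballI deriv[OF c' t])
    then show "snd c' \<circ> \<gamma> piecewise_C1_differentiable_on {s..e}"
      by (rule C1_differentiable_imp_piecewise)
  qed
  assume t: "t \<in> {0..1}"
  have "velocity A \<gamma> t = frechet_derivative (local_rep c (chart_at A (\<gamma> t)) id) (at (?l t)) (b - a)"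
    unfolding velocity_def by (rule vector_derivative_at[OF deriv[OF chart_at(1) t chart_at(2)]])
  then show "\<gamma> t \<in> fst c \<and> snd c (\<gamma> t) = ?l t \<and> velocity A \<gamma> t = from_chart A c (\<gamma> t) (b - a)"
    using \<gamma>[OF t] by (simp add: from_chart_def)
qed

lemma riemannian_dist_upper:
  assumes c: "c \<in> A" and xy: "x \<in> fst c" "y \<in> fst c"
    and seg: "closed_segment (snd c x) (snd c y) \<subseteq> snd c ` W" "W \<subseteq> fst c"
    and bound: "\<And>z v. z \<in> W \<Longrightarrow> tn z (from_chart A c z v) \<le> K * norm v"
  shows "riemannian_dist A g x y \<le> ennreal (K * norm (snd c x - snd c y))"
proof -
  have ch: "is_chart c" by (rule chart[OF c])
  define a b where "a = snd c x" and "b = snd c y"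
  define \<gamma> where "\<gamma> t = inv_into (fst c) (snd c) (a + t *\<^sub>R (b - a))" for t
  have sub: "closed_segment a b \<subseteq> snd c ` fst c" using seg unfolding a_def b_def by blast
  note seg_len = segment_length[OF c sub, folded \<gamma>_def]
  have start: "pathstart \<gamma> = x" "pathfinish \<gamma> = y"
    using xy by (simp_all add: pathstart_def pathfinish_def \<gamma>_def a_def b_def chart_inv[OF ch])
  have inW: "\<gamma> t \<in> W" if "t \<in> {0..1}" for t
  proof -
    have "a + t *\<^sub>R (b - a) \<in> closed_segment a b"
      unfolding closed_segment_def using that by (intro CollectI exI[of _ t]) (simp add: algebra_simps)
    then obtain z where z: "z \<in> W" "a + t *\<^sub>R (b - a) = snd c z" using seg(1) unfolding a_def b_def by blast
    then have "\<gamma> t = z" unfolding \<gamma>_def using seg(2) by (simp add: chart_inv[OF ch] subset_iff)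
    with z show ?thesis by simp
  qed
  have "riemannian_dist A g x y \<le> curve_length A g \<gamma>"
    unfolding riemannian_dist_def using seg_len(1) start by (intro Inf_lower) blast
  also have "\<dots> \<le> (\<integral>\<^sup>+t\<in>{0..1}. ennreal (K * norm (b - a)) \<partial>(lborel :: real measure))"
    unfolding curve_length_def
  proof (rule nn_integral_mono)
    fix t :: real
    show "ennreal (tn (\<gamma> t) (velocity A \<gamma> t)) * indicator {0..1} t \<le> ennreal (K * norm (b - a)) * indicator {0..1} t"
    proof (cases "t \<in> {0..1}")
      case True
      then have "tn (\<gamma> t) (velocity A \<gamma> t) \<le> K * norm (b - a)"
        using seg_len(2)[OF True] bound[OF inW[OF True]] by simp
      then show ?thesis by (intro mult_right_mono ennreal_leI) simp_all
    qed simp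
  qed
  also have "\<dots> = ennreal (K * norm (b - a))"
    by (simp add: nn_integral_cmult_indicator)
  finally show ?thesis by (simp add: a_def b_def norm_minus_commute)
qed

text \<open>An initial arc is no longer than the whole curve, so only the arc has to lie in the
  chart. There the displacement is at most the integral of the Euclidean speed, which is at most
  \<open>K\<close> times the Riemannian speed.\<close>

lemma curve_length_lower:
  assumes c: "c \<in> A" and \<gamma>: "piecewise_C1_curve A \<gamma>" and T: "0 \<le> T" "T \<le> 1"
    and sub: "\<gamma> ` {0..T} \<subseteq> W" "W \<subseteq> fst c" and K: "0 < K"
    and bound: "\<And>z v. z \<in> W \<Longrightarrow> norm v \<le> K * tn z (from_chart A c z v)"
  shows "ennreal (norm (snd c (\<gamma> T) - snd c (\<gamma> 0)) / K) \<le> curve_length A g \<gamma>"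
proof -
  have ch: "is_chart c" by (rule chart[OF c])
  define h where "h = snd c \<circ> \<gamma>"
  have "\<gamma> ` {0..T} \<subseteq> fst c" using sub by blast
  then have "h piecewise_C1_differentiable_on {0..T}"
    using \<gamma> c T unfolding piecewise_C1_curve_def h_def by blast
  then obtain S where S: "finite S" "continuous_on {0..T} h" "h C1_differentiable_on ({0..T} - S)"
    unfolding piecewise_C1_differentiable_on_def by blast
  then obtain D where D: "\<And>t. t \<in> {0..T} - S \<Longrightarrow> (h has_vector_derivative D t) (at t)" "continuous_on ({0..T} - S) D"
    unfolding C1_differentiable_on_def by blast
  \<comment> \<open>\<open>velocity\<close> is a two-sided derivative, and the curve may leave the
    chart right after \<open>T\<close>, so the end points are discarded.\<close>
  define S' where "S' = S \<union> {0, T}"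
  have le: "norm (D t) \<le> K * tn (\<gamma> t) (velocity A \<gamma> t)" if t: "t \<in> {0..T} - S'" for t
  proof -
    have t': "t \<in> {0..T}" "t \<in> {0<..<T}" "t \<in> {0..T} - S" using t by (auto simp: S'_def)
    have \<gamma>t: "\<gamma> t \<in> W" "\<gamma> t \<in> fst c" using sub t'(1) by blast+
    let ?c = "chart_at A (\<gamma> t)"
    have 1: "(local_rep c ?c id has_derivative from_chart A c (\<gamma> t)) (at (h t))"
      using from_chart_has_derivative[OF c \<gamma>t(2)] by (simp add: h_def)
    have "(local_rep c ?c id \<circ> h has_vector_derivative from_chart A c (\<gamma> t) (D t)) (at t)"
      by (rule has_vector_derivative_compose[OF D(1)[OF t'(3)] 1])
    then have "(snd ?c \<circ> \<gamma> has_vector_derivative from_chart A c (\<gamma> t) (D t)) (at t)"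
    proof (rule has_vector_derivative_transform_within_open[OF _ open_greaterThanLessThan t'(2)])
      fix s assume "s \<in> {0<..<T}"
      then have "\<gamma> s \<in> fst c" using sub by (auto simp: image_subset_iff)
      then show "(local_rep c ?c id \<circ> h) s = (snd ?c \<circ> \<gamma>) s"
        by (simp add: local_rep_def h_def chart_inv[OF ch])
    qed
    then have "velocity A \<gamma> t = from_chart A c (\<gamma> t) (D t)"
      unfolding velocity_def by (rule vector_derivative_at)
    then show ?thesis using bound[OF \<gamma>t(1)] by simp
  qed
  define h' where "h' t = h t /\<^sub>R K" for t
  have h'_deriv: "(h' has_vector_derivative D t /\<^sub>R K) (at t)" if "t \<in> {0..T} - S'" for t
  proof -
    have "(h has_vector_derivative D t) (at t)" using that by (intro D(1)) (auto simp: S'_def)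
    then show ?thesis unfolding h'_def[abs_def]
      by (rule bounded_linear.has_vector_derivative[OF bounded_linear_scaleR_right])
  qed
  have "ennreal (norm (h' T - h' 0)) \<le> (\<integral>\<^sup>+t\<in>{0..T} - S'. ennreal (norm (D t /\<^sub>R K)) \<partial>lborel)"
  proof (rule nn_integral_norm_deriv_ge[OF T(1)])
    show "finite S'" using S(1) by (simp add: S'_def)
    show "continuous_on {0..T} h'" unfolding h'_def[abs_def] by (intro continuous_on_scaleR continuous_on_const S(2))
    show "continuous_on ({0..T} - S') (\<lambda>t. D t /\<^sub>R K)"
      by (intro continuous_on_scaleR continuous_on_const continuous_on_subset[OF D(2)]) (auto simp: S'_def)
  qed (rule h'_deriv)
  also have "\<dots> \<le> curve_length A g \<gamma>"
    unfolding curve_length_def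
  proof (rule nn_integral_mono)
    fix t :: real
    show "ennreal (norm (D t /\<^sub>R K)) * indicator ({0..T} - S') t \<le>
        ennreal (tn (\<gamma> t) (velocity A \<gamma> t)) * indicator {0..1} t"
    proof (cases "t \<in> {0..T} - S'")
      case True
      then have "t \<in> {0..1}" using T by auto
      moreover have "norm (D t /\<^sub>R K) \<le> tn (\<gamma> t) (velocity A \<gamma> t)"
        unfolding norm_divideR[OF K] using le[OF True] K by (simp add: pos_divide_le_eq mult.commute)
      ultimately show ?thesis using True by (simp add: ennreal_leI)
    qed simp
  qed
  also have "h' T - h' 0 = (h T - h 0) /\<^sub>R K" by (simp add: h'_def scaleR_diff_right)
  finally show ?thesis unfolding norm_divideR[OF K] by (simp add: h_def)
qed

text \<open>A curve from \<open>x\<close> to \<open>y\<close> may leave the chart, but it first has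
  to cross the ball about \<open>x\<close> whose radius is the chart distance. The arc up to the
  first exit is already long enough; it ends on the sphere, as the closed chart ball is closed in
  the manifold.\<close>

lemma riemannian_dist_lower:
  assumes c: "c \<in> A" and x: "x \<in> fst c" and y: "y \<in> fst c"
    and ball: "cball (snd c x) (norm (snd c x - snd c y)) \<subseteq> snd c ` W" "W \<subseteq> fst c" and K: "0 < K"
    and bound: "\<And>z v. z \<in> W \<Longrightarrow> norm v \<le> K * tn z (from_chart A c z v)"
  shows "ennreal (norm (snd c x - snd c y) / K) \<le> riemannian_dist A g x y"
  unfolding riemannian_dist_def
proof (rule Inf_greatest, elim CollectE exE conjE)
  have ch: "is_chart c" by (rule chart[OF c])
  fix l \<gamma> assume l: "l = curve_length A g \<gamma>" and \<gamma>: "piecewise_C1_curve A \<gamma>"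
    and start: "pathstart \<gamma> = x" "pathfinish \<gamma> = y"
  define a where "a = norm (snd c x - snd c y)"
  show "ennreal (norm (snd c x - snd c y) / K) \<le> l"
  proof (cases "a = 0")
    case True
    then show ?thesis by (simp add: a_def)
  next
    case False
    then have a: "0 < a" by (simp add: a_def)
    have "cball (snd c x) a \<subseteq> snd c ` fst c" using ball unfolding a_def by blast
    then have gr: "good_radius c x a" using c x a by (simp add: good_radius_def)
    define B where "B = fst c \<inter> snd c -` ball (snd c x) a"
    define B' where "B' = {z \<in> fst c. norm (snd c z - snd c x) \<le> a}"
    have B: "open B" unfolding B_def by (intro chart_open_vimage[OF ch] open_ball)
    have B': "closed B'" unfolding B'_def by (rule closed_chart_ball[OF gr order_refl])
    have BB': "B \<subseteq> B'" by (auto simp: B_def B'_def dist_norm norm_minus_commute)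
    have B'W: "B' \<subseteq> W"
    proof
      fix z assume z: "z \<in> B'"
      then have "snd c z \<in> cball (snd c x) a" by (auto simp: B'_def dist_norm norm_minus_commute)
      then obtain w where w: "w \<in> W" "snd c z = snd c w" using ball(1) unfolding a_def by blast
      then have "z = w" using inj_onD[OF chart_inj[OF ch] w(2)] z ball(2) by (auto simp: B'_def)
      with w show "z \<in> W" by simp
    qed
    have cont: "continuous_on {0..1} \<gamma>" using \<gamma> by (simp add: piecewise_C1_curve_def path_def)
    have \<gamma>0: "\<gamma> 0 = x" and \<gamma>1: "\<gamma> 1 = y" using start by (simp_all add: pathstart_def pathfinish_def)
    \<comment> \<open>The times spent outside the open ball form a closed set. It contains 1 because
      \<open>y\<close> lies on the sphere, so its infimum is the first exit time.\<close>
    define E where "E = {0..1} \<inter> \<gamma> -` (- B)"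
    have "closed E" unfolding E_def
      by (rule continuous_closed_preimage[OF cont]) (use B in auto)
    moreover have "1 \<in> E" using \<gamma>1 by (simp add: E_def B_def a_def dist_norm)
    moreover have bdd: "bdd_below E" unfolding E_def by (rule bdd_belowI[of _ 0]) auto
    ultimately have TE: "Inf E \<in> E" by (intro closed_contains_Inf) auto
    define T where "T = Inf E"
    have T: "0 \<le> T" "T \<le> 1" "\<gamma> T \<notin> B" using TE by (auto simp: E_def T_def)
    have "x \<in> B" using x a by (simp add: B_def)
    then have "T \<noteq> 0" using T(3) \<gamma>0 by auto
    then have T0: "0 < T" using T(1) by simp
    have before: "\<gamma> t \<in> B" if "t \<in> {0..<T}" for t
    proof (rule ccontr)
      assume "\<gamma> t \<notin> B"
      then have "t \<in> E" using that T(2) by (auto simp: E_def)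
      then have "T \<le> t" unfolding T_def by (rule cInf_lower[OF _ bdd])
      then show False using that by simp
    qed
    have cl: "closed ({0..1} \<inter> \<gamma> -` B')"
      by (rule continuous_closed_preimage[OF cont]) (use B' in auto)
    have "{0..<T} \<subseteq> {0..1} \<inter> \<gamma> -` B'"
    proof
      fix t assume t: "t \<in> {0..<T}"
      then show "t \<in> {0..1} \<inter> \<gamma> -` B'" using subsetD[OF BB' before[OF t]] T(2) by simp
    qed
    then have "closure {0..<T} \<subseteq> {0..1} \<inter> \<gamma> -` B'" using cl by (rule closure_minimal)
    then have img: "\<gamma> ` {0..T} \<subseteq> B'" using T0 by auto
    then have "\<gamma> T \<in> B'" using T(1) by auto
    then have "\<gamma> T \<in> fst c" by (simp add: B'_def)
    then have far: "a \<le> norm (snd c (\<gamma> T) - snd c (\<gamma> 0))"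
      using T(3) unfolding \<gamma>0 by (simp add: B_def dist_norm norm_minus_commute)
    have "\<gamma> ` {0..T} \<subseteq> W" using img B'W by (rule subset_trans)
    from curve_length_lower[OF c \<gamma> T(1,2) this ball(2) K bound]
    have "ennreal (norm (snd c (\<gamma> T) - snd c (\<gamma> 0)) / K) \<le> l" unfolding l .
    moreover have "ennreal (a / K) \<le> ennreal (norm (snd c (\<gamma> T) - snd c (\<gamma> 0)) / K)"
      using far K by (intro ennreal_leI divide_right_mono) simp_all
    ultimately show ?thesis unfolding a_def by (rule order_trans[rotated])
  qed
qed

lemma riemannian_dist_local:
  assumes c: "c \<in> A" and p: "p \<in> fst c"
  shows "\<exists>W K. open W \<and> p \<in> W \<and> W \<subseteq> fst c \<and> 0 < K \<and> (\<forall>x\<in>W. \<forall>y\<in>W.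
    riemannian_dist A g x y \<le> ennreal (K * norm (snd c x - snd c y)) \<and>
    ennreal (norm (snd c x - snd c y)) \<le> ennreal K * riemannian_dist A g x y)"
proof -
  have ch: "is_chart c" by (rule chart[OF c])
  from metric_bound[OF c p] obtain V K where V: "open V" "p \<in> V" "V \<subseteq> fst c" "1 \<le> K"
    "\<forall>x\<in>V. \<forall>v. norm v \<le> K * tn x (from_chart A c x v) \<and> tn x (from_chart A c x v) \<le> K * norm v"
    by (elim exE conjE)
  have "open (snd c ` V)" "snd c p \<in> snd c ` V" using chart_open_image[OF ch V(1,3)] V(2) by auto
  then obtain R where R: "0 < R" "ball (snd c p) R \<subseteq> snd c ` V" using open_contains_ball by blast
  \<comment> \<open>With a third of the radius, the ball about \<open>x\<close> through
    \<open>y\<close> stays in the region where the metric is controlled.\<close>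
  define W where "W = fst c \<inter> snd c -` ball (snd c p) (R / 3)"
  have K: "0 < K" using V(4) by simp
  have "riemannian_dist A g x y \<le> ennreal (K * norm (snd c x - snd c y)) \<and>
    ennreal (norm (snd c x - snd c y)) \<le> ennreal K * riemannian_dist A g x y"
    if xy: "x \<in> W" "y \<in> W" for x y
  proof
    have xy': "x \<in> fst c" "y \<in> fst c" "snd c x \<in> ball (snd c p) (R / 3)" "snd c y \<in> ball (snd c p) (R / 3)"
      using xy by (auto simp: W_def)
    have "closed_segment (snd c x) (snd c y) \<subseteq> ball (snd c p) (R / 3)"
      by (rule closed_segment_subset[OF xy'(3,4) convex_ball])
    also have "\<dots> \<subseteq> ball (snd c p) R" using R(1) by (intro subset_ball) simp
    finally have seg: "closed_segment (snd c x) (snd c y) \<subseteq> snd c ` V" using R(2) by blast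
    show "riemannian_dist A g x y \<le> ennreal (K * norm (snd c x - snd c y))"
      by (rule riemannian_dist_upper[OF c xy'(1,2) seg V(3)]) (use V(5) in blast)
    have "cball (snd c x) (norm (snd c x - snd c y)) \<subseteq> ball (snd c p) R"
    proof
      fix z assume "z \<in> cball (snd c x) (norm (snd c x - snd c y))"
      then have "dist (snd c x) z \<le> dist (snd c x) (snd c y)" by (simp add: dist_norm)
      then show "z \<in> ball (snd c p) R"
        using dist_triangle[of "snd c p" z "snd c x"] dist_triangle[of "snd c x" "snd c y" "snd c p"] xy'(3,4)
          dist_commute[of "snd c x" "snd c p"]
        unfolding mem_ball by linarith
    qed
    then have cb: "cball (snd c x) (norm (snd c x - snd c y)) \<subseteq> snd c ` V" using R(2) by (rule subset_trans)
    have "ennreal (norm (snd c x - snd c y) / K) \<le> riemannian_dist A g x y"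
      by (rule riemannian_dist_lower[OF c xy'(1,2) cb V(3) K]) (use V(5) in blast)
    then have "ennreal K * ennreal (norm (snd c x - snd c y) / K) \<le> ennreal K * riemannian_dist A g x y"
      by (rule mult_left_mono) simp
    then show "ennreal (norm (snd c x - snd c y)) \<le> ennreal K * riemannian_dist A g x y"
      using K by (simp add: ennreal_mult[symmetric])
  qed
  moreover have "open W" unfolding W_def by (intro chart_open_vimage[OF ch] open_ball)
  moreover have "p \<in> W" "W \<subseteq> fst c" using p R by (auto simp: W_def)
  ultimately show ?thesis using K by (intro exI[of _ W] exI[of _ K] conjI ballI) auto
qed

end

section \<open>Essential supremum\<close>

text \<open>Null sets are stable under finite unions, so by compactness a comparison on
  neighbourhoods suffices, with constants varying from place to place.\<close>

lemma hausdorff_null_local_lipschitz: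
  fixes J :: "'a::topological_space set"
  assumes J: "compact J" and Z: "Z \<subseteq> J" and s: "0 < s"
    and null: "hausdorff_outer_measure \<rho> s Z = 0"
    and loc: "\<And>p. p \<in> J \<Longrightarrow> \<exists>W K. open W \<and> p \<in> W \<and> 0 < K \<and> (\<forall>x\<in>W. \<forall>y\<in>W. \<rho>' x y \<le> ennreal K * \<rho> x y)"
  shows "hausdorff_outer_measure \<rho>' s Z = 0"
proof -
  define Q where "Q W p \<longleftrightarrow> open W \<and> p \<in> W \<and> (\<exists>K>0. \<forall>x\<in>W. \<forall>y\<in>W. \<rho>' x y \<le> ennreal K * \<rho> x y)" for W p
  have "\<forall>p\<in>J. \<exists>W. Q W p"
  proof
    fix p assume "p \<in> J"
    from loc[OF this] obtain W K where "open W" "p \<in> W" "0 < K" "\<forall>x\<in>W. \<forall>y\<in>W. \<rho>' x y \<le> ennreal K * \<rho> x y"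
      by (elim exE conjE)
    then have "Q W p" unfolding Q_def by (intro conjI exI[of _ K])
    then show "\<exists>W. Q W p" by (rule exI)
  qed
  from bchoice[OF this] obtain W where WQ: "\<forall>p\<in>J. Q (W p) p" by (elim exE)
  have W: "open (W p)" "p \<in> W p"
    "\<exists>K>0. \<forall>x\<in>W p. \<forall>y\<in>W p. \<rho>' x y \<le> ennreal K * \<rho> x y" if "p \<in> J" for p
    using bspec[OF WQ that] unfolding Q_def by simp_all
  have cov: "J \<subseteq> (\<Union>p\<in>J. W p)" using W(2) by blast
  obtain F where F: "F \<subseteq> J" "finite F" "J \<subseteq> (\<Union>p\<in>F. W p)"
    by (rule compactE_image[OF J W(1) cov])
  have "hausdorff_outer_measure \<rho>' s (Z \<inter> W p) = 0" if p: "p \<in> F" for p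
  proof -
    have "p \<in> J" using p F(1) by blast
    then obtain K where K: "0 < K" "\<forall>x\<in>W p. \<forall>y\<in>W p. \<rho>' x y \<le> ennreal K * \<rho> x y" using W(3)[OF \<open>p \<in> J\<close>] by (elim exE conjE)
    show ?thesis
    proof (rule hausdorff_null_lipschitz[OF hausdorff_null_mono[OF null Int_lower1] s K(1)])
      fix x y assume "x \<in> Z \<inter> W p" "y \<in> Z \<inter> W p"
      then show "\<rho>' x y \<le> ennreal K * \<rho> x y" using K(2) by simp
    qed
  qed
  then have "hausdorff_outer_measure \<rho>' s (\<Union>p\<in>F. Z \<inter> W p) = 0"
    by (rule hausdorff_null_UN_countable[OF countable_finite[OF F(2)]])
  moreover have "Z \<subseteq> (\<Union>p\<in>F. Z \<inter> W p)" using F(3) Z by blast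
  ultimately show ?thesis by (rule hausdorff_null_mono)
qed

text \<open>For the indicator of \<open>Z\<close> the decomposition formula writes
  \<open>measure \<mu> Z\<close> as an average of numbers at most 1; such an average is 1 exactly if
  almost all of them are.\<close>

lemma ergodic_decomposition_full_measure:
  fixes f :: "'a::topological_space \<Rightarrow> 'a"
  assumes dec: "ergodic_decomposition f J \<mu> \<tau>" and \<mu>: "\<mu> \<in> invariant_measures f J" and Z: "Z \<in> sets borel"
  shows "emeasure \<mu> Z = 1 \<longleftrightarrow> (AE \<nu> in \<tau>. \<nu> \<in> ergodic_measures f J \<longrightarrow> emeasure \<nu> Z = 1)"
proof -
  let ?E = "ergodic_measures f J"
  note dec_def = dec[unfolded ergodic_decomposition_def]
  have \<tau>: "prob_space \<tau>" "emeasure \<tau> ?E = 1"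
    using dec_def by simp_all
  have dec': "set_integrable \<tau> ?E (\<lambda>\<nu>. LINT x|\<nu>. \<psi> x) \<and>
        (LINT x|\<mu>. \<psi> x) = (LINT \<nu>:?E|\<tau>. (LINT x|\<nu>. \<psi> x))" if "integrable \<mu> \<psi>" for \<psi> :: "'a \<Rightarrow> real"
    using conjunct2[OF mp[OF spec[OF conjunct2[OF conjunct2[OF conjunct2[OF dec_def]]]] that]] .
  have inv: "prob_space \<nu> \<and> sets \<nu> = sets borel \<and> space \<nu> = UNIV" if "\<nu> \<in> invariant_measures f J" for \<nu>
  proof -
    have s: "sets \<nu> = sets borel" "prob_space \<nu>" using that by (simp_all add: invariant_measures_def)
    show ?thesis using sets_eq_imp_space_eq[OF s(1)] s by simp
  qed
  have erg: "\<nu> \<in> invariant_measures f J" if "\<nu> \<in> ?E" for \<nu> using that by (simp add: ergodic_measures_def)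
  have LINT: "(LINT x|\<nu>. indicator Z x) = measure \<nu> Z" if "\<nu> \<in> invariant_measures f J" for \<nu>
    using inv[OF that] by simp
  have one: "emeasure \<nu> Z = 1 \<longleftrightarrow> measure \<nu> Z = 1" if "\<nu> \<in> invariant_measures f J" for \<nu>
  proof -
    interpret prob_space \<nu> using inv[OF that] by simp
    show ?thesis by (simp add: emeasure_eq_measure)
  qed
  interpret M: prob_space \<mu> using inv[OF \<mu>] by simp
  interpret T: prob_space \<tau> by (rule \<tau>(1))
  \<comment> \<open>The integrand of the set integral, cut off to 0 outside the ergodic measures,
    which form a set of full measure.\<close>
  define h where "h \<nu> = indicator ?E \<nu> * measure \<nu> Z" for \<nu>
  have int_ind: "integrable \<mu> (indicator Z :: 'a \<Rightarrow> real)"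
    using Z inv[OF \<mu>] by (simp add: less_top[symmetric])
  have h_eq: "indicator ?E \<nu> *\<^sub>R (LINT x|\<nu>. indicator Z x) = h \<nu>" for \<nu>
    using LINT[OF erg] by (cases "\<nu> \<in> ?E") (simp_all add: h_def)
  have h_int: "integrable \<tau> h"
    using conjunct1[OF dec'[OF int_ind]] unfolding set_integrable_def h_eq .
  have h_val: "measure \<mu> Z = (LINT \<nu>|\<tau>. h \<nu>)"
    using conjunct2[OF dec'[OF int_ind]] unfolding set_lebesgue_integral_def h_eq LINT[OF \<mu>] .
  have h_le: "h \<nu> \<le> 1" for \<nu>
  proof (cases "\<nu> \<in> ?E")
    case True
    then interpret prob_space \<nu> using inv[OF erg] by simp
    show ?thesis using prob_le_1[of Z] by (auto simp: h_def indicator_def)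
  qed (simp add: h_def)
  have AE_E: "AE \<nu> in \<tau>. \<nu> \<in> ?E"
    by (rule T.AE_prob_1) (use \<tau>(2) in \<open>simp add: measure_def\<close>)
  have "measure \<mu> Z = 1 \<longleftrightarrow> (LINT \<nu>|\<tau>. 1 - h \<nu>) = 0"
    unfolding h_val using h_int T.prob_space by auto
  also have "\<dots> \<longleftrightarrow> (AE \<nu> in \<tau>. 1 - h \<nu> = 0)"
    by (rule integral_nonneg_eq_0_iff_AE) (use h_int h_le in auto)
  also have "\<dots> \<longleftrightarrow> (AE \<nu> in \<tau>. \<nu> \<in> ?E \<longrightarrow> emeasure \<nu> Z = 1)"
  proof
    assume "AE \<nu> in \<tau>. 1 - h \<nu> = 0"
    then show "AE \<nu> in \<tau>. \<nu> \<in> ?E \<longrightarrow> emeasure \<nu> Z = 1"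
      by eventually_elim (auto simp: h_def one[OF erg])
  next
    assume "AE \<nu> in \<tau>. \<nu> \<in> ?E \<longrightarrow> emeasure \<nu> Z = 1"
    then show "AE \<nu> in \<tau>. 1 - h \<nu> = 0" using AE_E
      by eventually_elim (auto simp: h_def one[OF erg])
  qed
  finally show ?thesis unfolding one[OF \<mu>] .
qed

lemma hausdorff_dim_measure_ge_ess_sup:
  assumes dec: "ergodic_decomposition f J \<mu> \<tau>" and \<mu>: "\<mu> \<in> invariant_measures f J"
  shows "essential_sup_on \<tau> (ergodic_measures f J) (hausdorff_dim_measure \<rho>) \<le> hausdorff_dim_measure \<rho> \<mu>"
  unfolding hausdorff_dim_measure_def[of \<rho> \<mu>]
proof (rule Inf_greatest, elim CollectE exE conjE)
  fix z Z assume z: "z = hausdorff_dim \<rho> Z" and Z: "Z \<in> sets borel" "emeasure \<mu> Z = 1"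
  have "AE \<nu> in \<tau>. \<nu> \<in> ergodic_measures f J \<longrightarrow> emeasure \<nu> Z = 1"
    using ergodic_decomposition_full_measure[OF dec \<mu> Z(1)] Z(2) by simp
  then have "AE \<nu> in \<tau>. \<nu> \<in> ergodic_measures f J \<longrightarrow> hausdorff_dim_measure \<rho> \<nu> \<le> hausdorff_dim \<rho> Z"
  proof eventually_elim
    case (elim \<nu>)
    show ?case
    proof
      assume "\<nu> \<in> ergodic_measures f J"
      then have "emeasure \<nu> Z = 1" using elim by blast
      then show "hausdorff_dim_measure \<rho> \<nu> \<le> hausdorff_dim \<rho> Z"
        unfolding hausdorff_dim_measure_def using Z(1) by (intro Inf_lower) blast
    qed
  qed
  then show "essential_sup_on \<tau> (ergodic_measures f J) (hausdorff_dim_measure \<rho>) \<le> z"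
    unfolding essential_sup_on_def z by (intro Inf_lower) simp
qed

context expanding_dynamics begin

section \<open>Comparison of the adapted metric with the Riemannian distance\<close>

lemma dist_compare:
  assumes p: "p \<in> J"
  shows "\<exists>W K. open W \<and> p \<in> W \<and> 0 < K \<and> (\<forall>x\<in>W. \<forall>y\<in>W.
    ennreal (d x y) \<le> ennreal K * riemannian_dist A g x y \<and> riemannian_dist A g x y \<le> ennreal K * ennreal (d x y))"
proof -
  obtain c W1 K1 where 1: "c \<in> A" "open W1" "p \<in> W1" "W1 \<subseteq> fst c" "0 < K1"
    "\<And>x y. x \<in> W1 \<Longrightarrow> y \<in> W1 \<Longrightarrow> d x y \<le> K1 * norm (snd c x - snd c y)"
    "\<And>x y. x \<in> W1 \<Longrightarrow> y \<in> W1 \<Longrightarrow> norm (snd c x - snd c y) \<le> K1 * d x y"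
    using adapted_metric_local[OF adapted p] by metis
  have "p \<in> fst c" using 1(3,4) by blast
  from riemannian_dist_local[OF 1(1) this] obtain W2 K2 where 2: "open W2" "p \<in> W2" "0 < K2"
    "\<forall>x\<in>W2. \<forall>y\<in>W2. riemannian_dist A g x y \<le> ennreal (K2 * norm (snd c x - snd c y)) \<and>
    ennreal (norm (snd c x - snd c y)) \<le> ennreal K2 * riemannian_dist A g x y" by (elim exE conjE)
  have "ennreal (d x y) \<le> ennreal (K1 * K2) * riemannian_dist A g x y \<and>
      riemannian_dist A g x y \<le> ennreal (K1 * K2) * ennreal (d x y)"
    if xy: "x \<in> W1 \<inter> W2" "y \<in> W1 \<inter> W2" for x y
  proof
    have R: "riemannian_dist A g x y \<le> ennreal (K2 * norm (snd c x - snd c y))"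
      "ennreal (norm (snd c x - snd c y)) \<le> ennreal K2 * riemannian_dist A g x y" using 2(4) xy by blast+
    have D: "d x y \<le> K1 * norm (snd c x - snd c y)" "norm (snd c x - snd c y) \<le> K1 * d x y"
      using 1(6,7)[of x y] xy by simp_all
    have "ennreal (d x y) \<le> ennreal K1 * ennreal (norm (snd c x - snd c y))"
      using D(1) 1(5) by (simp add: ennreal_mult[symmetric] ennreal_leI)
    also have "\<dots> \<le> ennreal K1 * (ennreal K2 * riemannian_dist A g x y)" by (rule mult_left_mono[OF R(2)]) simp
    also have "\<dots> = ennreal (K1 * K2) * riemannian_dist A g x y" using 1(5) 2(3) by (simp add: ennreal_mult mult.assoc)
    finally show "ennreal (d x y) \<le> ennreal (K1 * K2) * riemannian_dist A g x y" .
    have "K2 * norm (snd c x - snd c y) \<le> K2 * (K1 * d x y)" using D(2) 2(3) by (intro mult_left_mono) simp_all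
    then have "ennreal (K2 * norm (snd c x - snd c y)) \<le> ennreal (K2 * (K1 * d x y))" by (rule ennreal_leI)
    also have "\<dots> = ennreal (K1 * K2) * ennreal (d x y)"
      using 1(5) 2(3) d_nonneg by (simp add: ennreal_mult[symmetric] mult_ac)
    finally show "riemannian_dist A g x y \<le> ennreal (K1 * K2) * ennreal (d x y)" using R(1) by (rule order_trans[rotated])
  qed
  moreover have "open (W1 \<inter> W2)" using 1(2) 2(1) by (rule open_Int)
  ultimately show ?thesis using 1(3,5) 2(2,3) by (intro exI[of _ "W1 \<inter> W2"] exI[of _ "K1 * K2"] conjI ballI) simp_all
qed

lemma hausdorff_null_dist_iff:
  assumes "Z \<subseteq> J" "0 < s"
  shows "hausdorff_outer_measure (riemannian_dist A g) s Z = 0 \<longleftrightarrow>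
    hausdorff_outer_measure (\<lambda>x y. ennreal (d x y)) s Z = 0"
proof
  assume "hausdorff_outer_measure (riemannian_dist A g) s Z = 0"
  then show "hausdorff_outer_measure (\<lambda>x y. ennreal (d x y)) s Z = 0"
  proof (rule hausdorff_null_local_lipschitz[OF compact_J assms])
    fix p assume "p \<in> J"
    from dist_compare[OF this] obtain W K where "open W" "p \<in> W" "0 < K" "\<forall>x\<in>W. \<forall>y\<in>W.
      ennreal (d x y) \<le> ennreal K * riemannian_dist A g x y \<and> riemannian_dist A g x y \<le> ennreal K * ennreal (d x y)"
      by (elim exE conjE)
    then show "\<exists>W K. open W \<and> p \<in> W \<and> 0 < K \<and>
        (\<forall>x\<in>W. \<forall>y\<in>W. ennreal (d x y) \<le> ennreal K * riemannian_dist A g x y)"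
      by (intro exI[of _ W] exI[of _ K]) simp
  qed
next
  assume "hausdorff_outer_measure (\<lambda>x y. ennreal (d x y)) s Z = 0"
  then show "hausdorff_outer_measure (riemannian_dist A g) s Z = 0"
  proof (rule hausdorff_null_local_lipschitz[OF compact_J assms])
    fix p assume "p \<in> J"
    from dist_compare[OF this] obtain W K where "open W" "p \<in> W" "0 < K" "\<forall>x\<in>W. \<forall>y\<in>W.
      ennreal (d x y) \<le> ennreal K * riemannian_dist A g x y \<and> riemannian_dist A g x y \<le> ennreal K * ennreal (d x y)"
      by (elim exE conjE)
    then show "\<exists>W K. open W \<and> p \<in> W \<and> 0 < K \<and>
        (\<forall>x\<in>W. \<forall>y\<in>W. riemannian_dist A g x y \<le> ennreal K * ennreal (d x y))"
      by (intro exI[of _ W] exI[of _ K]) simp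
  qed
qed

section \<open>Small sets that carry all ergodic measures of small dimension\<close>

lemma J_borel: "J \<in> sets borel"
  using compact_J by (intro borel_closed compact_imp_closed)

lemma piece_borel:
  "S \<in> sets borel \<Longrightarrow> piece \<alpha> \<beta> k \<epsilon> \<epsilon>' S \<in> sets borel"
  unfolding piece_def by (intro sets.Int freq_set_borel J_borel growth_set_borel)

lemma piece_subset: "piece \<alpha> \<beta> k \<epsilon> \<epsilon>' S \<subseteq> J"
  by (auto simp: piece_def freq_set_def)

text \<open>\<open>Z\<close> is fixed before \<open>\<nu>\<close>: it collects every admissible
  piece that happens to be null, whichever measure it arises from. The conclusion is thus uniform in
  \<open>\<nu>\<close> and can be integrated against \<open>\<tau>\<close>.\<close>

lemma small_dim_set:
  fixes \<B> :: "'a set set"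
  assumes acr: "average_conformal_repeller A g f J" and B: "countable \<B>" "topological_basis \<B>"
    and t: "0 < t" "t < t'"
  shows "\<exists>Z. Z \<in> sets borel \<and> hausdorff_dim (riemannian_dist A g) Z \<le> ennreal t' \<and>
    (\<forall>\<nu>\<in>ergodic_measures f J. hausdorff_dim_measure (riemannian_dist A g) \<nu> < ennreal t \<longrightarrow> emeasure \<nu> Z = 1)"
proof -
  let ?\<rho> = "riemannian_dist A g"
  let ?d = "\<lambda>x y. ennreal (d x y)"
  define P where "P = (\<lambda>(\<alpha>, \<beta>, k, \<epsilon>, \<epsilon>', F). piece \<alpha> \<beta> k \<epsilon> \<epsilon>' (\<Union>F))"
  define I where "I = {i \<in> \<rat> \<times> \<rat> \<times> UNIV \<times> \<rat> \<times> \<rat> \<times> {F. finite F \<and> F \<subseteq> \<B>}.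
    hausdorff_outer_measure ?d t' (P i) = 0}"
  have "countable {F. finite F \<and> F \<subseteq> \<B>}" using B(1) by (rule countable_Collect_finite_subset)
  then have "countable I" unfolding I_def
    by (intro countable_Collect countable_SIGMA countable_rat) simp_all
  define Z where "Z = (\<Union>i\<in>I. P i)"
  have "P i \<in> sets borel" if "i \<in> I" for i
  proof -
    obtain \<alpha> \<beta> k \<epsilon> \<epsilon>' F where i: "i = (\<alpha>, \<beta>, k, \<epsilon>, \<epsilon>', F)" by (cases i)
    then have "F \<subseteq> \<B>" using that by (simp add: I_def)
    then have "open (\<Union>F)" using topological_basis_open[OF B(2)] by (intro open_Union) blast
    then show ?thesis unfolding i P_def by (simp add: piece_borel)
  qed
  then have Z: "Z \<in> sets borel" unfolding Z_def using \<open>countable I\<close> by (intro sets.countable_UN'') simp_all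
  have "P i \<subseteq> J" for i unfolding P_def case_prod_beta by (rule piece_subset)
  then have ZJ: "Z \<subseteq> J" unfolding Z_def by (intro UN_least)
  have "hausdorff_outer_measure ?d t' Z = 0"
    unfolding Z_def using \<open>countable I\<close> by (rule hausdorff_null_UN_countable) (simp add: I_def)
  then have "hausdorff_outer_measure ?\<rho> t' Z = 0"
    using hausdorff_null_dist_iff[OF ZJ] t by simp
  then have dim: "hausdorff_dim ?\<rho> Z \<le> ennreal t'" using t by (intro hausdorff_dim_le) simp_all
  obtain C r where Cr: "0 \<le> C" "0 < r" "\<forall>y\<in>J. \<forall>z\<in>J. d y z < r \<longrightarrow>
    d y z \<le> exp C * d (f y) (f z) \<and> d (f y) (f z) \<le> exp C * d y z"
    using step_compare by (elim exE conjE)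
  have "emeasure \<nu> Z = 1" if \<nu>: "\<nu> \<in> ergodic_measures f J" and less: "hausdorff_dim_measure ?\<rho> \<nu> < ennreal t" for \<nu>
  proof -
    have inv: "\<nu> \<in> invariant_measures f J" using \<nu> by (simp add: ergodic_measures_def)
    have sets: "sets \<nu> = sets borel" and "prob_space \<nu>" and \<nu>J: "emeasure \<nu> J = 1"
      using inv by (simp_all add: invariant_measures_def)
    interpret prob_space \<nu> by fact
    have AE_J: "AE x in \<nu>. x \<in> J" using \<nu>J by (intro AE_prob_1) (simp add: measure_def)
    obtain L where L: "lyapunov_exponents A g f \<nu> L" "\<forall>i\<in>{1..DIM('b)}. L i = L 1 \<and> L i > 0"
      using acr \<nu> unfolding average_conformal_repeller_def by blast
    have "1 \<in> {1..DIM('b)}" using DIM_positive[where 'a='b] by (simp add: Suc_leI)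
    then have L1: "0 < L 1" using L(2) by blast
    have Leq: "\<forall>i\<in>{1..DIM('b)}. L i = L 1" using L(2) by blast
    obtain Y where Y: "Y \<in> sets borel" "emeasure \<nu> Y = 1" "hausdorff_dim ?\<rho> Y < ennreal t"
      using less unfolding hausdorff_dim_measure_def Inf_less_iff by blast
    \<comment> \<open>The two distances are compared only near \<open>J\<close>, so the carrier is
      cut down to \<open>J\<close>, which has full measure.\<close>
    have "hausdorff_outer_measure ?\<rho> t (Y \<inter> J) = 0"
      by (rule hausdorff_null_mono[OF hausdorff_null_of_dim_less[OF Y(3)]]) simp
    then have Y0: "hausdorff_outer_measure ?d t (Y \<inter> J) = 0"
      using hausdorff_null_dist_iff[of "Y \<inter> J" t] t by simp
    \<comment> \<open>A single piece has measure only close to 1; \<open>Z\<close> contains a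
      suitable piece for every \<open>\<eta>\<close>.\<close>
    have approx: "1 - \<eta> \<le> prob Z" if \<eta>: "0 < \<eta>" "\<eta> \<le> 1" for \<eta>
    proof -
      have "\<exists>\<alpha>\<in>\<rat>. \<exists>\<beta>\<in>\<rat>. \<exists>k. \<exists>\<epsilon>\<in>\<rat>. \<exists>\<epsilon>'\<in>\<rat>. \<exists>F. finite F \<and> F \<subseteq> \<B> \<and>
        hausdorff_outer_measure ?d t' (piece \<alpha> \<beta> k \<epsilon> \<epsilon>' (\<Union>F)) = 0 \<and>
        1 - \<eta> \<le> prob (piece \<alpha> \<beta> k \<epsilon> \<epsilon>' (\<Union>F))"
      proof (rule ergodic_piece[OF \<nu> compact_J J_borel B Cr(1,2) _ L1 _ t Y(1,2) Y0 \<eta>])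
        show "AE x in \<nu>. \<exists>k. x \<in> growth_set \<alpha> \<beta> k" if "\<alpha> < L 1" "L 1 < \<beta>" for \<alpha> \<beta>
          by (rule growth_of_exponents[OF L(1) Leq AE_J that])
        show "d x y \<le> exp C * d (f x) (f y) \<and> d (f x) (f y) \<le> exp C * d x y"
          if "x \<in> J" "y \<in> J" "d x y < r" for x y
          using Cr(3) that by simp
      qed
      then obtain \<alpha> \<beta> k \<epsilon> \<epsilon>' F where i: "\<alpha> \<in> \<rat>" "\<beta> \<in> \<rat>" "\<epsilon> \<in> \<rat>" "\<epsilon>' \<in> \<rat>" "finite F" "F \<subseteq> \<B>"
        "hausdorff_outer_measure ?d t' (piece \<alpha> \<beta> k \<epsilon> \<epsilon>' (\<Union>F)) = 0"
        "1 - \<eta> \<le> prob (piece \<alpha> \<beta> k \<epsilon> \<epsilon>' (\<Union>F))" by (elim bexE exE conjE)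
      have "(\<alpha>, \<beta>, k, \<epsilon>, \<epsilon>', F) \<in> I" using i by (simp add: I_def P_def)
      then have "P (\<alpha>, \<beta>, k, \<epsilon>, \<epsilon>', F) \<subseteq> Z" unfolding Z_def by (rule UN_upper)
      then have "prob (piece \<alpha> \<beta> k \<epsilon> \<epsilon>' (\<Union>F)) \<le> prob Z"
        by (intro finite_measure_mono) (use Z sets in \<open>simp_all add: P_def\<close>)
      with i(8) show ?thesis by linarith
    qed
    have "1 \<le> prob Z"
    proof (rule field_le_epsilon)
      fix e :: real assume e: "0 < e"
      have "1 - min e 1 \<le> prob Z" using e approx[of "min e 1"] by simp
      then show "1 \<le> prob Z + e" by linarith
    qed
    then have "prob Z = 1" using prob_le_1[of Z] by linarith
    then show ?thesis by (simp add: emeasure_eq_measure)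
  qed
  with Z dim show ?thesis by (intro exI[of _ Z] conjI ballI impI)
qed

end

theorem theorem4p4:
  fixes A :: "('a::{t2_space, second_countable_topology}, 'b::euclidean_space) chart set"
    and g :: "'a \<Rightarrow> 'b \<Rightarrow> 'b \<Rightarrow> real"
    and f :: "'a \<Rightarrow> 'a" and J :: "'a set"
    and \<mu> :: "'a measure" and \<tau> :: "'a measure measure"
  assumes "smooth_atlas A" and "riemannian_metric A g"
    and "C1_map A f"
    and "average_conformal_repeller A g f J"
    and "\<mu> \<in> invariant_measures f J"
    and "ergodic_decomposition f J \<mu> \<tau>"
  shows "hausdorff_dim_measure (riemannian_dist A g) \<mu> =
    essential_sup_on \<tau> (ergodic_measures f J) (hausdorff_dim_measure (riemannian_dist A g))"
proof (rule antisym)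
  let ?\<rho> = "riemannian_dist A g"
  interpret riemannian_manifold A g by unfold_locales fact+
  have rep: "repeller A g f J" using assms(4) by (simp add: average_conformal_repeller_def)
  then have "compact J" by (simp add: repeller_def)
  then obtain d where d: "adapted_metric J d" using adapted_metric_exists by blast
  interpret expanding_dynamics A g f J d by unfold_locales fact+
  obtain \<B> :: "'a set set" where B: "countable \<B>" "topological_basis \<B>"
    using ex_countable_basis by blast
  show "hausdorff_dim_measure ?\<rho> \<mu> \<le> essential_sup_on \<tau> (ergodic_measures f J) (hausdorff_dim_measure ?\<rho>)"
    unfolding essential_sup_on_def
  proof (rule Inf_greatest, elim CollectE)
    fix z assume z: "AE \<nu> in \<tau>. \<nu> \<in> ergodic_measures f J \<longrightarrow> hausdorff_dim_measure ?\<rho> \<nu> \<le> z"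
    show "hausdorff_dim_measure ?\<rho> \<mu> \<le> z"
    proof (cases z)
      case (real r)
      show ?thesis
      proof (rule ennreal_le_epsilon)
        fix e :: real assume e: "0 < e"
        \<comment> \<open>Strictly above the essential bound, as the hypothesis on dimensions in
          \<open>small_dim_set\<close> is strict, positive even if r = 0, and below the second
          exponent r + e.\<close>
        define t where "t = r + e / 2"
        have t: "0 < t" "t < r + e" using real e by (simp_all add: t_def)
        from small_dim_set[OF assms(4) B t] obtain Z where Z: "Z \<in> sets borel"
          "hausdorff_dim ?\<rho> Z \<le> ennreal (r + e)"
          "\<forall>\<nu>\<in>ergodic_measures f J. hausdorff_dim_measure ?\<rho> \<nu> < ennreal t \<longrightarrow> emeasure \<nu> Z = 1"
          by (elim exE conjE)
        have "z < ennreal t" using real e by (simp add: t_def ennreal_less_iff)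
        from z have "AE \<nu> in \<tau>. \<nu> \<in> ergodic_measures f J \<longrightarrow> emeasure \<nu> Z = 1"
        proof eventually_elim
          case (elim \<nu>)
          then show ?case using Z(3) \<open>z < ennreal t\<close> order_le_less_trans by blast
        qed
        then have "emeasure \<mu> Z = 1"
          using ergodic_decomposition_full_measure[OF assms(6,5) Z(1)] by blast
        then have "hausdorff_dim_measure ?\<rho> \<mu> \<le> hausdorff_dim ?\<rho> Z"
          unfolding hausdorff_dim_measure_def using Z(1) by (intro Inf_lower) blast
        also note Z(2)
        also have "ennreal (r + e) = z + ennreal e" using real e by (simp add: ennreal_plus)
        finally show "hausdorff_dim_measure ?\<rho> \<mu> \<le> z + ennreal e" .
      qed
    qed simp
  qed
  show "essential_sup_on \<tau> (ergodic_measures f J) (hausdorff_dim_measure ?\<rho>) \<le> hausdorff_dim_measure ?\<rho> \<mu>"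
    by (rule hausdorff_dim_measure_ge_ess_sup[OF assms(6,5)])
qed

end
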